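(* Let $A\subset\mathbb{R}$ be a finite nonempty set. Then for every $\epsilon>0$, \[\max(|A+A|,|AA|)\gg_\epsilon |A|^{c_1-\epsilon}\qquad\text{and}\qquad \max(|A-A|,|A+A|,|AA|)\gg_\epsilon |A|^{c_2-\epsilon},\] where $c_1=\frac{1270}{951}$ and $c_2=\frac{144511}{108174}$.
   Context: $A+A=\{a+b:a,b\in A\}$, $A-A=\{a-b:a,b\in A\}$, $AA=\{ab:a,b\in A\}$. $X\ll_\epsilon Y$ (equivalently $Y\gg_\epsilon X$) means $X\le C_\epsilon Y$ with $C_\epsilon$ depending only on $\epsilon$. *)

theory Defs
  imports Complex_Main "HOL-Library.Set_Algebras"
begin

text \<open>
  The sumset and the product set are the pointwise operations \<open>A + B\<close> and \<open>A * B\<close> on sets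
  from \<open>Set_Algebras\<close>. The set of differences needs its own definition, because \<open>A - B\<close> on
  sets denotes the set-theoretic difference.
\<close>

definition difference_set :: "'a::minus set \<Rightarrow> 'a set \<Rightarrow> 'a set" where
  "difference_set A B = {a - b | a b. a \<in> A \<and> b \<in> B}"

end

theory Submission
  imports Defs "HOL-Analysis.Convex"
begin

text \<open>
  Let \<open>N = card A\<close> and let \<open>K\<close> bound the sets involved; we may take \<open>A\<close> positive. Solymosi's argument sums
  points of \<open>A \<times> A\<close> on consecutive lines through the origin. Following Konyagin and Shkredov, all
  pairs of lines from blocks of \<open>L\<close> consecutive slopes are used: either this gains a factor \<open>L\<close>, or many fibres
  \<open>A\<^sub>\<nu> = {u\<in>A. \<nu> u \<in> A}\<close> satisfy a three-term linear equation very often. In the second case an inequality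
  of Elekes--Ruzsa type makes the products \<open>A\<^sub>\<nu> A\<close> nearly distinct, and as these products lie in
  \<open>AA \<inter> \<nu> AA\<close> (Katz--Koester), the slopes \<open>\<nu>\<close> nearly preserve \<open>AA\<close>. Hence a large subset \<open>A'\<close> of \<open>A\<close>
  has, up to dilation, very many factorizations through slopes and \<open>AA\<close>, and Szemeredi--Trotter makes \<open>A'\<close>
  controlled: the level sets of \<open>rep A' B\<close> satisfy a cubic bound for all \<open>B\<close>. Controlled sets have large
  difference sets (Schoen--Shkredov, exponent 8/5) and sumsets (Rudnev--Stevens, exponent 30/19).

  All incidence bounds concern rich lines in Cartesian products, where Szemeredi--Trotter is elementary.
  The levels of \<open>\<nu> \<mapsto> card A\<^sub>\<nu>\<close> are weighted by a power slightly larger than 2; this makes the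
  control marginally better than required, so that the exponent 8/5 for differences suffices and all
  logarithmic losses are absorbed.
\<close>

section \<open>Rich lines in Cartesian products\<close>


text \<open>Let q be half the exponent in the weight of a level, N the size of the set and K the
  bound on its sumset and product set. Up to constants and logarithms, a level of n slopes with
  fibres of size t yields control with \<kappa>^q = K^(5q + 24) N^(-6q) n^(-q - 21/2) t^(3q - 27).
  The multiplicative energy forces n t^(2q) >= N^(4q) K^(1 - 2q), counting pairs gives n t <= N^2,
  and the worst case is t = N^2 / K, n = K, where \<kappa>^q = K^(q + 81/2) N^(-54). The closing
  inequalities N^41 << \<kappa>^11 K^19 and N^11 << \<kappa>^3 K^5 turn q = 1 into the exponents
  1270/951, which is c_1 exactly and leaves nothing for logarithms, and 346/259, which is just below
  c_2. For q = 51/50 they become 10597/7935 and 2887/2161. Both exceed the targets by about 4 *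
  10^(-5), and this margin pays for the logarithms, for the constants and for the loss of size in
  passing to a regular subset.\<close>

lemma weighted_image_Cauchy_Schwarz:
  fixes g :: "'a \<Rightarrow> real"
  assumes "finite W"
  shows "(\<Sum>w\<in>W. g w)\<^sup>2 \<le> card (h ` W) * (\<Sum>(w, w')\<in>{(w, w'). w \<in> W \<and> w' \<in> W \<and> h w = h w'}. g w * g w')"
proof -
  define F where "F y = (\<Sum>w\<in>{w\<in>W. h w = y}. g w)" for y
  have 1: "(\<Sum>w\<in>W. g w) = (\<Sum>y\<in>h ` W. 1 * F y)"
    unfolding F_def by (simp add: sum.image_gen[OF assms, of g h])
  have 2: "(\<Sum>y\<in>h ` W. 1 * F y)\<^sup>2 \<le> (\<Sum>y\<in>h ` W. 1\<^sup>2) * (\<Sum>y\<in>h ` W. (F y)\<^sup>2)"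
    by (rule Cauchy_Schwarz_ineq_sum)
  have 3: "(\<Sum>y\<in>h ` W. (F y)\<^sup>2) = (\<Sum>y\<in>h ` W. \<Sum>p\<in>{w\<in>W. h w = y} \<times> {w\<in>W. h w = y}. g (fst p) * g (snd p))"
    unfolding F_def power2_eq_square by (simp add: sum_product sum.cartesian_product split_def)
  also have "\<dots> = (\<Sum>p\<in>(\<Union>y\<in>h ` W. {w\<in>W. h w = y} \<times> {w\<in>W. h w = y}). g (fst p) * g (snd p))"
    by (rule sum.UNION_disjoint[symmetric]) (use assms in auto)
  also have "(\<Union>y\<in>h ` W. {w\<in>W. h w = y} \<times> {w\<in>W. h w = y}) = {(w, w'). w \<in> W \<and> w' \<in> W \<and> h w = h w'}"
    by auto
  finally show ?thesis
    using 1 2 by (simp add: split_def)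
qed

lemma image_Cauchy_Schwarz:
  assumes "finite W"
  shows "(card W)\<^sup>2 \<le> card (h ` W) * card {(w, w'). w \<in> W \<and> w' \<in> W \<and> h w = h w'}"
proof -
  have "(real (card W))\<^sup>2 \<le> real (card (h ` W)) * real (card {(w, w'). w \<in> W \<and> w' \<in> W \<and> h w = h w'})"
    using weighted_image_Cauchy_Schwarz[OF assms, of "\<lambda>_. 1" h] by (simp add: split_def)
  then have "real ((card W)\<^sup>2) \<le> real (card (h ` W) * card {(w, w'). w \<in> W \<and> w' \<in> W \<and> h w = h w'})"
    by simp
  then show ?thesis
    by (simp only: of_nat_le_iff)
qed

lemma dyadic_level_exists:
  fixes n :: nat
  assumes "1 \<le> n" "n < 2 ^ l"
  shows "\<exists>i<l. 2 ^ i \<le> n \<and> n < 2 ^ (i + 1)"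
proof -
  obtain i where i: "2 ^ i \<le> n" "n < 2 ^ (i + 1)"
    using ex_power_ivl1[of 2 n] assms by auto
  have "(2::nat) ^ i < 2 ^ l" using i(1) assms(2) by (rule le_less_trans)
  then have "i < l" by simp
  then show ?thesis using i by blast
qed

lemma dyadic_sum_le:
  fixes g :: "'a \<Rightarrow> real"
  assumes "finite \<Omega>" "\<And>w. w \<in> \<Omega> \<Longrightarrow> 1 \<le> f w \<and> f w < (2::nat) ^ l" "\<And>w. w \<in> \<Omega> \<Longrightarrow> 0 \<le> g w"
  shows "(\<Sum>w\<in>\<Omega>. g w) \<le> (\<Sum>i<l. \<Sum>w\<in>{w\<in>\<Omega>. 2 ^ i \<le> f w \<and> f w < 2 ^ (i + 1)}. g w)"
proof -
  let ?P = "\<lambda>i w. 2 ^ i \<le> f w \<and> f w < (2::nat) ^ (i + 1)"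
  have "g w \<le> (\<Sum>i\<in>{i\<in>{..<l}. ?P i w}. g w)" if w: "w \<in> \<Omega>" for w
  proof -
    obtain i where "i < l" "?P i w" using dyadic_level_exists assms(2)[OF w] by blast
    then have "(\<Sum>i\<in>{i}. g w) \<le> (\<Sum>i\<in>{i\<in>{..<l}. ?P i w}. g w)"
      by (intro sum_mono2) (use assms(3)[OF w] in auto)
    then show ?thesis by simp
  qed
  then have "(\<Sum>w\<in>\<Omega>. g w) \<le> (\<Sum>w\<in>\<Omega>. \<Sum>i\<in>{i\<in>{..<l}. ?P i w}. g w)"
    by (rule sum_mono)
  also have "\<dots> = (\<Sum>i<l. \<Sum>w\<in>{w\<in>\<Omega>. ?P i w}. g w)"
    by (rule sum.swap_restrict) (use assms in auto)
  finally show ?thesis .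
qed

lemma dyadic_pigeonhole:
  fixes g :: "'a \<Rightarrow> real"
  assumes "finite \<Omega>" "\<And>w. w \<in> \<Omega> \<Longrightarrow> 1 \<le> f w \<and> f w < (2::nat) ^ l" "\<And>w. w \<in> \<Omega> \<Longrightarrow> 0 \<le> g w" "0 < l"
  shows "\<exists>i<l. (\<Sum>w\<in>\<Omega>. g w) \<le> real l * (\<Sum>w\<in>{w\<in>\<Omega>. 2 ^ i \<le> f w \<and> f w < 2 ^ (i + 1)}. g w)"
proof (rule ccontr)
  assume *: "\<not> ?thesis"
  let ?s = "\<lambda>i. \<Sum>w\<in>{w\<in>\<Omega>. 2 ^ i \<le> f w \<and> f w < 2 ^ (i + 1)}. g w"
  have "(\<Sum>i<l. real l * ?s i) < (\<Sum>i<l. \<Sum>w\<in>\<Omega>. g w)"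
    by (rule sum_strict_mono) (use * assms in \<open>auto simp: not_le\<close>)
  then have "real l * (\<Sum>i<l. ?s i) < real l * (\<Sum>w\<in>\<Omega>. g w)"
    by (simp add: sum_distrib_left)
  moreover have "(\<Sum>w\<in>\<Omega>. g w) \<le> (\<Sum>i<l. ?s i)"
    by (rule dyadic_sum_le) (use assms in auto)
  ultimately show False using assms(4) by simp
qed

section \<open>Szemeredi--Trotter for rich lines in a grid\<close>

text \<open>The intervals \<open>]\<phi> u, \<phi> (next u)]\<close> are disjoint, so their point counts add up to at most \<open>card V\<close>.\<close>
lemma sum_card_consecutive_gaps_le:
  fixes \<phi> :: "real \<Rightarrow> real"
  assumes "finite X" "finite V" "strict_mono \<phi>"
  shows "(\<Sum>u\<in>X - {Max X}. card {z\<in>V. \<phi> u < z \<and> z \<le> \<phi> (Min {z\<in>X. u < z})}) \<le> card V"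
proof -
  let ?J = "\<lambda>u. {z\<in>V. \<phi> u < z \<and> z \<le> \<phi> (Min {z\<in>X. u < z})}"
  have dis: "?J u \<inter> ?J w = {}" if "u \<in> X" "w \<in> X" "u < w" for u w
  proof -
    have "Min {z\<in>X. u < z} \<le> w" using that assms by (intro Min_le) auto
    then have "\<phi> (Min {z\<in>X. u < z}) \<le> \<phi> w" using assms(3) by (simp add: strict_mono_less_eq)
    then show ?thesis by auto
  qed
  have "(\<Sum>u\<in>X - {Max X}. card (?J u)) = card (\<Union>u\<in>X - {Max X}. ?J u)"
  proof (rule card_UN_disjoint[symmetric])
    show "\<forall>u\<in>X - {Max X}. \<forall>w\<in>X - {Max X}. u \<noteq> w \<longrightarrow> ?J u \<inter> ?J w = {}"
    proof (intro ballI impI)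
      fix u w assume uw: "u \<in> X - {Max X}" "w \<in> X - {Max X}" "u \<noteq> w"
      consider "u < w" | "w < u" using uw(3) by linarith
      then show "?J u \<inter> ?J w = {}"
      proof cases
        case 1 then show ?thesis using dis[of u w] uw by blast
      next
        case 2 then show ?thesis using dis[of w u] uw by blast
      qed
    qed
  qed (use assms in auto)
  also have "\<dots> \<le> card V" using assms by (intro card_mono) auto
  finally show ?thesis .
qed

text \<open>Markov's inequality: the gaps share at most \<open>card V\<close> points, so at most k /
  8 of them can hold more than 8 \<open>card V\<close> / k. The 8 leaves room for two exceptional
  sets, one for each coordinate.\<close>

lemma card_long_gaps_less:
  fixes \<phi> :: "real \<Rightarrow> real"
  assumes "finite X" "finite V" "strict_mono \<phi>" "0 < k"
  shows "8 * card {u\<in>X - {Max X}. 8 * card V < k * card {z\<in>V. \<phi> u < z \<and> z \<le> \<phi> (Min {z\<in>X. u < z})}} \<le> k"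
proof -
  let ?c = "\<lambda>u. card {z\<in>V. \<phi> u < z \<and> z \<le> \<phi> (Min {z\<in>X. u < z})}"
  let ?B = "{u\<in>X - {Max X}. 8 * card V < k * ?c u}"
  show ?thesis
  proof (cases "card V = 0")
    case True
    then have "V = {}" using assms(2) by simp
    then show ?thesis by simp
  next
    case False
    have "card ?B * (8 * card V) = (\<Sum>u\<in>?B. 8 * card V)" by simp
    also have "\<dots> \<le> (\<Sum>u\<in>?B. k * ?c u)" by (rule sum_mono) auto
    also have "\<dots> \<le> (\<Sum>u\<in>X - {Max X}. k * ?c u)" by (rule sum_mono2) (use assms in auto)
    also have "\<dots> \<le> k * card V"
      using sum_card_consecutive_gaps_le[OF assms(1-3)] by (simp add: sum_distrib_left[symmetric])
    finally show ?thesis using False by (simp add: mult.commute mult.left_commute)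
  qed
qed

text \<open>The largest such z has all the others between u and itself, so its own bound on the
  points of V passed over bounds their number.\<close>

lemma card_short_gap_le:
  fixes u :: real
  assumes "finite V"
  shows "k * card {z\<in>V. u < z \<and> k * card {y\<in>V. u < y \<and> y \<le> z} \<le> T} \<le> (T :: nat)"
proof -
  let ?Y = "{z\<in>V. u < z \<and> k * card {y\<in>V. u < y \<and> y \<le> z} \<le> T}"
  show ?thesis
  proof (cases "?Y = {}")
    case False
    have fin: "finite ?Y" using assms by simp
    have m: "Max ?Y \<in> ?Y" using Max_in[OF fin False] .
    have "card ?Y \<le> card {y\<in>V. u < y \<and> y \<le> Max ?Y}"
      by (rule card_mono) (use assms Max_ge[OF fin] in auto)
    then have "k * card ?Y \<le> k * card {y\<in>V. u < y \<and> y \<le> Max ?Y}" by simp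
    also have "\<dots> \<le> T" using m by blast
    finally show ?thesis .
  next
    case True
    then show ?thesis by (metis card.empty mult_0_right zero_le)
  qed
qed

text \<open>
  The Szemeredi--Trotter bound for rich lines of positive slope in a Cartesian product. Most pairs
  of consecutive points on a \<open>k\<close>-rich line have rank differences \<open>O(card U / k)\<close> and
  \<open>O(card V / k)\<close> in the two coordinates, and there are few pairs of grid points with this property.
\<close>
lemma card_rich_lines_le:
  fixes U V :: "real set" and L :: "(real \<times> real) set"
  assumes U: "finite U" and V: "finite V" and L: "finite L" and k: "2 \<le> k"
    and rich: "\<And>\<mu> x. (\<mu>, x) \<in> L \<Longrightarrow> 0 < \<mu> \<and> k \<le> card {u\<in>U. \<mu> * u + x \<in> V}"
  shows "card L * k ^ 3 \<le> 256 * (card U)\<^sup>2 * (card V)\<^sup>2"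
proof -
  define X where "X = (\<lambda>(\<mu>, x). {u\<in>U. \<mu> * u + x \<in> V})"
  define nx where "nx p u = Min {z\<in>X p. u < z}" for p u
  define line where "line = (\<lambda>(\<mu>, x) u. \<mu> * u + x :: real)"
  define gU where "gU u u' = card {z\<in>U. u < z \<and> z \<le> u'}" for u u'
  define gV where "gV u u' = card {z\<in>V. u < z \<and> z \<le> u'}" for u u'
  define good where "good p = {u \<in> X p - {Max (X p)}.
     k * gU u (nx p u) \<le> 8 * card U \<and> k * gV (line p u) (line p (nx p u)) \<le> 8 * card V}" for p
  have fX: "finite (X p)" for p unfolding X_def using U by (cases p) auto
  have fg: "finite (good p)" for p unfolding good_def using fX by simp
  have mono: "strict_mono (line p)" if "p \<in> L" for p
    using rich[of "fst p" "snd p"] that unfolding line_def by (auto simp: strict_mono_def split_def)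
  have kX: "k \<le> card (X p)" if "p \<in> L" for p
    using rich[of "fst p" "snd p"] that unfolding X_def by (auto simp: split_def)
  have good_card: "k \<le> 4 * card (good p)" if p: "p \<in> L" for p
  proof -
    define B1 where "B1 = {u\<in>X p - {Max (X p)}. 8 * card U < k * gU u (nx p u)}"
    define B2 where "B2 = {u\<in>X p - {Max (X p)}. 8 * card V < k * gV (line p u) (line p (nx p u))}"
    have b1: "8 * card B1 \<le> k"
      unfolding B1_def gU_def nx_def
      using card_long_gaps_less[OF fX U, of id k p] k by (simp add: strict_mono_def)
    have b2: "8 * card B2 \<le> k"
      unfolding B2_def gV_def nx_def
      using card_long_gaps_less[OF fX V mono[OF p], of k p] k by simp
    have fB: "finite B1" "finite B2" unfolding B1_def B2_def using fX by simp_all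
    \<comment> \<open>Of at least k points, the last has no successor and at most k / 8 fail in each
      coordinate. As k >= 2, there remain k - 1 - k / 4 >= k / 4.\<close>
    have "X p \<subseteq> {Max (X p)} \<union> (good p \<union> (B1 \<union> B2))"
      unfolding good_def B1_def B2_def by auto
    then have "card (X p) \<le> card ({Max (X p)} \<union> (good p \<union> (B1 \<union> B2)))"
      by (rule card_mono[rotated]) (use fg fB in simp)
    also have "\<dots> \<le> 1 + (card (good p) + (card B1 + card B2))"
      using card_Un_le[of "{Max (X p)}" "good p \<union> (B1 \<union> B2)"] card_Un_le[of "good p" "B1 \<union> B2"]
        card_Un_le[of B1 B2] by simp
    finally show ?thesis using b1 b2 kX[OF p] k by linarith
  qed
  define PU where "PU = (SIGMA u:U. {u'\<in>U. u < u' \<and> k * gU u u' \<le> 8 * card U})"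
  define PV where "PV = (SIGMA v:V. {v'\<in>V. v < v' \<and> k * gV v v' \<le> 8 * card V})"
  have PU: "k * card PU \<le> 8 * (card U)\<^sup>2"
  proof -
    have "k * card PU = (\<Sum>u\<in>U. k * card {u'\<in>U. u < u' \<and> k * gU u u' \<le> 8 * card U})"
      unfolding PU_def using U by (simp add: sum_distrib_left)
    also have "\<dots> \<le> (\<Sum>u\<in>U. 8 * card U)" by (rule sum_mono) (rule card_short_gap_le[OF U, folded gU_def])
    finally show ?thesis by (simp add: power2_eq_square)
  qed
  have PV: "k * card PV \<le> 8 * (card V)\<^sup>2"
  proof -
    have "k * card PV = (\<Sum>u\<in>V. k * card {u'\<in>V. u < u' \<and> k * gV u u' \<le> 8 * card V})"
      unfolding PV_def using V by (simp add: sum_distrib_left)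
    also have "\<dots> \<le> (\<Sum>u\<in>V. 8 * card V)" by (rule sum_mono) (rule card_short_gap_le[OF V, folded gV_def])
    finally show ?thesis by (simp add: power2_eq_square)
  qed
  define G where "G = (SIGMA p:L. good p)"
  define h where "h = (\<lambda>(p, u). ((u, nx p u), (line p u, line p (nx p u))))"
  have nx: "nx p u \<in> X p \<and> u < nx p u" if "u \<in> good p" for p u
  proof -
    have u: "u \<in> X p" "u \<noteq> Max (X p)" using that unfolding good_def by auto
    then have "u < Max (X p)" "Max (X p) \<in> X p"
      using Max_ge[OF fX, of u p] Max_in[OF fX, of p] by (force, blast)
    then have "{z\<in>X p. u < z} \<noteq> {}" by blast
    then have "nx p u \<in> {z\<in>X p. u < z}" unfolding nx_def by (intro Min_in) (use fX in auto)
    then show ?thesis by blast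
  qed
  \<comment> \<open>Two distinct points determine their line, so consecutive points together with
    their images recover slope and intercept.\<close>
  have inj: "inj_on h G"
  proof (rule inj_onI)
    fix P Q assume PQ: "P \<in> G" "Q \<in> G" "h P = h Q"
    obtain \<mu> x u \<mu>' x' u' where p: "P = ((\<mu>, x), u)" and q: "Q = ((\<mu>', x'), u')"
      by (metis prod.collapse)
    have u: "u \<in> good (\<mu>, x)" using PQ p unfolding G_def by auto
    define n where "n = nx (\<mu>, x) u"
    have e: "u = u'" "n = nx (\<mu>', x') u'" "\<mu> * u + x = \<mu>' * u' + x'" "\<mu> * n + x = \<mu>' * n + x'"
      using PQ(3) unfolding h_def p q line_def n_def by auto
    have "\<mu> * (n - u) = \<mu>' * (n - u)" using e(1,3,4) by (simp add: algebra_simps)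
    moreover have "n - u \<noteq> 0" using nx[OF u] n_def by auto
    ultimately have "\<mu> = \<mu>'" by simp
    then show "P = Q" using e p q by simp
  qed
  have sub: "h ` G \<subseteq> PU \<times> PV"
  proof
    fix y assume "y \<in> h ` G"
    then obtain p u where y: "y = h (p, u)" and m: "p \<in> L" and u: "u \<in> good p"
      unfolding G_def by auto
    have X: "z \<in> U \<and> line p z \<in> V" if "z \<in> X p" for z
      using that unfolding X_def line_def by (cases p) auto
    have uX: "u \<in> X p" using u unfolding good_def by simp
    have lt: "line p u < line p (nx p u)" using mono[OF m] nx[OF u] by (simp add: strict_mono_def)
    show "y \<in> PU \<times> PV"
      using nx[OF u] u X[OF uX] X[of "nx p u"] lt unfolding y h_def PU_def PV_def good_def by simp
  qed
  have fP: "finite (PU \<times> PV)" unfolding PU_def PV_def using U V by auto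
  have "card L * k = (\<Sum>p\<in>L. k)" by simp
  also have "\<dots> \<le> (\<Sum>p\<in>L. 4 * card (good p))"
    by (rule sum_mono) (rule good_card)
  also have "\<dots> = 4 * card G"
    unfolding G_def using L fg by (simp add: sum_distrib_left)
  also have "card G \<le> card PU * card PV"
    using card_inj_on_le[OF inj sub fP] by (simp add: card_cartesian_product)
  \<comment> \<open>The extra factor k^2 supplies one k for each of \<open>PU\<close> and
    \<open>PV\<close>; 256 = 4 * 8 * 8.\<close>
  finally have "card L * k * k\<^sup>2 \<le> 4 * (card PU * card PV) * k\<^sup>2" by simp
  also have "\<dots> = 4 * ((k * card PU) * (k * card PV))" by (simp add: power2_eq_square)
  also have "\<dots> \<le> 4 * ((8 * (card U)\<^sup>2) * (8 * (card V)\<^sup>2))"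
    by (intro mult_le_mono PU PV order_refl)
  finally show ?thesis by (simp add: power3_eq_cube power2_eq_square mult.assoc)
qed

section \<open>Controlled sets\<close>

text \<open>\<open>rep A B x\<close> is the number of representations \<open>x = a - b\<close>.\<close>
definition rep :: "real set \<Rightarrow> real set \<Rightarrow> real \<Rightarrow> nat" where
  "rep A B x = card {b\<in>B. x + b \<in> A}"

text \<open>The ratio of \<kappa> to \<open>card A\<close> is a Szemeredi--Trotter constant of the
  set. Testing with \<open>B = {0}\<close> and \<rho> = 1 shows \<kappa> >= \<open>card A\<close>; a
  bound of this order is what convex sets satisfy.\<close>

definition controlled :: "real \<Rightarrow> real set \<Rightarrow> bool" where
  "controlled \<kappa> A \<longleftrightarrow> (\<forall>B \<rho>. finite B \<longrightarrow> 0 < \<rho> \<longrightarrow>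
     real (card {x. \<rho> \<le> rep A B x}) * real \<rho> ^ 3 \<le> \<kappa> * (real (card B))\<^sup>2)"

lemma controlledD:
  assumes "controlled \<kappa> A" "finite B" "0 < \<rho>"
  shows "real (card {x. \<rho> \<le> rep A B x}) * real \<rho> ^ 3 \<le> \<kappa> * (real (card B))\<^sup>2"
  using assms unfolding controlled_def by blast

lemma rep_le_right: "finite B \<Longrightarrow> rep A B x \<le> card B"
  unfolding rep_def by (intro card_mono) auto

lemma rep_le_left: "finite A \<Longrightarrow> rep A B x \<le> card A"
  unfolding rep_def by (rule card_inj_on_le[of "\<lambda>b. x + b"]) (auto simp: inj_on_def)

lemma finite_rep_support:
  assumes "finite A" "finite B" "0 < \<rho>"
  shows "finite {x. \<rho> \<le> rep A B x}"
proof (rule finite_subset)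
  show "{x. \<rho> \<le> rep A B x} \<subseteq> (\<lambda>(a, b). a - b) ` (A \<times> B)"
  proof
    fix x assume "x \<in> {x. \<rho> \<le> rep A B x}"
    then have "card {b\<in>B. x + b \<in> A} \<noteq> 0" using assms(3) unfolding rep_def by simp
    then obtain b where "b \<in> B" "x + b \<in> A" by (metis (mono_tags, lifting) card.empty empty_Collect_eq)
    then show "x \<in> (\<lambda>(a, b). a - b) ` (A \<times> B)" by (intro image_eqI[of _ _ "(x + b, b)"]) auto
  qed
qed (use assms in auto)

lemma sum_rep_le:
  assumes "finite A" "finite B" "finite X"
  shows "(\<Sum>x\<in>X. rep A B x) \<le> card A * card B"
proof -
  have "(\<Sum>x\<in>X. rep A B x) = card (SIGMA x:X. {b\<in>B. x + b \<in> A})"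
    unfolding rep_def using assms by simp
  also have "\<dots> \<le> card (A \<times> B)"
    by (rule card_inj_on_le[of "\<lambda>(x, b). (x + b, b)"]) (use assms in \<open>auto simp: inj_on_def\<close>)
  finally show ?thesis by (simp add: card_cartesian_product)
qed

lemma card_rep_level_le:
  assumes "finite A" "finite B"
  shows "card {x. \<rho> \<le> rep A B x} * \<rho> \<le> card A * card B"
proof (cases "\<rho> = 0")
  case False
  then have fin: "finite {x. \<rho> \<le> rep A B x}" using finite_rep_support[OF assms] by simp
  have "card {x. \<rho> \<le> rep A B x} * \<rho> = (\<Sum>x | \<rho> \<le> rep A B x. \<rho>)" by simp
  also have "\<dots> \<le> (\<Sum>x | \<rho> \<le> rep A B x. rep A B x)" by (rule sum_mono) simp
  also have "\<dots> \<le> card A * card B" by (rule sum_rep_le[OF assms fin])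
  finally show ?thesis .
qed simp

lemma controlled_nonneg:
  assumes "controlled \<kappa> A"
  shows "0 \<le> \<kappa>"
proof -
  have "real (card {x. 1 \<le> rep A {0} x}) * real 1 ^ 3 \<le> \<kappa> * (real (card {0::real}))\<^sup>2"
    by (rule controlledD[OF assms]) auto
  then show ?thesis by (smt (verit) card.empty card_insert_disjoint empty_iff finite.emptyI mult_cancel_left2 of_nat_0_le_iff of_nat_1 One_nat_def power_one)
qed

text \<open>Each \<open>x\<close> with many representations \<open>x = q r - b\<close> gives many incidences between the grid \<open>R \<times> B\<close> and the lines \<open>b = q r - x\<close>.\<close>
lemma controlled_if_many_factorizations:
  assumes A: "finite A" and Q: "finite Q" "\<And>q. q \<in> Q \<Longrightarrow> 0 < q" and R: "finite R" "\<And>r. r \<in> R \<Longrightarrow> 0 < r"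
    and t: "0 < t" "\<And>a. a \<in> A \<Longrightarrow> t \<le> card {q\<in>Q. a / q \<in> R}" and l: "card R < 2 ^ l" "0 < l"
  shows "controlled (2048 * real l ^ 3 * (real (card Q))\<^sup>2 * (real (card R))\<^sup>2 / real t ^ 3) A"
  unfolding controlled_def
proof (intro allI impI)
  fix B :: "real set" and \<rho> :: nat
  assume B: "finite B" and \<rho>: "0 < \<rho>"
  define D where "D = {x. \<rho> \<le> rep A B x}"
  have fD: "finite D" unfolding D_def using finite_rep_support[OF A B \<rho>] .
  define k where "k = (\<lambda>(q, y). card {r\<in>R. q * r + y \<in> B})"
  define \<Omega> where "\<Omega> = {p \<in> Q \<times> uminus ` D. 1 \<le> k p}"
  have f\<Omega>: "finite \<Omega>" unfolding \<Omega>_def using Q fD by simp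
  have kl: "k p < 2 ^ l" for p
  proof -
    have "k p \<le> card R" unfolding k_def using R by (cases p) (auto intro: card_mono)
    then show ?thesis using l by linarith
  qed
  define q where "q = real (card Q)"
  define r where "r = real (card R)"
  define b where "b = real (card B)"
  define d where "d = real (card D)"
  \<comment> \<open>Each of the \<rho> representations a = x + b comes with t factorizations a = q
    r, and every one of them puts the point (r, b) on the line of slope q and intercept -x.\<close>
  have inc: "\<rho> * t \<le> (\<Sum>q\<in>Q. k (q, - x))" if x: "x \<in> D" for x
  proof -
    have "\<rho> * t \<le> (\<Sum>b\<in>{b\<in>B. x + b \<in> A}. t)" using x unfolding D_def rep_def by simp
    also have "\<dots> \<le> (\<Sum>b\<in>{b\<in>B. x + b \<in> A}. card {q\<in>Q. (x + b) / q \<in> R})"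
      by (rule sum_mono) (use t in auto)
    also have "\<dots> = card (SIGMA b:{b\<in>B. x + b \<in> A}. {q\<in>Q. (x + b) / q \<in> R})"
      using B Q by simp
    also have "\<dots> \<le> card (SIGMA q:Q. {r\<in>R. q * r + - x \<in> B})"
    proof (rule card_inj_on_le[of "\<lambda>(b, q). (q, (x + b) / q)"])
      show "inj_on (\<lambda>(b, q). (q, (x + b) / q)) (SIGMA b:{b\<in>B. x + b \<in> A}. {q\<in>Q. (x + b) / q \<in> R})"
        using Q(2) by (force simp: inj_on_def)
      show "(\<lambda>(b, q). (q, (x + b) / q)) ` (SIGMA b:{b\<in>B. x + b \<in> A}. {q\<in>Q. (x + b) / q \<in> R})
          \<subseteq> (SIGMA q:Q. {r\<in>R. q * r + - x \<in> B})"
        using Q(2) by force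
    qed (use Q R in auto)
    also have "\<dots> = (\<Sum>q\<in>Q. k (q, - x))" unfolding k_def using Q R by simp
    finally show ?thesis .
  qed
  have "d * (real \<rho> * real t) = (\<Sum>x\<in>D. real (\<rho> * t))" unfolding d_def by simp
  also have "\<dots> \<le> (\<Sum>x\<in>D. real (\<Sum>q\<in>Q. k (q, - x)))"
    by (rule sum_mono) (use inc in \<open>simp only: of_nat_le_iff\<close>)
  also have "\<dots> = (\<Sum>q\<in>Q. \<Sum>x\<in>D. real (k (q, - x)))"
    by (subst sum.swap) simp
  also have "\<dots> = (\<Sum>q\<in>Q. \<Sum>y\<in>uminus ` D. real (k (q, y)))"
    by (simp add: sum.reindex)
  also have "\<dots> = (\<Sum>p\<in>Q \<times> uminus ` D. real (k p))" by (simp add: sum.cartesian_product)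
  also have "\<dots> = (\<Sum>p\<in>\<Omega>. real (k p))"
    unfolding \<Omega>_def by (rule sum.mono_neutral_right) (use Q fD in auto)
  finally have tot: "d * (real \<rho> * real t) \<le> (\<Sum>p\<in>\<Omega>. real (k p))" .
  obtain i where i: "(\<Sum>p\<in>\<Omega>. real (k p)) \<le> real l * (\<Sum>p\<in>{p\<in>\<Omega>. 2 ^ i \<le> k p \<and> k p < 2 ^ (i + 1)}. real (k p))"
    using dyadic_pigeonhole[OF f\<Omega>, of k l "\<lambda>p. real (k p)"] kl l unfolding \<Omega>_def by auto
  define L where "L = {p\<in>\<Omega>. 2 ^ i \<le> k p \<and> k p < 2 ^ (i + 1)}"
  define n where "n = real (card L)"
  have fL: "finite L" unfolding L_def using f\<Omega> by simp
  have "(\<Sum>p\<in>L. real (k p)) \<le> (\<Sum>p\<in>L. 2 * 2 ^ i)"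
  proof (rule sum_mono)
    fix p assume "p \<in> L"
    then have "k p < 2 ^ (i + 1)" unfolding L_def by blast
    then have "real (k p) < real (2 ^ (i + 1))" by (simp only: of_nat_less_iff)
    then show "real (k p) \<le> 2 * 2 ^ i" by simp
  qed
  then have tot2: "d * (real \<rho> * real t) \<le> 2 * real l * (2 ^ i * n)"
  proof -
    assume "(\<Sum>p\<in>L. real (k p)) \<le> (\<Sum>p\<in>L. 2 * 2 ^ i)"
    then have "real l * (\<Sum>p\<in>L. real (k p)) \<le> real l * (\<Sum>p\<in>L. 2 * 2 ^ i)"
      by (rule mult_left_mono) simp
    then show ?thesis using tot i[folded L_def] unfolding n_def by (simp add: mult_ac)
  qed
  have nQD: "n \<le> q * d"
  proof -
    have "card L \<le> card (Q \<times> uminus ` D)" unfolding L_def \<Omega>_def by (rule card_mono) (use Q fD in auto)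
    also have "\<dots> = card Q * card D" by (simp add: card_cartesian_product card_image)
    finally show ?thesis unfolding n_def q_def d_def by (simp only: of_nat_le_iff flip: of_nat_mult)
  qed
  have main: "d * (real \<rho> * real t) ^ 3 \<le> 2048 * real l ^ 3 * q\<^sup>2 * r\<^sup>2 * b\<^sup>2"
  proof (cases "D = {}")
    case False
    then have d: "d > 0" unfolding d_def using fD by (simp add: card_gt_0_iff)
    show ?thesis
    proof (cases "i = 0")
      case False
      then have i2: "(2::nat) \<le> 2 ^ i" using power_increasing[of 1 i "2::nat"] by simp
      have "card L * (2 ^ i) ^ 3 \<le> 256 * (card R)\<^sup>2 * (card B)\<^sup>2"
      proof (rule card_rich_lines_le[OF R(1) B fL i2])
        fix \<mu> x assume "(\<mu>, x) \<in> L"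
        then show "0 < \<mu> \<and> 2 ^ i \<le> card {u \<in> R. \<mu> * u + x \<in> B}"
          unfolding L_def \<Omega>_def k_def using Q(2) by auto
      qed
      then have rich: "n * (2 ^ i) ^ 3 \<le> 256 * r\<^sup>2 * b\<^sup>2"
      proof -
        assume "card L * (2 ^ i) ^ 3 \<le> 256 * (card R)\<^sup>2 * (card B)\<^sup>2"
        then have "real (card L * (2 ^ i) ^ 3) \<le> real (256 * (card R)\<^sup>2 * (card B)\<^sup>2)"
          by (rule of_nat_mono)
        then show ?thesis
          unfolding n_def r_def b_def by (simp only: of_nat_mult of_nat_power of_nat_numeral)
      qed
      \<comment> \<open>Of the factor n^3, one n goes to the rich-line bound and n^2 to the trivial
        count \<open>card Q * card D\<close>; the resulting d^2 cancels.\<close>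
      have "(d * (real \<rho> * real t)) ^ 3 \<le> (2 * real l * (2 ^ i * n)) ^ 3"
        by (rule power_mono[OF tot2]) (simp add: d_def)
      also have "\<dots> = 8 * real l ^ 3 * (n * (2 ^ i) ^ 3) * n\<^sup>2"
        by (simp add: power_mult_distrib power3_eq_cube power2_eq_square mult_ac)
      also have "\<dots> \<le> 8 * real l ^ 3 * (256 * r\<^sup>2 * b\<^sup>2) * (q * d)\<^sup>2"
        by (intro mult_mono power_mono rich nQD) (auto simp: n_def)
      finally have "d\<^sup>2 * (d * (real \<rho> * real t) ^ 3) \<le> d\<^sup>2 * (2048 * real l ^ 3 * q\<^sup>2 * r\<^sup>2 * b\<^sup>2)"
        by (simp add: power_mult_distrib power3_eq_cube power2_eq_square mult_ac)
      then show ?thesis using d by (simp add: mult_le_cancel_left)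
    next
      \<comment> \<open>Lines meeting the grid in a single point are out of reach of the rich-line
        bound. Here three elementary bounds are multiplied: d \<rho> t <= q r b, \<rho> t <= 2 l q
        and \<rho> t <= b r.\<close>
      case True
      have ne: "\<exists>x. x \<in> D" using \<open>D \<noteq> {}\<close> by blast
      then obtain x where x: "\<rho> \<le> rep A B x" unfolding D_def by blast
      then have "{b\<in>B. x + b \<in> A} \<noteq> {}" using \<rho> unfolding rep_def by fastforce
      then obtain a where a: "a \<in> A" by blast
      have "card {q\<in>Q. a / q \<in> R} \<le> card R"
      proof (rule card_inj_on_le[of "\<lambda>q. a / q"])
        show "inj_on (\<lambda>q. a / q) {q \<in> Q. a / q \<in> R}"
          using Q(2) R(2) by (fastforce simp: inj_on_def field_simps)
      qed (use R in auto)
      then have tr: "real t \<le> r" using t(2)[OF a] unfolding r_def by simp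
      have rb: "real \<rho> \<le> b" using x rep_le_right[OF B, of A x] unfolding b_def by simp
      have "card A * t = (\<Sum>a\<in>A. t)" by simp
      also have "\<dots> \<le> (\<Sum>a\<in>A. card {q\<in>Q. a / q \<in> R})" by (rule sum_mono) (rule t(2))
      also have "\<dots> = card (SIGMA a:A. {q\<in>Q. a / q \<in> R})" using A Q by simp
      also have "\<dots> \<le> card (Q \<times> R)"
      proof (rule card_inj_on_le[of "\<lambda>(a, q). (q, a / q)"])
        show "inj_on (\<lambda>(a, q). (q, a / q)) (SIGMA a:A. {q \<in> Q. a / q \<in> R})"
          using Q(2) by (fastforce simp: inj_on_def)
      qed (use Q R in auto)
      finally have At: "card A * t \<le> card Q * card R" by (simp add: card_cartesian_product)
      have "card D * \<rho> \<le> card A * card B" unfolding D_def by (rule card_rep_level_le[OF A B])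
      then have "card D * \<rho> * t \<le> card A * card B * t" by simp
      also have "\<dots> \<le> card Q * card R * card B" using mult_right_mono[OF At, of "card B"] by (simp add: mult_ac)
      finally have e1: "d * (real \<rho> * real t) \<le> q * r * b"
      proof -
        assume "card D * \<rho> * t \<le> card Q * card R * card B"
        then have "real (card D * \<rho> * t) \<le> real (card Q * card R * card B)"
          by (rule of_nat_mono)
        then show ?thesis
          unfolding d_def q_def r_def b_def by (simp add: mult_ac)
      qed
      have "d * (real \<rho> * real t) \<le> 2 * real l * (q * d)"
        using tot2 nQD True mult_left_mono[OF nQD, of "2 * real l"] by simp
      then have "d * (real \<rho> * real t) \<le> d * (2 * real l * q)" by (simp add: mult_ac)
      then have e2: "real \<rho> * real t \<le> 2 * real l * q" using d by (simp add: mult_le_cancel_left)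
      have e3: "real \<rho> * real t \<le> b * r" by (intro mult_mono rb tr) (auto simp: b_def)
      have "d * (real \<rho> * real t) ^ 3 = (d * (real \<rho> * real t)) * (real \<rho> * real t) * (real \<rho> * real t)"
        by (simp add: power3_eq_cube)
      also have "\<dots> \<le> (q * r * b) * (2 * real l * q) * (b * r)"
        by (intro mult_mono e1 e2 e3) (auto simp: d_def q_def r_def b_def)
      also have "\<dots> = 2 * real l * (q\<^sup>2 * r\<^sup>2 * b\<^sup>2)" by (simp add: power2_eq_square)
      also have "\<dots> \<le> 2048 * real l ^ 3 * (q\<^sup>2 * r\<^sup>2 * b\<^sup>2)"
      proof (rule mult_right_mono)
        have "real l ^ 1 \<le> real l ^ 3" by (rule power_increasing) (use l in auto)
        then have "real l \<le> real l ^ 3" by (simp only: power_one_right)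
        then show "2 * real l \<le> 2048 * real l ^ 3" by linarith
      qed simp
      finally show ?thesis by (simp add: mult_ac)
    qed
  next
    case True
    then show ?thesis unfolding d_def by simp
  qed
  have "real (card D) * real \<rho> ^ 3 * real t ^ 3 \<le> 2048 * real l ^ 3 * q\<^sup>2 * r\<^sup>2 * b\<^sup>2"
    using main unfolding d_def by (simp add: power_mult_distrib mult_ac)
  then show "real (card {x. \<rho> \<le> rep A B x}) * real \<rho> ^ 3
      \<le> 2048 * real l ^ 3 * (real (card Q))\<^sup>2 * (real (card R))\<^sup>2 / real t ^ 3 * (real (card B))\<^sup>2"
    using t(1) unfolding D_def[symmetric] q_def r_def b_def by (simp add: field_simps)
qed

section \<open>Third moments and difference sets\<close>

text \<open>The cubic bound is scale invariant for the third moment: each of the l dyadic levels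
  contributes the same amount, and 8 is the cube of the ratio of its ends.\<close>

lemma sum_cube_rep_le:
  assumes "controlled \<kappa> A" "finite A" "card A < 2 ^ l"
  shows "(\<Sum>x | 1 \<le> rep A A x. real (rep A A x) ^ 3) \<le> 8 * real l * \<kappa> * (real (card A))\<^sup>2"
proof -
  let ?X = "{x. 1 \<le> rep A A x}"
  have fX: "finite ?X" using finite_rep_support[OF assms(2,2)] by simp
  have "(\<Sum>x\<in>?X. real (rep A A x) ^ 3)
      \<le> (\<Sum>i<l. \<Sum>x\<in>{x\<in>?X. 2 ^ i \<le> rep A A x \<and> rep A A x < 2 ^ (i + 1)}. real (rep A A x) ^ 3)"
    by (rule dyadic_sum_le[OF fX]) (use rep_le_left[OF assms(2), of A] assms(3) in \<open>auto intro: le_less_trans\<close>)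
  also have "\<dots> \<le> (\<Sum>i<l. 8 * (\<kappa> * (real (card A))\<^sup>2))"
  proof (rule sum_mono)
    fix i
    let ?L = "{x\<in>?X. 2 ^ i \<le> rep A A x \<and> rep A A x < 2 ^ (i + 1)}"
    have fin: "finite {x. 2 ^ i \<le> rep A A x}" using finite_rep_support[OF assms(2,2)] by simp
    have "(\<Sum>x\<in>?L. real (rep A A x) ^ 3) \<le> (\<Sum>x\<in>?L. real (2 ^ (i + 1)) ^ 3)"
    proof (rule sum_mono)
      fix x assume "x \<in> ?L"
      then have "real (rep A A x) \<le> real (2 ^ (i + 1))" by (simp only: of_nat_le_iff) simp
      then show "real (rep A A x) ^ 3 \<le> real (2 ^ (i + 1)) ^ 3" by (rule power_mono) simp
    qed
    also have "\<dots> = 8 * (real (card ?L) * real (2 ^ i) ^ 3)"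
      by (simp add: power_mult_distrib)
    also have "\<dots> \<le> 8 * (real (card {x. 2 ^ i \<le> rep A A x}) * real (2 ^ i) ^ 3)"
      by (intro mult_left_mono mult_right_mono of_nat_mono card_mono fin) auto
    also have "\<dots> \<le> 8 * (\<kappa> * (real (card A))\<^sup>2)"
      using controlledD[OF assms(1,2), of "2 ^ i"] by simp
    finally show "(\<Sum>x\<in>?L. real (rep A A x) ^ 3) \<le> 8 * (\<kappa> * (real (card A))\<^sup>2)" .
  qed
  finally show ?thesis by (simp add: mult_ac)
qed

lemma card_triple_rep:
  assumes "finite A"
  shows "real (card (SIGMA x:{x. 1 \<le> rep A A x}. {b\<in>A. x + b \<in> A} \<times> {b\<in>A. x + b \<in> A} \<times> {b\<in>A. x + b \<in> A}))
    = (\<Sum>x | 1 \<le> rep A A x. real (rep A A x) ^ 3)"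
  using assms finite_rep_support[OF assms assms, of 1]
  by (simp add: card_cartesian_product rep_def power3_eq_cube mult_ac)

lemma one_le_rep_iff: "finite B \<Longrightarrow> 1 \<le> rep A B x \<longleftrightarrow> (\<exists>b\<in>B. x + b \<in> A)"
proof -
  assume "finite B"
  then have "1 \<le> rep A B x \<longleftrightarrow> {b\<in>B. x + b \<in> A} \<noteq> {}"
    unfolding rep_def by (simp add: Suc_le_eq card_gt_0_iff)
  then show ?thesis by blast
qed

lemma difference_set_conv_image: "difference_set A B = (\<lambda>(a, b). a - b) ` (A \<times> B)"
  unfolding difference_set_def by auto

text \<open>
  The triples \<open>(a, b, c)\<close> with \<open>a - b\<close> popular are mapped to the pairs \<open>(a - c, b - c)\<close>; two triples
  with the same image differ by a translation, so that the third moment of \<open>rep A A\<close> counts the collisions.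
\<close>
lemma controlled_difference_set:
  fixes A :: "real set"
  assumes ctl: "controlled \<kappa> A" and A: "finite A" "A \<noteq> {}" and l: "card A < 2 ^ l"
    and K: "real (card (difference_set A A)) \<le> K"
  shows "real (card A) ^ 11 \<le> 65536 * real l ^ 4 * \<kappa> ^ 3 * K ^ 5"
proof -
  define D where "D = difference_set A A"
  define N where "N = real (card A)"
  have fD: "finite D" unfolding D_def difference_set_conv_image using A by simp
  have N: "N > 0" unfolding N_def using A by (simp add: card_gt_0_iff)
  have dK: "real (card D) \<le> K" unfolding D_def by (rule K)
  have dpos: "card D > 0" unfolding D_def difference_set_conv_image using A by (simp add: card_gt_0_iff)
  have K0: "K > 0" using dK dpos by simp
  have \<kappa>: "0 \<le> \<kappa>" using ctl by (rule controlled_nonneg)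
  have l0: "0 < l" using l A by (cases l) (auto simp: card_gt_0_iff)
  \<comment> \<open>Half of the lower bound N^2 / K for the average multiplicity of a difference, so
    the unpopular differences account for at most half of all pairs.\<close>
  define \<omega> where "\<omega> = N\<^sup>2 / (2 * K)"
  define r where "r = rep A A"
  define G where "G = {p \<in> A \<times> A. \<omega> \<le> real (r (fst p - snd p))}"
  have fG: "finite G" unfolding G_def using A by simp
  have G: "N\<^sup>2 \<le> 2 * real (card G)"
  proof -
    let ?U = "{d\<in>D. real (r d) < \<omega>}"
    have "card (A \<times> A - G) \<le> card (SIGMA d:?U. {b\<in>A. d + b \<in> A})"
      by (rule card_inj_on_le[of "\<lambda>(a, b). (a - b, b)"])
        (use A fD in \<open>auto simp: inj_on_def G_def D_def difference_set_def\<close>)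
    also have "\<dots> = (\<Sum>d\<in>?U. r d)" unfolding r_def rep_def using A fD by simp
    finally have "real (card (A \<times> A - G)) \<le> (\<Sum>d\<in>?U. real (r d))"
      by (metis of_nat_le_iff of_nat_sum)
    also have "\<dots> \<le> (\<Sum>d\<in>?U. \<omega>)" by (rule sum_mono) auto
    also have "\<dots> \<le> real (card D) * \<omega>"
      using K0 by (simp, intro mult_right_mono of_nat_mono card_mono fD) (auto simp: \<omega>_def)
    also have "\<dots> \<le> K * \<omega>" by (rule mult_right_mono[OF dK]) (use K0 in \<open>simp add: \<omega>_def\<close>)
    also have "\<dots> = N\<^sup>2 / 2" unfolding \<omega>_def using K0 by simp
    finally have "real (card (A \<times> A - G)) \<le> N\<^sup>2 / 2" .
    moreover have "card (A \<times> A - G) = card (A \<times> A) - card G"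
      by (rule card_Diff_subset[OF fG]) (auto simp: G_def)
    moreover have "card G \<le> card (A \<times> A)" by (rule card_mono) (use A in \<open>auto simp: G_def\<close>)
    moreover have "real (card (A \<times> A)) = N\<^sup>2" unfolding N_def by (simp add: card_cartesian_product power2_eq_square)
    ultimately show ?thesis by (simp add: of_nat_diff)
  qed
  define W where "W = G \<times> A"
  define h where "h = (\<lambda>((a, b), c). (a - c, b - c :: real))"
  define Z where "Z = h ` W"
  have fW: "finite W" unfolding W_def using fG A by simp
  have cW: "real (card W) = real (card G) * N" unfolding W_def N_def by (simp add: card_cartesian_product)
  let ?S = "SIGMA x:{x. 1 \<le> rep A A x}. {b\<in>A. x + b \<in> A} \<times> {b\<in>A. x + b \<in> A} \<times> {b\<in>A. x + b \<in> A}"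
  have "card {(w, w'). w \<in> W \<and> w' \<in> W \<and> h w = h w'} \<le> card ?S"
  proof (rule card_inj_on_le[of "\<lambda>(((a, b), c), ((a', b'), c')). (a' - a, (a, b, c))"])
    show "inj_on (\<lambda>(((a, b), c), ((a', b'), c')). (a' - a, (a, b, c))) {(w, w'). w \<in> W \<and> w' \<in> W \<and> h w = h w'}"
      by (auto simp: inj_on_def h_def)
    show "(\<lambda>(((a, b), c), ((a', b'), c')). (a' - a, (a, b, c))) ` {(w, w'). w \<in> W \<and> w' \<in> W \<and> h w = h w'} \<subseteq> ?S"
    proof (clarsimp simp: W_def h_def G_def)
      fix a b c a' b' c'
      assume *: "a \<in> A" "b \<in> A" "c \<in> A" "a' \<in> A" "b' \<in> A" "c' \<in> A" "a - c = a' - c'" "b - c = b' - c'"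
      have "a' - a + b = b'" "a' - a + c = c'" using * by linarith+
      then show "Suc 0 \<le> rep A A (a' - a) \<and> a' - a + b \<in> A \<and> a' - a + c \<in> A"
        using * one_le_rep_iff[OF A(1), of A "a' - a"] by force
    qed
    show "finite ?S" using A finite_rep_support[OF A(1) A(1), of 1] by (intro finite_SigmaI) auto
  qed
  then have coll: "real (card {(w, w'). w \<in> W \<and> w' \<in> W \<and> h w = h w'}) \<le> 8 * real l * \<kappa> * N\<^sup>2"
    using card_triple_rep[OF A(1)] sum_cube_rep_le[OF ctl A(1) l] unfolding N_def by linarith
  have Z1: "(real (card W))\<^sup>2 \<le> real (card Z) * (8 * real l * \<kappa> * N\<^sup>2)"
  proof -
    have "real ((card W)\<^sup>2) \<le> real (card Z * card {(w, w'). w \<in> W \<and> w' \<in> W \<and> h w = h w'})"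
      unfolding Z_def by (rule of_nat_mono) (rule image_Cauchy_Schwarz[OF fW])
    also have "\<dots> \<le> real (card Z) * (8 * real l * \<kappa> * N\<^sup>2)"
      unfolding of_nat_mult by (rule mult_left_mono[OF coll]) simp
    finally show ?thesis by simp
  qed
  have fZ: "finite Z" unfolding Z_def using fW by simp
  have Zsub: "s \<in> D \<and> s' \<in> D \<and> \<omega> \<le> real (r (s - s'))" if "(s, s') \<in> Z" for s s'
    using that unfolding Z_def h_def W_def G_def D_def difference_set_def by auto
  define R where "R = rep A D"
  let ?Y = "{y. 1 \<le> R y}"
  have fY: "finite ?Y" unfolding R_def using finite_rep_support[OF A(1) fD] by simp
  \<comment> \<open>Expand the popular s - s' as a' - a and put y = a - s'. Then y + s' = a and y +
    s = a' both lie in A, so the expansions are counted by the second moment of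
    \<open>rep A D\<close>.\<close>
  have "\<omega> * real (card Z) = (\<Sum>z\<in>Z. \<omega>)" by simp
  also have "\<dots> \<le> (\<Sum>z\<in>Z. real (r (fst z - snd z)))"
    by (rule sum_mono) (use Zsub in \<open>auto simp: split_def\<close>)
  also have "\<dots> = real (card (SIGMA z:Z. {a\<in>A. (fst z - snd z) + a \<in> A}))"
    unfolding r_def rep_def using fZ A by simp
  also have "\<dots> \<le> real (card (SIGMA y:?Y. {d\<in>D. y + d \<in> A} \<times> {d\<in>D. y + d \<in> A}))"
  proof (rule of_nat_mono, rule card_inj_on_le[of "\<lambda>((s, s'), a). (a - s', (s, s'))"])
    show "(\<lambda>((s, s'), a). (a - s', (s, s'))) ` (SIGMA z:Z. {a\<in>A. (fst z - snd z) + a \<in> A})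
        \<subseteq> (SIGMA y:?Y. {d\<in>D. y + d \<in> A} \<times> {d\<in>D. y + d \<in> A})"
    proof clarsimp
      fix s s' a assume *: "(s, s') \<in> Z" "a \<in> A" "s - s' + a \<in> A"
      have m: "a - s' + s \<in> A" using *(3) by (simp add: algebra_simps)
      have "1 \<le> R (a - s')" using m Zsub[OF *(1)] one_le_rep_iff[OF fD] unfolding R_def by blast
      then show "Suc 0 \<le> R (a - s') \<and> s \<in> D \<and> a - s' + s \<in> A \<and> s' \<in> D"
        using m Zsub[OF *(1)] by simp
    qed
  qed (use fD fY in \<open>auto simp: inj_on_def\<close>)
  also have "\<dots> = (\<Sum>y\<in>?Y. (real (R y))\<^sup>2)"
    unfolding R_def rep_def using fD fY[unfolded R_def rep_def] by (simp add: card_cartesian_product power2_eq_square)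
  finally have V1: "\<omega> * real (card Z) \<le> (\<Sum>y\<in>?Y. (real (R y))\<^sup>2)" .
  have "\<And>y. R y < 2 ^ l" unfolding R_def using rep_le_left[OF A(1)] l by (rule le_less_trans)
  then obtain i where i: "(\<Sum>y\<in>?Y. (real (R y))\<^sup>2)
      \<le> real l * (\<Sum>y\<in>{y\<in>?Y. 2 ^ i \<le> R y \<and> R y < 2 ^ (i + 1)}. (real (R y))\<^sup>2)"
    using dyadic_pigeonhole[OF fY, of R l "\<lambda>y. (real (R y))\<^sup>2"] l0 by auto
  define L where "L = {y. 2 ^ i \<le> R y}"
  have fL: "finite L" unfolding L_def R_def using finite_rep_support[OF A(1) fD] by simp
  define n where "n = real (card L)"
  define e where "e = (2::real) ^ i"
  have e0: "e > 0" unfolding e_def by simp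
  have "(\<Sum>y\<in>{y\<in>?Y. 2 ^ i \<le> R y \<and> R y < 2 ^ (i + 1)}. (real (R y))\<^sup>2)
     \<le> (\<Sum>y\<in>{y\<in>?Y. 2 ^ i \<le> R y \<and> R y < 2 ^ (i + 1)}. (2 * e)\<^sup>2)"
  proof (rule sum_mono)
    fix y assume "y \<in> {y\<in>?Y. 2 ^ i \<le> R y \<and> R y < 2 ^ (i + 1)}"
    then have "real (R y) \<le> real (2 ^ (i + 1))" by (simp only: of_nat_le_iff) simp
    then show "(real (R y))\<^sup>2 \<le> (2 * e)\<^sup>2" unfolding e_def by (intro power_mono) auto
  qed
  also have "\<dots> \<le> n * (4 * e\<^sup>2)"
    unfolding n_def sum_constant power_mult_distrib
    by (intro mult_mono of_nat_mono card_mono fL) (auto simp: L_def)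
  finally have V2: "(\<Sum>y\<in>?Y. (real (R y))\<^sup>2) \<le> 4 * real l * (e\<^sup>2 * n)"
    by (rule order_trans[OF i order_trans[OF mult_left_mono]]) (simp_all add: mult_ac)
  have n1: "n * e ^ 3 \<le> \<kappa> * K\<^sup>2"
  proof -
    have "n * e ^ 3 \<le> \<kappa> * (real (card D))\<^sup>2"
      using controlledD[OF ctl fD, of "2 ^ i"] unfolding n_def e_def L_def R_def by simp
    also have "\<dots> \<le> \<kappa> * K\<^sup>2" by (intro mult_left_mono power_mono dK \<kappa>) auto
    finally show ?thesis .
  qed
  have n2: "n * e \<le> N * K"
  proof -
    have "card L * 2 ^ i \<le> card A * card D" unfolding L_def R_def by (rule card_rep_level_le[OF A(1) fD])
    then have "real (card L * 2 ^ i) \<le> real (card A * card D)" by (rule of_nat_mono)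
    then have "n * e \<le> N * real (card D)" unfolding n_def e_def N_def by simp
    also have "\<dots> \<le> N * K" by (rule mult_left_mono[OF dK]) (use N in simp)
    finally show ?thesis .
  qed
  define V where "V = e\<^sup>2 * n"
  have V0: "V \<ge> 0" unfolding V_def n_def by simp
  \<comment> \<open>Interpolation: (e^2 n)^2 is the product of n e^3, bounded by control, and n e,
    bounded by counting pairs.\<close>
  have VV: "V\<^sup>2 \<le> \<kappa> * K ^ 3 * N"
  proof -
    have "V\<^sup>2 = (n * e ^ 3) * (n * e)" unfolding V_def by (simp add: power2_eq_square power3_eq_cube)
    also have "\<dots> \<le> (\<kappa> * K\<^sup>2) * (N * K)"
      by (intro mult_mono n1 n2) (use e0 \<kappa> in \<open>auto simp: n_def\<close>)
    finally show ?thesis by (simp add: power2_eq_square power3_eq_cube mult_ac)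
  qed
  have z: "N ^ 6 \<le> 32 * real l * \<kappa> * N\<^sup>2 * real (card Z)"
  proof -
    have "(N ^ 3)\<^sup>2 \<le> (2 * real (card W))\<^sup>2"
      unfolding cW by (rule power_mono) (use mult_right_mono[OF G, of N] N in \<open>auto simp: power3_eq_cube power2_eq_square\<close>)
    then have "N ^ 6 \<le> 4 * (real (card W))\<^sup>2" by (simp add: power_mult_distrib flip: power_mult)
    then show ?thesis using Z1 by (simp add: mult_ac)
  qed
  have "N ^ 6 * N\<^sup>2 \<le> (32 * real l * \<kappa> * N\<^sup>2 * real (card Z)) * N\<^sup>2" by (rule mult_right_mono[OF z]) simp
  also have "\<dots> = (64 * real l * \<kappa> * K * N\<^sup>2) * (\<omega> * real (card Z))"
    unfolding \<omega>_def using K0 by (simp add: field_simps)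
  also have "\<dots> \<le> (64 * real l * \<kappa> * K * N\<^sup>2) * (4 * real l * V)"
    by (rule mult_left_mono[OF order_trans[OF V1 V2[folded V_def]]]) (use \<kappa> K0 in simp)
  finally have "N\<^sup>2 * N ^ 6 \<le> N\<^sup>2 * (256 * (real l)\<^sup>2 * \<kappa> * K * V)"
    by (simp add: power2_eq_square mult_ac)
  then have "N ^ 6 \<le> 256 * (real l)\<^sup>2 * \<kappa> * K * V" by (rule mult_left_le_imp_le) (use N in simp)
  then have "(N ^ 6)\<^sup>2 \<le> (256 * (real l)\<^sup>2 * \<kappa> * K * V)\<^sup>2" by (rule power_mono) (use N in simp)
  also have "\<dots> = 65536 * real l ^ 4 * \<kappa>\<^sup>2 * K\<^sup>2 * V\<^sup>2"
    by (simp add: power_mult_distrib flip: power_mult)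
  also have "\<dots> \<le> 65536 * real l ^ 4 * \<kappa>\<^sup>2 * K\<^sup>2 * (\<kappa> * K ^ 3 * N)"
    by (rule mult_left_mono[OF VV]) simp
  finally have "N * N ^ 11 \<le> N * (65536 * real l ^ 4 * \<kappa> ^ 3 * K ^ 5)"
    by (simp add: eval_nat_numeral mult_ac)
  then show ?thesis unfolding N_def[symmetric] by (rule mult_left_le_imp_le) (use N in simp)
qed

section \<open>Additive energy and sumsets\<close>

text \<open>Rearranging a + c = a' + c' as a - a' = c' - c expresses the energy through differences,
  the quantities that control bounds.\<close>

lemma energy_le_sum_square_rep:
  assumes "finite A"
  shows "card {(p, p'). p \<in> A \<times> A \<and> p' \<in> A \<times> A \<and> fst p + snd p = fst p' + snd p'}
    \<le> (\<Sum>x | 1 \<le> rep A A x. (rep A A x)\<^sup>2)"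
proof -
  let ?S = "SIGMA x:{x. 1 \<le> rep A A x}. {b\<in>A. x + b \<in> A} \<times> {b\<in>A. x + b \<in> A}"
  have fS: "finite {x. 1 \<le> rep A A x}" using finite_rep_support[OF assms assms, of 1] by simp
  have "card {(p, p'). p \<in> A \<times> A \<and> p' \<in> A \<times> A \<and> fst p + snd p = fst p' + snd p'} \<le> card ?S"
  proof (rule card_inj_on_le[of "\<lambda>((a, c), (a', c')). (a - a', (a', c))"])
    show "(\<lambda>((a, c), (a', c')). (a - a', (a', c))) `
        {(p, p'). p \<in> A \<times> A \<and> p' \<in> A \<times> A \<and> fst p + snd p = fst p' + snd p'} \<subseteq> ?S"
    proof clarsimp
      fix a c a' c' assume *: "a \<in> A" "c \<in> A" "a' \<in> A" "c' \<in> A" "a + c = a' + c'"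
      have e: "a - a' + c = c'" using * by linarith
      have "a - a' + c \<in> A" using *(4) by (simp only: e)
      moreover have "1 \<le> rep A A (a - a')" using * one_le_rep_iff[OF assms, of A "a - a'"] by force
      ultimately show "Suc 0 \<le> rep A A (a - a') \<and> a - a' + c \<in> A" using * by simp
    qed
  qed (use assms fS in \<open>auto simp: inj_on_def\<close>)
  also have "\<dots> = (\<Sum>x | 1 \<le> rep A A x. (rep A A x)\<^sup>2)"
    using assms fS by (simp add: card_cartesian_product rep_def power2_eq_square)
  finally show ?thesis .
qed

lemma card_popular_pairs:
  fixes A :: "'a set" and f :: "'a \<Rightarrow> 'b"
  assumes "finite A" "finite S" "f ` A \<subseteq> S" "0 \<le> \<omega>"
  shows "real (card {a\<in>A. real (card {b\<in>A. f b = f a}) < \<omega>}) \<le> real (card S) * \<omega>"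
proof -
  let ?c = "\<lambda>y. card {b\<in>A. f b = y}"
  let ?U = "{y\<in>S. real (?c y) < \<omega>}"
  have "{a\<in>A. real (?c (f a)) < \<omega>} \<subseteq> (\<Union>y\<in>?U. {b\<in>A. f b = y})"
    using assms(3) by auto
  then have "card {a\<in>A. real (?c (f a)) < \<omega>} \<le> card (\<Union>y\<in>?U. {b\<in>A. f b = y})"
    by (rule card_mono[rotated]) (use assms in auto)
  also have "\<dots> \<le> (\<Sum>y\<in>?U. ?c y)" by (rule card_UN_le) (use assms in auto)
  finally have "real (card {a\<in>A. real (?c (f a)) < \<omega>}) \<le> real (\<Sum>y\<in>?U. ?c y)" by (rule of_nat_mono)
  also have "\<dots> = (\<Sum>y\<in>?U. real (?c y))" by simp
  also have "\<dots> \<le> (\<Sum>y\<in>?U. \<omega>)" by (rule sum_mono) auto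
  also have "\<dots> \<le> real (card S) * \<omega>"
    using assms by (simp, intro mult_right_mono of_nat_mono card_mono) auto
  finally show ?thesis .
qed

text \<open>Eliminates z, V, P and D. Inequalities 2, 3 and 4 combine to a bound for P^7 D^12 N^9.
  The ninth power of 1 contains P^9 D^18 = (P^7 D^12) (P D^3)^2, so that bound and the square of 5
  remove P and D together.\<close>

lemma sumset_exponent_algebra:
  fixes N P D K \<kappa> z V l :: real
  assumes pos: "0 < N" "0 < P" "0 < D" "0 < K" "0 \<le> \<kappa>" "0 < l" "0 \<le> z" "0 \<le> V"
    and 1: "N ^ 4 \<le> 16 * l * K * (P * D\<^sup>2)"
    and 2: "P\<^sup>2 * D\<^sup>2 \<le> 32 * l * \<kappa> * z"
    and 3: "N\<^sup>2 * z \<le> 16 * K * V"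
    and 4: "V ^ 6 \<le> 4096 * l ^ 12 * \<kappa> ^ 3 * K ^ 4 * N ^ 3 * P ^ 5"
    and 5: "P * D ^ 3 \<le> \<kappa> * N\<^sup>2"
  shows "N ^ 41 \<le> 2 ^ 102 * l ^ 27 * \<kappa> ^ 11 * K ^ 19"
proof -
  have "P\<^sup>2 * D\<^sup>2 * N\<^sup>2 \<le> 32 * l * \<kappa> * z * N\<^sup>2" by (rule mult_right_mono[OF 2]) simp
  also have "\<dots> = 32 * l * \<kappa> * (N\<^sup>2 * z)" by simp
  also have "\<dots> \<le> 32 * l * \<kappa> * (16 * K * V)" by (rule mult_left_mono[OF 3]) (use pos in simp)
  finally have "(P\<^sup>2 * D\<^sup>2 * N\<^sup>2) ^ 6 \<le> (32 * l * \<kappa> * (16 * K * V)) ^ 6"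
    by (rule power_mono) simp
  also have "\<dots> = 2 ^ 54 * l ^ 6 * \<kappa> ^ 6 * K ^ 6 * V ^ 6" by (simp add: power_mult_distrib)
  also have "\<dots> \<le> 2 ^ 54 * l ^ 6 * \<kappa> ^ 6 * K ^ 6 * (4096 * l ^ 12 * \<kappa> ^ 3 * K ^ 4 * N ^ 3 * P ^ 5)"
    by (rule mult_left_mono[OF 4]) (use pos in simp)
  finally have "N ^ 3 * P ^ 5 * (P ^ 7 * D ^ 12 * N ^ 9) \<le> N ^ 3 * P ^ 5 * (2 ^ 66 * l ^ 18 * \<kappa> ^ 9 * K ^ 10)"
    by (simp add: power_mult_distrib eval_nat_numeral mult_ac)
  then have 6: "P ^ 7 * D ^ 12 * N ^ 9 \<le> 2 ^ 66 * l ^ 18 * \<kappa> ^ 9 * K ^ 10"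
    by (rule mult_left_le_imp_le) (use pos in simp)
  have "(N ^ 4) ^ 9 \<le> (16 * l * K * (P * D\<^sup>2)) ^ 9" by (rule power_mono[OF 1]) (use pos in simp)
  also have "\<dots> = 2 ^ 36 * l ^ 9 * K ^ 9 * (P ^ 7 * D ^ 12) * (P * D ^ 3)\<^sup>2"
    by (simp add: power_mult_distrib eval_nat_numeral mult_ac)
  also have "\<dots> \<le> 2 ^ 36 * l ^ 9 * K ^ 9 * (P ^ 7 * D ^ 12) * (\<kappa> * N\<^sup>2)\<^sup>2"
    by (intro mult_left_mono power_mono 5) (use pos in auto)
  finally have "(N ^ 4) ^ 9 * N ^ 9 \<le> 2 ^ 36 * l ^ 9 * K ^ 9 * (P ^ 7 * D ^ 12) * (\<kappa> * N\<^sup>2)\<^sup>2 * N ^ 9"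
    by (rule mult_right_mono) (use pos in simp)
  also have "\<dots> = 2 ^ 36 * l ^ 9 * K ^ 9 * \<kappa>\<^sup>2 * N ^ 4 * (P ^ 7 * D ^ 12 * N ^ 9)"
    by (simp add: power_mult_distrib eval_nat_numeral mult_ac)
  also have "\<dots> \<le> 2 ^ 36 * l ^ 9 * K ^ 9 * \<kappa>\<^sup>2 * N ^ 4 * (2 ^ 66 * l ^ 18 * \<kappa> ^ 9 * K ^ 10)"
    by (rule mult_left_mono[OF 6]) (use pos in simp)
  also have "\<dots> = N ^ 4 * (2 ^ 102 * l ^ 27 * \<kappa> ^ 11 * K ^ 19)"
    by (simp add: eval_nat_numeral mult_ac)
  also have "(N ^ 4) ^ 9 * N ^ 9 = N ^ 4 * N ^ 41" by (simp flip: power_mult power_add)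
  finally show ?thesis by (rule mult_left_le_imp_le) (use pos in simp)
qed

text \<open>
  The triples \<open>(a, b, c)\<close> with \<open>a + c\<close>, \<open>b + c\<close> popular and \<open>a - b\<close> in the level set \<open>P\<close> carrying the
  additive energy are mapped to \<open>(a + c, b + c)\<close>. Collisions are counted by the third moment of \<open>rep A A\<close>;
  expanding the popular sum \<open>a + c\<close> bounds the image by a correlation of \<open>rep A S\<close> and \<open>rep A P\<close>.
\<close>
lemma controlled_sumset:
  fixes A :: "real set"
  assumes ctl: "controlled \<kappa> A" and A: "finite A" "A \<noteq> {}" and l: "card A < 2 ^ l"
    and K: "real (card (A + A)) \<le> K"
  shows "real (card A) ^ 41 \<le> 2 ^ 102 * real l ^ 27 * \<kappa> ^ 11 * K ^ 19"
proof -
  define S where "S = A + A"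
  define N where "N = real (card A)"
  have S: "S = (\<lambda>p. fst p + snd p) ` (A \<times> A)" unfolding S_def by (simp add: set_plus_image split_def)
  have fS: "finite S" unfolding S using A by simp
  have N: "N > 0" unfolding N_def using A by (simp add: card_gt_0_iff)
  have sK: "real (card S) \<le> K" unfolding S_def by (rule K)
  have spos: "card S > 0" unfolding S using A by (simp add: card_gt_0_iff)
  have K0: "K > 0" using sK spos by simp
  have \<kappa>: "0 \<le> \<kappa>" using ctl by (rule controlled_nonneg)
  have l0: "0 < l" using l A by (cases l) (auto simp: card_gt_0_iff)
  have cAA: "real (card (A \<times> A)) = N\<^sup>2" unfolding N_def by (simp add: card_cartesian_product power2_eq_square)
  \<comment> \<open>With 16, at most N^2 / 16 pairs have an unpopular sum. Hence at most a quarter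
    of A has more than N / 4 bad partners, and any two of the remaining elements still share N / 2
    good ones.\<close>
  define \<omega> where "\<omega> = N\<^sup>2 / (16 * K)"
  have \<omega>: "0 \<le> \<omega>" unfolding \<omega>_def using K0 by simp
  define rs where "rs s = card {p\<in>A \<times> A. fst p + snd p = s}" for s
  define U where "U = {p\<in>A \<times> A. real (rs (fst p + snd p)) < \<omega>}"
  have U: "real (card U) \<le> N\<^sup>2 / 16"
  proof -
    have "real (card U) \<le> real (card S) * \<omega>"
      unfolding U_def rs_def by (rule card_popular_pairs) (use A fS \<omega> S in auto)
    also have "\<dots> \<le> K * \<omega>" by (rule mult_right_mono[OF sK \<omega>])
    finally show ?thesis unfolding \<omega>_def using K0 by simp
  qed
  define A1 where "A1 = {a\<in>A. 4 * real (card {c\<in>A. (a, c) \<in> U}) \<le> N}"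
  have fA1: "finite A1" unfolding A1_def using A by simp
  have A1sub: "A1 \<subseteq> A" unfolding A1_def by blast
  have A1: "3 * N \<le> 4 * real (card A1)"
  proof -
    have "real (card (A - A1)) * N = (\<Sum>a\<in>A - A1. N)" by simp
    also have "\<dots> \<le> (\<Sum>a\<in>A - A1. 4 * real (card {c\<in>A. (a, c) \<in> U}))"
      by (rule sum_mono) (auto simp: A1_def)
    also have "\<dots> = 4 * real (card (SIGMA a:A - A1. {c\<in>A. (a, c) \<in> U}))"
      using A by (simp add: sum_distrib_left)
    also have "\<dots> \<le> 4 * real (card U)"
      by (intro mult_left_mono of_nat_mono card_mono) (use A in \<open>auto simp: U_def\<close>)
    finally have "N * real (card (A - A1)) \<le> N * (N / 4)" using U by (simp add: power2_eq_square mult_ac)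
    then have "real (card (A - A1)) \<le> N / 4" by (rule mult_left_le_imp_le) (rule N)
    moreover have "card (A - A1) = card A - card A1" by (rule card_Diff_subset[OF fA1 A1sub])
    moreover have "card A1 \<le> card A" by (rule card_mono[OF A(1) A1sub])
    ultimately show ?thesis unfolding N_def by (simp add: of_nat_diff)
  qed
  define r where "r = rep A1 A1"
  let ?X = "{x. 1 \<le> r x}"
  have fX: "finite ?X" unfolding r_def using finite_rep_support[OF fA1 fA1] by simp
  have rl: "r x < 2 ^ l" for x
    unfolding r_def using rep_le_left[OF fA1, of A1 x] card_mono[OF A(1) A1sub] l by linarith
  \<comment> \<open>The energy is taken on \<open>A1\<close>, of size at least 3 N / 4; the loss 256
    / 81 is rounded up to 4.\<close>
  have E: "N ^ 4 \<le> 4 * K * (\<Sum>x\<in>?X. (real (r x))\<^sup>2)"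
  proof -
    let ?E = "card {(p, p'). p \<in> A1 \<times> A1 \<and> p' \<in> A1 \<times> A1 \<and> fst p + snd p = fst p' + snd p'}"
    have "(card (A1 \<times> A1))\<^sup>2 \<le> card ((\<lambda>p. fst p + snd p) ` (A1 \<times> A1)) * ?E"
      by (rule image_Cauchy_Schwarz) (use fA1 in simp)
    also have "\<dots> \<le> card S * (\<Sum>x\<in>?X. (r x)\<^sup>2)"
      unfolding r_def by (intro mult_mono card_mono fS energy_le_sum_square_rep[OF fA1]) (use A1sub S in auto)
    finally have "real ((card (A1 \<times> A1))\<^sup>2) \<le> real (card S * (\<Sum>x\<in>?X. (r x)\<^sup>2))" by (rule of_nat_mono)
    also have "\<dots> \<le> K * (\<Sum>x\<in>?X. (real (r x))\<^sup>2)"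
      using mult_right_mono[OF sK, of "\<Sum>x\<in>?X. (real (r x))\<^sup>2"] by (simp add: sum_nonneg)
    finally have e: "real (card A1) ^ 4 \<le> K * (\<Sum>x\<in>?X. (real (r x))\<^sup>2)"
      by (simp add: card_cartesian_product eval_nat_numeral mult_ac)
    have "(3 * N) ^ 4 \<le> (4 * real (card A1)) ^ 4" by (rule power_mono[OF A1]) (use N in simp)
    then have "81 * N ^ 4 \<le> 256 * real (card A1) ^ 4" by (simp add: power_mult_distrib)
    moreover have "0 \<le> real (card A1) ^ 4" by simp
    ultimately show ?thesis using e by (simp only: mult.assoc)
  qed
  obtain i where i: "(\<Sum>x\<in>?X. (real (r x))\<^sup>2)
      \<le> real l * (\<Sum>x\<in>{x\<in>?X. 2 ^ i \<le> r x \<and> r x < 2 ^ (i + 1)}. (real (r x))\<^sup>2)"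
    using dyadic_pigeonhole[OF fX, of r l "\<lambda>x. (real (r x))\<^sup>2"] rl l0 by auto
  define P where "P = {x\<in>?X. 2 ^ i \<le> r x \<and> r x < 2 ^ (i + 1)}"
  define D where "D = (2::real) ^ i"
  have D0: "D > 0" unfolding D_def by simp
  have fP: "finite P" unfolding P_def using fX by simp
  define p where "p = real (card P)"
  have PD: "D \<le> real (r x) \<and> real (r x) \<le> 2 * D" if "x \<in> P" for x
  proof -
    have "real (2 ^ i) \<le> real (r x)" "real (r x) \<le> real (2 ^ (i + 1))"
      using that unfolding P_def by (simp_all only: of_nat_le_iff) auto
    then show ?thesis unfolding D_def by simp
  qed
  have 1: "N ^ 4 \<le> 16 * real l * K * (p * D\<^sup>2)"
  proof -
    have "(\<Sum>x\<in>P. (real (r x))\<^sup>2) \<le> (\<Sum>x\<in>P. (2 * D)\<^sup>2)"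
      by (intro sum_mono power_mono) (use PD in auto)
    also have "\<dots> = 4 * (p * D\<^sup>2)" unfolding p_def by (simp add: power_mult_distrib)
    finally have "(\<Sum>x\<in>?X. (real (r x))\<^sup>2) \<le> real l * (4 * (p * D\<^sup>2))"
      using order_trans[OF i[folded P_def] mult_left_mono] by simp
    then have "4 * K * (\<Sum>x\<in>?X. (real (r x))\<^sup>2) \<le> 4 * K * (real l * (4 * (p * D\<^sup>2)))"
      by (rule mult_left_mono) (use K0 in simp)
    then show ?thesis using E by (simp add: mult_ac)
  qed
  have p0: "p > 0"
  proof (rule ccontr)
    assume "\<not> 0 < p"
    then have "p = 0" unfolding p_def by simp
    then show False using 1 N by simp
  qed
  have 5: "p * D ^ 3 \<le> \<kappa> * N\<^sup>2"
  proof -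
    have "r x \<le> rep A A x" for x
      unfolding r_def rep_def by (rule card_mono) (use A A1sub in auto)
    then have "P \<subseteq> {x. 2 ^ i \<le> rep A A x}" unfolding P_def by (auto intro: order_trans)
    moreover have "finite {x. 2 ^ i \<le> rep A A x}" by (rule finite_rep_support) (use A in auto)
    ultimately have "p \<le> real (card {x. 2 ^ i \<le> rep A A x})"
      unfolding p_def by (intro of_nat_mono card_mono)
    then have "p * D ^ 3 \<le> real (card {x. 2 ^ i \<le> rep A A x}) * D ^ 3"
      by (rule mult_right_mono) (use D0 in simp)
    also have "\<dots> \<le> \<kappa> * N\<^sup>2"
      using controlledD[OF ctl A(1), of "2 ^ i"] unfolding D_def N_def by simp
    finally show ?thesis .
  qed
  define G where "G = {q \<in> A1 \<times> A1. fst q - snd q \<in> P}"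
  have fG: "finite G" unfolding G_def using fA1 by simp
  have G: "p * D \<le> real (card G)"
  proof -
    have "p * D = (\<Sum>x\<in>P. D)" unfolding p_def by simp
    also have "\<dots> \<le> (\<Sum>x\<in>P. real (r x))" by (rule sum_mono) (use PD in blast)
    also have "\<dots> = real (card (SIGMA x:P. {b\<in>A1. x + b \<in> A1}))"
      unfolding r_def rep_def using fP fA1 by simp
    also have "\<dots> \<le> real (card G)"
      by (rule of_nat_mono, rule card_inj_on_le[of "\<lambda>(x, b). (x + b, b)"])
        (use fG in \<open>auto simp: inj_on_def G_def\<close>)
    finally show ?thesis .
  qed
  define W where "W = (SIGMA q:G. {c\<in>A. (fst q, c) \<notin> U \<and> (snd q, c) \<notin> U})"
  define h where "h = (\<lambda>((a, b), c). (a + c, b + c :: real))"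
  define Z where "Z = h ` W"
  have fW: "finite W" unfolding W_def using fG A by simp
  have W: "p * D * N \<le> 2 * real (card W)"
  proof -
    have c: "N / 2 \<le> real (card {c\<in>A. (fst q, c) \<notin> U \<and> (snd q, c) \<notin> U})" if "q \<in> G" for q
    proof -
      let ?B = "\<lambda>a. {c\<in>A. (a, c) \<in> U}"
      have "A \<subseteq> {c\<in>A. (fst q, c) \<notin> U \<and> (snd q, c) \<notin> U} \<union> (?B (fst q) \<union> ?B (snd q))" by blast
      then have "card A \<le> card ({c\<in>A. (fst q, c) \<notin> U \<and> (snd q, c) \<notin> U} \<union> (?B (fst q) \<union> ?B (snd q)))"
        by (rule card_mono[rotated]) (use A in simp)
      also have "\<dots> \<le> card {c\<in>A. (fst q, c) \<notin> U \<and> (snd q, c) \<notin> U} + (card (?B (fst q)) + card (?B (snd q)))"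
        by (rule order_trans[OF card_Un_le add_left_mono[OF card_Un_le]])
      finally have "N \<le> real (card {c\<in>A. (fst q, c) \<notin> U \<and> (snd q, c) \<notin> U})
          + (real (card (?B (fst q))) + real (card (?B (snd q))))"
        unfolding N_def by linarith
      moreover have "fst q \<in> A1" "snd q \<in> A1" using that unfolding G_def by auto
      then have "4 * real (card (?B (fst q))) \<le> N" "4 * real (card (?B (snd q))) \<le> N"
        unfolding A1_def by blast+
      ultimately show ?thesis by linarith
    qed
    have "p * D * (N / 2) \<le> real (card G) * (N / 2)" by (rule mult_right_mono[OF G]) (use N in simp)
    also have "\<dots> = (\<Sum>q\<in>G. N / 2)" by simp
    also have "\<dots> \<le> (\<Sum>q\<in>G. real (card {c\<in>A. (fst q, c) \<notin> U \<and> (snd q, c) \<notin> U}))"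
      by (rule sum_mono) (rule c)
    also have "\<dots> = real (card W)" unfolding W_def using fG A by simp
    finally show ?thesis by simp
  qed
  let ?S = "SIGMA x:{x. 1 \<le> rep A A x}. {b\<in>A. x + b \<in> A} \<times> {b\<in>A. x + b \<in> A} \<times> {b\<in>A. x + b \<in> A}"
  have "card {(w, w'). w \<in> W \<and> w' \<in> W \<and> h w = h w'} \<le> card ?S"
  proof (rule card_inj_on_le[of "\<lambda>(((a, b), c), ((a', b'), c')). (a' - a, (a, b, c'))"])
    show "inj_on (\<lambda>(((a, b), c), ((a', b'), c')). (a' - a, (a, b, c'))) {(w, w'). w \<in> W \<and> w' \<in> W \<and> h w = h w'}"
      by (auto simp: inj_on_def h_def)
    show "(\<lambda>(((a, b), c), ((a', b'), c')). (a' - a, (a, b, c'))) ` {(w, w'). w \<in> W \<and> w' \<in> W \<and> h w = h w'} \<subseteq> ?S"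
    proof (intro subsetI, elim imageE)
      fix y v assume v: "v \<in> {(w, w'). w \<in> W \<and> w' \<in> W \<and> h w = h w'}"
        and y: "y = (\<lambda>(((a, b), c), ((a', b'), c')). (a' - a, (a, b, c'))) v"
      obtain a b c a' b' c' where vv: "v = (((a, b), c), ((a', b'), c'))" by (metis prod.collapse)
      have *: "a \<in> A1" "b \<in> A1" "c \<in> A" "a' \<in> A1" "b' \<in> A1" "c' \<in> A" "a + c = a' + c'" "b + c = b' + c'"
        using v unfolding vv W_def h_def G_def by auto
      have e: "a' - a + a = a'" "a' - a + b = b'" "a' - a + c' = c" using * by linarith+
      have m: "a \<in> {b\<in>A. a' - a + b \<in> A}" "b \<in> {b\<in>A. a' - a + b \<in> A}" "c' \<in> {b\<in>A. a' - a + b \<in> A}"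
        using *(1-6) A1sub by (simp_all only: e mem_Collect_eq) auto
      then have "1 \<le> rep A A (a' - a)" unfolding one_le_rep_iff[OF A(1)] by blast
      then show "y \<in> ?S" unfolding y vv using m by simp
    qed
    show "finite ?S" using A finite_rep_support[OF A(1) A(1), of 1] by (intro finite_SigmaI) auto
  qed
  then have coll: "real (card {(w, w'). w \<in> W \<and> w' \<in> W \<and> h w = h w'}) \<le> 8 * real l * \<kappa> * N\<^sup>2"
    using card_triple_rep[OF A(1)] sum_cube_rep_le[OF ctl A(1) l] unfolding N_def by linarith
  define z where "z = real (card Z)"
  have Z1: "(real (card W))\<^sup>2 \<le> z * (8 * real l * \<kappa> * N\<^sup>2)"
  proof -
    have "real ((card W)\<^sup>2) \<le> real (card Z * card {(w, w'). w \<in> W \<and> w' \<in> W \<and> h w = h w'})"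
      unfolding Z_def by (rule of_nat_mono) (rule image_Cauchy_Schwarz[OF fW])
    also have "\<dots> \<le> z * (8 * real l * \<kappa> * N\<^sup>2)"
      unfolding of_nat_mult z_def by (rule mult_left_mono[OF coll]) simp
    finally show ?thesis by simp
  qed
  have 2: "p\<^sup>2 * D\<^sup>2 \<le> 32 * real l * \<kappa> * z"
  proof -
    have "(p * D * N)\<^sup>2 \<le> (2 * real (card W))\<^sup>2" by (rule power_mono[OF W]) (use p0 D0 N in simp)
    then have "N\<^sup>2 * (p\<^sup>2 * D\<^sup>2) \<le> N\<^sup>2 * (32 * real l * \<kappa> * z)"
      using Z1 by (simp add: power_mult_distrib mult_ac)
    then show ?thesis by (rule mult_left_le_imp_le) (use N in simp)
  qed
  have fZ: "finite Z" unfolding Z_def using fW by simp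
  have Zsub: "s' \<in> S \<and> s - s' \<in> P \<and> \<omega> \<le> real (rs s)" if "(s, s') \<in> Z" for s s'
    using that A1sub unfolding Z_def h_def W_def G_def U_def S by force
  define f where "f = rep A S"
  \<comment> \<open>If s = a + b is an expansion of the popular sum and y = a - s', then y + s' = a
    and -y + (s - s') = b. The first condition is counted by f; the sign in the second explains the
    reflection in g.\<close>
  define g where "g y = rep A P (- y)" for y
  define Y where "Y = {y. 1 \<le> f y \<and> 1 \<le> g y}"
  have fY: "finite Y"
    by (rule finite_subset[OF _ finite_rep_support[OF A(1) fS, of 1]]) (auto simp: Y_def f_def)
  have "\<omega> * z = (\<Sum>q\<in>Z. \<omega>)" unfolding z_def by simp
  also have "\<dots> \<le> (\<Sum>q\<in>Z. real (rs (fst q)))"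
    by (rule sum_mono) (use Zsub in \<open>auto simp: split_def\<close>)
  also have "\<dots> = real (card (SIGMA q:Z. {p\<in>A \<times> A. fst p + snd p = fst q}))"
    unfolding rs_def using fZ A by simp
  also have "\<dots> \<le> real (card (SIGMA y:Y. {s\<in>S. y + s \<in> A} \<times> {d\<in>P. - y + d \<in> A}))"
  proof (rule of_nat_mono, rule card_inj_on_le[of "\<lambda>((s, s'), (a, b)). (a - s', (s', s - s'))"])
    show "(\<lambda>((s, s'), (a, b)). (a - s', (s', s - s'))) ` (SIGMA q:Z. {p\<in>A \<times> A. fst p + snd p = fst q})
        \<subseteq> (SIGMA y:Y. {s\<in>S. y + s \<in> A} \<times> {d\<in>P. - y + d \<in> A})"
    proof (intro subsetI, elim imageE)
      fix y q assume q: "q \<in> (SIGMA q:Z. {p\<in>A \<times> A. fst p + snd p = fst q})"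
        and y: "y = (\<lambda>((s, s'), (a, b)). (a - s', (s', s - s'))) q"
      obtain s s' a b where qq: "q = ((s, s'), (a, b))" by (metis prod.collapse)
      have *: "(s, s') \<in> Z" "a \<in> A" "b \<in> A" "a + b = s" using q unfolding qq by auto
      have m: "s' \<in> {s\<in>S. (a - s') + s \<in> A}" using * Zsub[OF *(1)] by simp
      have e: "- (a - s') + (s - s') = b" using *(4) by linarith
      have m2: "s - s' \<in> {d\<in>P. - (a - s') + d \<in> A}" using * Zsub[OF *(1)] by (simp only: mem_Collect_eq e)
      have "1 \<le> f (a - s')" unfolding f_def one_le_rep_iff[OF fS] using m by blast
      moreover have "1 \<le> g (a - s')" unfolding g_def one_le_rep_iff[OF fP] using m2 by blast
      ultimately show "y \<in> (SIGMA y:Y. {s\<in>S. y + s \<in> A} \<times> {d\<in>P. - y + d \<in> A})"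
        unfolding y qq Y_def using m m2 by simp
    qed
  qed (use fY fS fP in \<open>auto simp: inj_on_def\<close>)
  also have "\<dots> = (\<Sum>y\<in>Y. real (f y) * real (g y))"
    unfolding f_def g_def rep_def using fS fP fY by (simp add: card_cartesian_product)
  finally have V1: "\<omega> * z \<le> (\<Sum>y\<in>Y. real (f y) * real (g y))" .
  have fl: "f y < 2 ^ l" for y unfolding f_def using rep_le_left[OF A(1)] l by (rule le_less_trans)
  have gl: "g y < 2 ^ l" for y unfolding g_def using rep_le_left[OF A(1)] l by (rule le_less_trans)
  obtain j where j: "(\<Sum>y\<in>Y. real (f y) * real (g y))
      \<le> real l * (\<Sum>y\<in>{y\<in>Y. 2 ^ j \<le> f y \<and> f y < 2 ^ (j + 1)}. real (f y) * real (g y))"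
    using dyadic_pigeonhole[OF fY, of f l "\<lambda>y. real (f y) * real (g y)"] fl l0 unfolding Y_def by auto
  define Y1 where "Y1 = {y\<in>Y. 2 ^ j \<le> f y \<and> f y < 2 ^ (j + 1)}"
  have fY1: "finite Y1" unfolding Y1_def using fY by simp
  obtain k where k: "(\<Sum>y\<in>Y1. real (f y) * real (g y))
      \<le> real l * (\<Sum>y\<in>{y\<in>Y1. 2 ^ k \<le> g y \<and> g y < 2 ^ (k + 1)}. real (f y) * real (g y))"
    using dyadic_pigeonhole[OF fY1, of g l "\<lambda>y. real (f y) * real (g y)"] gl l0
    unfolding Y1_def Y_def by auto
  define Y2 where "Y2 = {y\<in>Y1. 2 ^ k \<le> g y \<and> g y < 2 ^ (k + 1)}"
  have fY2: "finite Y2" unfolding Y2_def using fY1 by simp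
  define n where "n = real (card Y2)"
  define e where "e = (2::real) ^ j"
  define d where "d = (2::real) ^ k"
  have ed: "e > 0" "d > 0" "n \<ge> 0" unfolding e_def d_def n_def by simp_all
  have "(\<Sum>y\<in>Y2. real (f y) * real (g y)) \<le> (\<Sum>y\<in>Y2. (2 * e) * (2 * d))"
  proof (rule sum_mono)
    fix y assume y: "y \<in> Y2"
    have "real (f y) \<le> real (2 ^ (j + 1))" "real (g y) \<le> real (2 ^ (k + 1))"
      using y unfolding Y2_def Y1_def by (simp_all only: of_nat_le_iff) auto
    then show "real (f y) * real (g y) \<le> (2 * e) * (2 * d)"
      unfolding e_def d_def by (intro mult_mono) auto
  qed
  also have "\<dots> = 4 * (e * d * n)" unfolding n_def by simp
  finally have "(\<Sum>y\<in>Y1. real (f y) * real (g y)) \<le> real l * (4 * (e * d * n))"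
    using order_trans[OF k[folded Y2_def] mult_left_mono] by simp
  then have "(\<Sum>y\<in>Y. real (f y) * real (g y)) \<le> real l * (real l * (4 * (e * d * n)))"
    using order_trans[OF j[folded Y1_def] mult_left_mono] by simp
  then have V2: "\<omega> * z \<le> 4 * (real l)\<^sup>2 * (e * d * n)"
    using V1 by (simp add: power2_eq_square mult_ac)
  have n1: "n * e ^ 3 \<le> \<kappa> * K\<^sup>2"
  proof -
    have "n \<le> real (card {y. 2 ^ j \<le> rep A S y})" unfolding n_def
      by (intro of_nat_mono card_mono finite_rep_support A fS) (auto simp: Y2_def Y1_def f_def)
    then have "n * e ^ 3 \<le> real (card {y. 2 ^ j \<le> rep A S y}) * e ^ 3"
      by (rule mult_right_mono) (use ed in simp)
    also have "\<dots> \<le> \<kappa> * (real (card S))\<^sup>2"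
      using controlledD[OF ctl fS, of "2 ^ j"] unfolding e_def by simp
    also have "\<dots> \<le> \<kappa> * K\<^sup>2" by (intro mult_left_mono power_mono sK \<kappa>) auto
    finally show ?thesis .
  qed
  have n': "n \<le> real (card {y. 2 ^ k \<le> rep A P y})"
  proof -
    have "card Y2 \<le> card {y. 2 ^ k \<le> rep A P y}"
      by (rule card_inj_on_le[of uminus]) (auto simp: Y2_def g_def intro: finite_rep_support A fP)
    then show ?thesis unfolding n_def by (rule of_nat_mono)
  qed
  have n2: "n * d ^ 3 \<le> \<kappa> * p\<^sup>2"
  proof -
    have "n * d ^ 3 \<le> real (card {y. 2 ^ k \<le> rep A P y}) * d ^ 3"
      by (rule mult_right_mono[OF n']) (use ed in simp)
    also have "\<dots> \<le> \<kappa> * p\<^sup>2"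
      using controlledD[OF ctl fP, of "2 ^ k"] unfolding d_def p_def by simp
    finally show ?thesis .
  qed
  have n3: "n * d \<le> N * p"
  proof -
    have "card {y. 2 ^ k \<le> rep A P y} * 2 ^ k \<le> card A * card P" by (rule card_rep_level_le[OF A(1) fP])
    then have "real (card {y. 2 ^ k \<le> rep A P y} * 2 ^ k) \<le> real (card A * card P)" by (rule of_nat_mono)
    then have "real (card {y. 2 ^ k \<le> rep A P y}) * d \<le> N * p" unfolding d_def N_def p_def by simp
    then show ?thesis using mult_right_mono[OF n', of d] ed by linarith
  qed
  define V where "V = 4 * (real l)\<^sup>2 * (e * d * n)"
  have V0: "V \<ge> 0" unfolding V_def using ed by simp
  have 4: "V ^ 6 \<le> 4096 * real l ^ 12 * \<kappa> ^ 3 * K ^ 4 * N ^ 3 * p ^ 5"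
  proof -
    \<comment> \<open>The multiplicities 2, 3, 1 of the three available bounds are chosen so that n,
      e and d all receive exponent 6.\<close>
    have "(e * d * n) ^ 6 = (n * e ^ 3)\<^sup>2 * (n * d) ^ 3 * (n * d ^ 3)"
      by (simp add: power_mult_distrib eval_nat_numeral mult_ac)
    also have "\<dots> \<le> (\<kappa> * K\<^sup>2)\<^sup>2 * (N * p) ^ 3 * (\<kappa> * p\<^sup>2)"
      by (intro mult_mono power_mono n1 n2 n3) (use ed \<kappa> N p0 in auto)
    also have "\<dots> = \<kappa> ^ 3 * K ^ 4 * N ^ 3 * p ^ 5"
      by (simp add: power_mult_distrib eval_nat_numeral mult_ac)
    finally have "4096 * real l ^ 12 * (e * d * n) ^ 6 \<le> 4096 * real l ^ 12 * (\<kappa> ^ 3 * K ^ 4 * N ^ 3 * p ^ 5)"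
      by (rule mult_left_mono) simp
    then show ?thesis unfolding V_def by (simp add: power_mult_distrib mult_ac flip: power_mult)
  qed
  have 3: "N\<^sup>2 * z \<le> 16 * K * V"
  proof -
    have "N\<^sup>2 * z = 16 * K * (\<omega> * z)" unfolding \<omega>_def using K0 by simp
    also have "\<dots> \<le> 16 * K * V" by (rule mult_left_mono[OF V2[folded V_def]]) (use K0 in simp)
    finally show ?thesis .
  qed
  show ?thesis unfolding N_def[symmetric]
    by (rule sumset_exponent_algebra[OF _ _ _ _ _ _ _ _ 1 2 3 4 5])
      (use N p0 D0 K0 \<kappa> l0 V0 in \<open>simp_all add: z_def\<close>)
qed

section \<open>The Elekes--Ruzsa inequality\<close>

text \<open>Over each common value the count is a product of two fibre sizes a and b, and 2 a b <=
  a^2 + b^2.\<close>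

lemma card_coincidences_le:
  assumes "finite X" "finite Y"
  shows "2 * card {(p, q). p \<in> X \<and> q \<in> Y \<and> F p = G q}
    \<le> card {(p, p'). p \<in> X \<and> p' \<in> X \<and> F p = F p'} + card {(q, q'). q \<in> Y \<and> q' \<in> Y \<and> G q = G q'}"
proof -
  let ?S = "F ` X \<union> G ` Y"
  let ?f = "\<lambda>s. {p\<in>X. F p = s}" and ?g = "\<lambda>s. {q\<in>Y. G q = s}"
  have fS: "finite ?S" using assms by simp
  have 1: "card {(p, q). p \<in> X \<and> q \<in> Y \<and> F p = G q} = (\<Sum>s\<in>?S. card (?f s) * card (?g s))"
  proof -
    have "{(p, q). p \<in> X \<and> q \<in> Y \<and> F p = G q} = (\<Union>s\<in>?S. ?f s \<times> ?g s)" by auto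
    also have "card \<dots> = (\<Sum>s\<in>?S. card (?f s \<times> ?g s))"
      by (rule card_UN_disjoint) (use assms fS in auto)
    finally show ?thesis by (simp add: card_cartesian_product)
  qed
  have 2: "card {(p, p'). p \<in> X \<and> p' \<in> X \<and> F p = F p'} = (\<Sum>s\<in>?S. card (?f s) * card (?f s))"
  proof -
    have "{(p, p'). p \<in> X \<and> p' \<in> X \<and> F p = F p'} = (\<Union>s\<in>?S. ?f s \<times> ?f s)" by auto
    also have "card \<dots> = (\<Sum>s\<in>?S. card (?f s \<times> ?f s))"
      by (rule card_UN_disjoint) (use assms fS in auto)
    finally show ?thesis by (simp add: card_cartesian_product)
  qed
  have 3: "card {(q, q'). q \<in> Y \<and> q' \<in> Y \<and> G q = G q'} = (\<Sum>s\<in>?S. card (?g s) * card (?g s))"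
  proof -
    have "{(q, q'). q \<in> Y \<and> q' \<in> Y \<and> G q = G q'} = (\<Union>s\<in>?S. ?g s \<times> ?g s)" by auto
    also have "card \<dots> = (\<Sum>s\<in>?S. card (?g s \<times> ?g s))"
      by (rule card_UN_disjoint) (use assms fS in auto)
    finally show ?thesis by (simp add: card_cartesian_product)
  qed
  have "2 * (a * b) \<le> a * a + b * (b::nat)" for a b
  proof -
    have "2 * (real a * real b) \<le> real a * real a + real b * real b"
      using sum_squares_bound[of "real a" "real b"] by (simp add: power2_eq_square mult.assoc)
    then have "real (2 * (a * b)) \<le> real (a * a + b * b)" by simp
    then show ?thesis by (simp only: of_nat_le_iff)
  qed
  then show ?thesis unfolding 1 2 3 sum.distrib[symmetric] sum_distrib_left by (intro sum_mono)
qed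

text \<open>The second moment, over the intercepts, of the number of points of
  \<open>U \<times> U\<close> on the lines of slope \<mu>: the additive energy of U with its dilate
  by \<mu>.\<close>

definition quads :: "real set \<Rightarrow> real \<Rightarrow> nat" where
  "quads U \<mu> = card {(p, p'). p \<in> U \<times> U \<and> p' \<in> U \<times> U \<and> snd p - \<mu> * fst p = snd p' - \<mu> * fst p'}"

text \<open>For n lines with about e grid points each, counting incidences gives n e <= d t^2 and
  the rich-line bound gives n e^3 << t^4. Their product bounds the square of the second moment e^2
  n, whence the square root of \<open>card D\<close>.\<close>

lemma sum_quads_le:
  assumes U: "finite U" and D: "finite D" "\<And>\<mu>. \<mu> \<in> D \<Longrightarrow> 0 < \<mu>" "card D \<le> (card U)\<^sup>2"
    and l: "card U < 2 ^ l" "0 < l"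
  shows "(\<Sum>\<mu>\<in>D. real (quads U \<mu>)) \<le> 64 * real l * sqrt (real (card D)) * real (card U) ^ 3"
proof -
  define k where "k = (\<lambda>(\<mu>, x). card {u\<in>U. \<mu> * u + x \<in> U})"
  define X where "X \<mu> = (\<lambda>p. snd p - \<mu> * fst p) ` (U \<times> U)" for \<mu>
  define \<Omega> where "\<Omega> = (SIGMA \<mu>:D. X \<mu>)"
  have fX: "finite (X \<mu>)" for \<mu> unfolding X_def using U by simp
  have f\<Omega>: "finite \<Omega>" unfolding \<Omega>_def using D fX by simp
  define t where "t = real (card U)"
  define d where "d = real (card D)"
  have dt: "d \<le> t\<^sup>2" using of_nat_mono[OF D(3), where 'a=real] unfolding d_def t_def by simp
  have q: "quads U \<mu> \<le> (\<Sum>x\<in>X \<mu>. (k (\<mu>, x))\<^sup>2)" for \<mu>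
  proof -
    have "quads U \<mu> \<le> card (SIGMA x:X \<mu>. {u\<in>U. \<mu> * u + x \<in> U} \<times> {u\<in>U. \<mu> * u + x \<in> U})"
      unfolding quads_def
    proof (rule card_inj_on_le[of "\<lambda>(p, p'). (snd p - \<mu> * fst p, (fst p, fst p'))"])
      show "(\<lambda>(p, p'). (snd p - \<mu> * fst p, (fst p, fst p'))) `
          {(p, p'). p \<in> U \<times> U \<and> p' \<in> U \<times> U \<and> snd p - \<mu> * fst p = snd p' - \<mu> * fst p'}
        \<subseteq> (SIGMA x:X \<mu>. {u\<in>U. \<mu> * u + x \<in> U} \<times> {u\<in>U. \<mu> * u + x \<in> U})"
      proof (intro subsetI, elim imageE)
        fix y P assume P: "P \<in> {(p, p'). p \<in> U \<times> U \<and> p' \<in> U \<times> U \<and> snd p - \<mu> * fst p = snd p' - \<mu> * fst p'}"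
          and y: "y = (\<lambda>(p, p'). (snd p - \<mu> * fst p, (fst p, fst p'))) P"
        obtain a b a' b' where p: "P = ((a, b), (a', b'))" by (metis prod.collapse)
        have *: "a \<in> U" "b \<in> U" "a' \<in> U" "b' \<in> U" "b - \<mu> * a = b' - \<mu> * a'" using P unfolding p by auto
        have e: "\<mu> * a + (b - \<mu> * a) = b" "\<mu> * a' + (b - \<mu> * a) = b'" using *(5) by linarith+
        have "b - \<mu> * a \<in> X \<mu>" unfolding X_def using * by (intro image_eqI[of _ _ "(a, b)"]) auto
        then show "y \<in> (SIGMA x:X \<mu>. {u\<in>U. \<mu> * u + x \<in> U} \<times> {u\<in>U. \<mu> * u + x \<in> U})"
          unfolding y p using * e by (simp only: split_conv fst_conv snd_conv mem_Sigma_iff mem_Collect_eq)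
      qed
    qed (use U fX in \<open>auto simp: inj_on_def\<close>)
    also have "\<dots> = (\<Sum>x\<in>X \<mu>. (k (\<mu>, x))\<^sup>2)"
      using U fX by (simp add: card_cartesian_product k_def power2_eq_square)
    finally show ?thesis .
  qed
  have "real (\<Sum>\<mu>\<in>D. quads U \<mu>) \<le> real (\<Sum>\<mu>\<in>D. \<Sum>x\<in>X \<mu>. (k (\<mu>, x))\<^sup>2)"
    by (rule of_nat_mono) (rule sum_mono[OF q])
  also have "\<dots> = (\<Sum>p\<in>\<Omega>. (real (k p))\<^sup>2)"
    unfolding \<Omega>_def using D fX by (simp add: sum.Sigma split_def)
  finally have 1: "(\<Sum>\<mu>\<in>D. real (quads U \<mu>)) \<le> (\<Sum>p\<in>\<Omega>. (real (k p))\<^sup>2)" by simp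
  have kU: "k p \<le> card U" for p unfolding k_def using U by (cases p) (auto intro: card_mono)
  have k1: "1 \<le> k p" if p: "p \<in> \<Omega>" for p
  proof -
    obtain \<mu> x where [simp]: "p = (\<mu>, x)" by (cases p)
    have "{u\<in>U. \<mu> * u + x \<in> U} \<noteq> {}" using p unfolding \<Omega>_def X_def by auto
    then show ?thesis unfolding k_def using U by (simp add: Suc_le_eq card_gt_0_iff)
  qed
  have kl: "1 \<le> k p \<and> k p < 2 ^ l" if "p \<in> \<Omega>" for p using k1[OF that] kU[of p] l by linarith
  obtain i where i: "(\<Sum>p\<in>\<Omega>. (real (k p))\<^sup>2)
      \<le> real l * (\<Sum>p\<in>{p\<in>\<Omega>. 2 ^ i \<le> k p \<and> k p < 2 ^ (i + 1)}. (real (k p))\<^sup>2)"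
    using dyadic_pigeonhole[OF f\<Omega>, of k l "\<lambda>p. (real (k p))\<^sup>2"] kl l by auto
  define L where "L = {p\<in>\<Omega>. 2 ^ i \<le> k p \<and> k p < 2 ^ (i + 1)}"
  define n where "n = real (card L)"
  define e where "e = (2::real) ^ i"
  have fL: "finite L" unfolding L_def using f\<Omega> by simp
  have ne: "n \<ge> 0" "e > 0" unfolding n_def e_def by simp_all
  have kL: "e \<le> real (k p) \<and> real (k p) \<le> 2 * e" if "p \<in> L" for p
  proof -
    have "real (2 ^ i) \<le> real (k p)" "real (k p) \<le> real (2 ^ (i + 1))"
      using that unfolding L_def by (simp_all only: of_nat_le_iff) auto
    then show ?thesis unfolding e_def by simp
  qed
  have "(\<Sum>p\<in>L. (real (k p))\<^sup>2) \<le> (\<Sum>p\<in>L. (2 * e)\<^sup>2)"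
    by (intro sum_mono power_mono) (use kL in auto)
  also have "\<dots> = 4 * (e\<^sup>2 * n)" unfolding n_def by (simp add: power_mult_distrib)
  finally have 2: "(\<Sum>p\<in>\<Omega>. (real (k p))\<^sup>2) \<le> real l * (4 * (e\<^sup>2 * n))"
    using order_trans[OF i[folded L_def] mult_left_mono] by simp
  have 3: "n * e \<le> d * t\<^sup>2"
  proof -
    have "n * e = (\<Sum>p\<in>L. e)" unfolding n_def by simp
    also have "\<dots> \<le> (\<Sum>p\<in>L. real (k p))" by (rule sum_mono) (use kL in blast)
    also have "\<dots> \<le> (\<Sum>p\<in>\<Omega>. real (k p))" by (rule sum_mono2[OF f\<Omega>]) (auto simp: L_def)
    also have "\<dots> = (\<Sum>\<mu>\<in>D. \<Sum>x\<in>X \<mu>. real (k (\<mu>, x)))"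
      unfolding \<Omega>_def using D fX by (simp add: sum.Sigma split_def)
    also have "\<dots> \<le> (\<Sum>\<mu>\<in>D. t\<^sup>2)"
    proof (rule sum_mono)
      fix \<mu>
      have "(\<Sum>x\<in>X \<mu>. k (\<mu>, x)) = card (SIGMA x:X \<mu>. {u\<in>U. \<mu> * u + x \<in> U})"
        unfolding k_def using U fX by simp
      also have "\<dots> \<le> card (U \<times> U)"
        by (rule card_inj_on_le[of "\<lambda>(x, u). (u, \<mu> * u + x)"]) (use U in \<open>auto simp: inj_on_def\<close>)
      finally have "real (\<Sum>x\<in>X \<mu>. k (\<mu>, x)) \<le> real (card (U \<times> U))" by (rule of_nat_mono)
      then show "(\<Sum>x\<in>X \<mu>. real (k (\<mu>, x))) \<le> t\<^sup>2"
        unfolding t_def by (simp add: card_cartesian_product power2_eq_square)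
    qed
    finally show ?thesis unfolding d_def by simp
  qed
  have 4: "(e\<^sup>2 * n)\<^sup>2 \<le> 256 * d * t ^ 6"
  proof (cases "i = 0")
    \<comment> \<open>Lines with one point again need separate treatment; the hypothesis d <= t^2
      makes the incidence count squared small enough.\<close>
    case True
    then have "(e\<^sup>2 * n)\<^sup>2 = (n * e) * (n * e)" unfolding e_def by (simp add: power2_eq_square)
    also have "\<dots> \<le> (d * t\<^sup>2) * (d * t\<^sup>2)" by (intro mult_mono 3) (use ne in \<open>auto simp: d_def\<close>)
    also have "\<dots> = d * t ^ 4 * d" by (simp add: eval_nat_numeral)
    also have "\<dots> \<le> d * t ^ 4 * t\<^sup>2" by (rule mult_left_mono[OF dt]) (simp add: d_def t_def)
    also have "\<dots> \<le> 256 * d * t ^ 6" by (simp add: eval_nat_numeral d_def t_def)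
    finally show ?thesis .
  next
    case False
    then have i2: "(2::nat) \<le> 2 ^ i" using power_increasing[of 1 i "2::nat"] by simp
    have "card L * (2 ^ i) ^ 3 \<le> 256 * (card U)\<^sup>2 * (card U)\<^sup>2"
    proof (rule card_rich_lines_le[OF U U fL i2])
      fix \<mu> x assume "(\<mu>, x) \<in> L"
      then show "0 < \<mu> \<and> 2 ^ i \<le> card {u \<in> U. \<mu> * u + x \<in> U}"
        unfolding L_def \<Omega>_def k_def using D(2) by auto
    qed
    then have "real (card L * (2 ^ i) ^ 3) \<le> real (256 * (card U)\<^sup>2 * (card U)\<^sup>2)" by (rule of_nat_mono)
    then have r: "n * e ^ 3 \<le> 256 * t ^ 4"
      unfolding n_def e_def t_def by (simp add: eval_nat_numeral mult_ac)
    have "(e\<^sup>2 * n)\<^sup>2 = (n * e) * (n * e ^ 3)" by (simp add: eval_nat_numeral)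
    also have "\<dots> \<le> (d * t\<^sup>2) * (256 * t ^ 4)"
      by (intro mult_mono 3 r) (use ne in \<open>auto simp: d_def\<close>)
    finally show ?thesis by (simp add: eval_nat_numeral mult_ac)
  qed
  have "(16 * s * t ^ 3)\<^sup>2 = 256 * (s * s) * t ^ 6" for s
    by (simp add: eval_nat_numeral)
  from this[of "sqrt d"] have sq: "(16 * sqrt d * t ^ 3)\<^sup>2 = 256 * d * t ^ 6"
    by (simp add: d_def)
  have "e\<^sup>2 * n \<le> 16 * sqrt d * t ^ 3"
    by (rule power2_le_imp_le[of "e\<^sup>2 * n" "16 * sqrt d * t ^ 3"]) (use 4 sq in \<open>simp_all add: d_def t_def\<close>)
  then have "real l * (4 * (e\<^sup>2 * n)) \<le> real l * (4 * (16 * sqrt d * t ^ 3))"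
    by (intro mult_left_mono) auto
  then show ?thesis using 1 2 unfolding d_def t_def by (simp add: mult_ac)
qed

text \<open>Expanding both \<open>u\<close> and \<open>\<mu> * u\<close> by means of the linear equation leads to coincidences of lines of slope \<open>\<mu>\<close> in the grids \<open>U2 \<times> U2\<close> and \<open>U3 \<times> U3\<close>.\<close>
lemma sum_dilation_correlation_le:
  fixes \<alpha> \<beta> \<gamma> :: real and U1 U2 U3 :: "real set"
  defines "w \<equiv> \<lambda>u. card {(v, z). v \<in> U2 \<and> z \<in> U3 \<and> \<alpha> * u + \<beta> * v = \<gamma> * z}"
  assumes U: "finite U1" "finite U2" "finite U3" "card U2 = t" "card U3 = t"
    and nz: "\<alpha> \<noteq> 0" "\<beta> \<noteq> 0" "\<gamma> \<noteq> 0"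
    and D: "finite D" "\<And>\<mu>. \<mu> \<in> D \<Longrightarrow> 0 < \<mu>" "card D \<le> t\<^sup>2" and l: "t < 2 ^ l" "0 < l"
  shows "(\<Sum>\<mu>\<in>D. \<Sum>u\<in>{u\<in>U1. \<mu> * u \<in> U1}. real (w u) * real (w (\<mu> * u)))
    \<le> 64 * real l * sqrt (real (card D)) * real t ^ 3"
proof -
  let ?W = "\<lambda>u. {(v, z). v \<in> U2 \<and> z \<in> U3 \<and> \<alpha> * u + \<beta> * v = \<gamma> * z}"
  have fW: "finite (?W u)" for u by (rule finite_subset[of _ "U2 \<times> U3"]) (use U in auto)
  have one: "2 * (\<Sum>u\<in>{u\<in>U1. \<mu> * u \<in> U1}. w u * w (\<mu> * u)) \<le> quads U3 \<mu> + quads U2 \<mu>" for \<mu>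
  proof -
    let ?F = "\<lambda>p. \<gamma> * (snd p - \<mu> * fst p)" and ?G = "\<lambda>p. \<beta> * (snd p - \<mu> * fst p)"
    have "(\<Sum>u\<in>{u\<in>U1. \<mu> * u \<in> U1}. w u * w (\<mu> * u)) = card (SIGMA u:{u\<in>U1. \<mu> * u \<in> U1}. ?W u \<times> ?W (\<mu> * u))"
      unfolding w_def using U fW by (simp add: card_cartesian_product)
    also have "\<dots> \<le> card {(p, q). p \<in> U3 \<times> U3 \<and> q \<in> U2 \<times> U2 \<and> ?F p = ?G q}"
    proof (rule card_inj_on_le[of "\<lambda>(u, ((v, z), (v', z'))). ((z, z'), (v, v'))"])
      show "inj_on (\<lambda>(u, ((v, z), (v', z'))). ((z, z'), (v, v'))) (SIGMA u:{u\<in>U1. \<mu> * u \<in> U1}. ?W u \<times> ?W (\<mu> * u))"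
      proof (rule inj_onI)
        fix P Q assume P: "P \<in> (SIGMA u:{u\<in>U1. \<mu> * u \<in> U1}. ?W u \<times> ?W (\<mu> * u))"
          and Q: "Q \<in> (SIGMA u:{u\<in>U1. \<mu> * u \<in> U1}. ?W u \<times> ?W (\<mu> * u))"
          and e: "(\<lambda>(u, ((v, z), (v', z'))). ((z, z'), (v, v'))) P = (\<lambda>(u, ((v, z), (v', z'))). ((z, z'), (v, v'))) Q"
        obtain u v z v' z' where p: "P = (u, ((v, z), (v', z')))" by (metis prod.collapse)
        obtain x y y' s s' where q: "Q = (x, ((y, s), (y', s')))" by (metis prod.collapse)
        have "\<alpha> * u + \<beta> * v = \<gamma> * z" "\<alpha> * x + \<beta> * v = \<gamma> * z" using P Q e unfolding p q by auto
        then have "\<alpha> * u = \<alpha> * x" by linarith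
        then show "P = Q" using e nz unfolding p q by simp
      qed
      show "(\<lambda>(u, ((v, z), (v', z'))). ((z, z'), (v, v'))) ` (SIGMA u:{u\<in>U1. \<mu> * u \<in> U1}. ?W u \<times> ?W (\<mu> * u))
          \<subseteq> {(p, q). p \<in> U3 \<times> U3 \<and> q \<in> U2 \<times> U2 \<and> ?F p = ?G q}"
      proof (intro subsetI, elim imageE)
        fix y P assume P: "P \<in> (SIGMA u:{u\<in>U1. \<mu> * u \<in> U1}. ?W u \<times> ?W (\<mu> * u))"
          and y: "y = (\<lambda>(u, ((v, z), (v', z'))). ((z, z'), (v, v'))) P"
        obtain u v z v' z' where p: "P = (u, ((v, z), (v', z')))" by (metis prod.collapse)
        have *: "v \<in> U2" "z \<in> U3" "v' \<in> U2" "z' \<in> U3" and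
          e: "\<alpha> * u + \<beta> * v = \<gamma> * z" "\<alpha> * (\<mu> * u) + \<beta> * v' = \<gamma> * z'" using P unfolding p by auto
        \<comment> \<open>Subtracting \<mu> times the equation for u from the equation for \<mu> u
          cancels u.\<close>
        have "\<gamma> * (z' - \<mu> * z) = (\<gamma> * z') - \<mu> * (\<gamma> * z)" by (simp add: algebra_simps)
        also have "\<dots> = \<beta> * (v' - \<mu> * v)" unfolding e[symmetric] by (simp add: algebra_simps)
        finally show "y \<in> {(p, q). p \<in> U3 \<times> U3 \<and> q \<in> U2 \<times> U2 \<and> ?F p = ?G q}"
          unfolding y p using * by simp
      qed
      show "finite {(p, q). p \<in> U3 \<times> U3 \<and> q \<in> U2 \<times> U2 \<and> ?F p = ?G q}"
        by (rule finite_subset[of _ "(U3 \<times> U3) \<times> (U2 \<times> U2)"]) (use U in auto)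
    qed
    finally have "2 * (\<Sum>u\<in>{u\<in>U1. \<mu> * u \<in> U1}. w u * w (\<mu> * u))
        \<le> 2 * card {(p, q). p \<in> U3 \<times> U3 \<and> q \<in> U2 \<times> U2 \<and> ?F p = ?G q}" by simp
    also have "\<dots> \<le> card {(p, p'). p \<in> U3 \<times> U3 \<and> p' \<in> U3 \<times> U3 \<and> ?F p = ?F p'}
        + card {(q, q'). q \<in> U2 \<times> U2 \<and> q' \<in> U2 \<times> U2 \<and> ?G q = ?G q'}"
      by (rule card_coincidences_le) (use U in auto)
    also have "\<dots> = quads U3 \<mu> + quads U2 \<mu>"
      unfolding quads_def using nz by (simp only: mult_cancel_left simp_thms)
    finally show ?thesis .
  qed
  have "2 * (\<Sum>\<mu>\<in>D. \<Sum>u\<in>{u\<in>U1. \<mu> * u \<in> U1}. real (w u) * real (w (\<mu> * u)))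
      = (\<Sum>\<mu>\<in>D. real (2 * (\<Sum>u\<in>{u\<in>U1. \<mu> * u \<in> U1}. w u * w (\<mu> * u))))"
    by (simp add: sum_distrib_left)
  also have "\<dots> \<le> (\<Sum>\<mu>\<in>D. real (quads U3 \<mu> + quads U2 \<mu>))"
    by (rule sum_mono) (rule of_nat_mono[OF one])
  also have "\<dots> = (\<Sum>\<mu>\<in>D. real (quads U3 \<mu>)) + (\<Sum>\<mu>\<in>D. real (quads U2 \<mu>))"
    by (simp add: sum.distrib)
  also have "\<dots> \<le> 64 * real l * sqrt (real (card D)) * real t ^ 3 + 64 * real l * sqrt (real (card D)) * real t ^ 3"
    using sum_quads_le[OF U(3) D(1,2), of l] sum_quads_le[OF U(2) D(1,2), of l] U D l by simp
  finally show ?thesis by simp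
qed

section \<open>Blocks of consecutive slopes\<close>

lemma card_increasing_pairs:
  fixes B :: "'a::linorder set"
  assumes "finite B"
  shows "2 * card {(i, j). i \<in> B \<and> j \<in> B \<and> i < j} = card B * (card B - 1)"
proof -
  let ?P = "{(i, j). i \<in> B \<and> j \<in> B \<and> i < j}" and ?Q = "{(i, j). i \<in> B \<and> j \<in> B \<and> j < i}"
  have fin: "finite ?P" "finite ?Q" by (rule finite_subset[of _ "B \<times> B"]; use assms in auto)+
  have "?Q = prod.swap ` ?P" by auto
  then have "card ?Q = card ?P" by (simp add: card_image)
  moreover have e: "B \<times> B - Id_on B = ?P \<union> ?Q" by (auto simp: Id_on_def)
  have "card (B \<times> B - Id_on B) = card ?P + card ?Q"
    unfolding e by (rule card_Un_disjoint) (use fin in auto)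
  moreover have "Id_on B = (\<lambda>b. (b, b)) ` B" unfolding Id_on_def by auto
  then have "card (Id_on B) = card B" by (simp add: card_image inj_on_def)
  moreover have "card (B \<times> B - Id_on B) = card (B \<times> B) - card (Id_on B)"
    by (rule card_Diff_subset) (use assms in \<open>auto simp: Id_on_def\<close>)
  ultimately show ?thesis by (simp add: card_cartesian_product diff_mult_distrib2)
qed

text \<open>Cauchy--Schwarz on the pairs (index, point). With m sets, the diagonal contributes m s
  to the collisions and the m^2 intersections of size at most s / m contribute another m s, so the
  union has at least (m s)^2 / (2 m s) points.\<close>

lemma card_Union_ge_of_small_intersections:
  assumes I: "finite I" and G: "\<And>i. i \<in> I \<Longrightarrow> finite (G i) \<and> card (G i) = s"
    and int: "\<And>i j. i \<in> I \<Longrightarrow> j \<in> I \<Longrightarrow> i \<noteq> j \<Longrightarrow> card (G i \<inter> G j) * card I \<le> s"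
  shows "card I * s \<le> 2 * card (\<Union>i\<in>I. G i)"
proof (cases "card I * s = 0")
  case False
  define m where "m = card I"
  have ms: "m > 0" "s > 0" using False unfolding m_def by auto
  define W where "W = (SIGMA i:I. G i)"
  have fW: "finite W" unfolding W_def using I G by auto
  have cW: "card W = m * s" unfolding W_def m_def using I G by simp
  define Q where "Q = {(w, w'). w \<in> W \<and> w' \<in> W \<and> snd w = snd w'}"
  have fS: "finite (SIGMA p:I \<times> I. G (fst p) \<inter> G (snd p))"
    by (intro finite_SigmaI finite_cartesian_product I finite_Int disjI1) (use G in auto)
  have "Q \<subseteq> (\<lambda>((i, j), x). ((i, x), (j, x))) ` (SIGMA p:I \<times> I. G (fst p) \<inter> G (snd p))"
    unfolding Q_def W_def by force
  then have "card Q \<le> card ((\<lambda>((i, j), x). ((i, x), (j, x))) ` (SIGMA p:I \<times> I. G (fst p) \<inter> G (snd p)))"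
    by (rule card_mono[OF finite_imageI[OF fS]])
  also have "\<dots> \<le> card (SIGMA p:I \<times> I. G (fst p) \<inter> G (snd p))"
    by (rule card_image_le[OF fS])
  also have "\<dots> = (\<Sum>p\<in>I \<times> I. card (G (fst p) \<inter> G (snd p)))"
    by (rule card_SigmaI) (use I G in auto)
  finally have "card Q * m \<le> (\<Sum>p\<in>I \<times> I. card (G (fst p) \<inter> G (snd p)) * m)"
    by (simp add: sum_distrib_right[symmetric])
  also have "\<dots> \<le> (\<Sum>p\<in>I \<times> I. s + (if fst p = snd p then s * m else 0))"
  proof (rule sum_mono)
    fix p assume p: "p \<in> I \<times> I"
    show "card (G (fst p) \<inter> G (snd p)) * m \<le> s + (if fst p = snd p then s * m else 0)"
    proof (cases "fst p = snd p")
      case True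
      then show ?thesis using p G[of "snd p"] by auto
    next
      case False
      then show ?thesis using int[of "fst p" "snd p"] p unfolding m_def by auto
    qed
  qed
  also have "\<dots> = 2 * (m * m * s)"
  proof -
    have "(\<Sum>p\<in>I \<times> I. if fst p = snd p then s * m else 0) = (\<Sum>i\<in>I. \<Sum>j\<in>I. if i = j then s * m else 0)"
      by (simp add: sum.cartesian_product split_def)
    also have "\<dots> = m * (s * m)" using I unfolding m_def by simp
    finally show ?thesis by (simp add: sum.distrib card_cartesian_product m_def)
  qed
  finally have Q: "card Q \<le> 2 * (m * s)" using ms by simp
  have "(m * s)\<^sup>2 \<le> card (snd ` W) * card Q"
    using image_Cauchy_Schwarz[OF fW, of snd] unfolding cW Q_def .
  also have "\<dots> \<le> card (snd ` W) * (2 * (m * s))" by (rule mult_le_mono2[OF Q])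
  finally have "m * s \<le> 2 * card (snd ` W)" using ms by (simp add: power2_eq_square)
  moreover have "snd ` W = (\<Union>i\<in>I. G i)" unfolding W_def by force
  ultimately show ?thesis unfolding m_def by simp
next
  case True
  show ?thesis unfolding True by simp
qed

text \<open>Blocks are ranks divided by L, hence runs of consecutive elements. Indices below
  \<open>card \<Lambda> div L\<close> belong to full blocks; the remaining elements form an
  incomplete last block, to which the first claim does not apply.\<close>

lemma rank_blocks:
  fixes \<Lambda> :: "real set"
  assumes "finite \<Lambda>" "0 < L"
  defines "blk \<equiv> \<lambda>x. card {y\<in>\<Lambda>. y < x} div L"
  shows "b < card \<Lambda> div L \<Longrightarrow> card {x\<in>\<Lambda>. blk x = b} = L"
    and "x \<in> \<Lambda> \<Longrightarrow> y \<in> \<Lambda> \<Longrightarrow> blk x < blk y \<Longrightarrow> x < y"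
proof -
  define r where "r x = card {y\<in>\<Lambda>. y < x}" for x
  have mono: "r x < r y" if "x \<in> \<Lambda>" "x < y" for x y
    unfolding r_def by (rule psubset_card_mono) (use assms that in auto)
  have le: "r y \<le> r x" if "y \<le> x" for x y
    unfolding r_def by (rule card_mono) (use assms that in auto)
  show "x \<in> \<Lambda> \<Longrightarrow> y \<in> \<Lambda> \<Longrightarrow> blk x < blk y \<Longrightarrow> x < y"
  proof (rule ccontr)
    assume "blk x < blk y" "\<not> x < y"
    then have "r y \<le> r x" using le by simp
    then have "r y div L \<le> r x div L" by (rule div_le_mono)
    then show False using \<open>blk x < blk y\<close> unfolding blk_def r_def by simp
  qed
  have inj: "inj_on r \<Lambda>"
  proof (rule inj_onI)
    fix x y assume "x \<in> \<Lambda>" "y \<in> \<Lambda>" "r x = r y"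
    then show "x = y" using mono[of x y] mono[of y x] by (cases x y rule: linorder_cases) auto
  qed
  have "r ` \<Lambda> \<subseteq> {..<card \<Lambda>}"
  proof
    fix k assume "k \<in> r ` \<Lambda>"
    then obtain x where x: "x \<in> \<Lambda>" "k = r x" by blast
    have "r x < card \<Lambda>" unfolding r_def by (rule psubset_card_mono) (use assms x in auto)
    then show "k \<in> {..<card \<Lambda>}" using x by simp
  qed
  then have img: "r ` \<Lambda> = {..<card \<Lambda>}"
    using card_image[OF inj] by (intro card_subset_eq) auto
  show "card {x\<in>\<Lambda>. blk x = b} = L" if b: "b < card \<Lambda> div L"
  proof -
    have bl: "(b + 1) * L \<le> card \<Lambda>"
      using mult_le_mono1[of "b + 1" "card \<Lambda> div L" L] b div_times_less_eq_dividend[of "card \<Lambda>" L] by linarith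
    have "r ` {x\<in>\<Lambda>. blk x = b} = {k\<in>r ` \<Lambda>. k div L = b}" unfolding blk_def r_def by auto
    also have "\<dots> = {b * L..<b * L + L}"
    proof -
      have dv: "k div L = b \<longleftrightarrow> b * L \<le> k \<and> k < b * L + L" for k
      proof
        assume "k div L = b"
        then show "b * L \<le> k \<and> k < b * L + L"
          using div_mult_mod_eq[of k L] mod_less_divisor[OF assms(2), of k] by auto
      next
        assume "b * L \<le> k \<and> k < b * L + L"
        then show "k div L = b" by (intro div_nat_eqI) (simp_all add: mult.commute)
      qed
      have bl': "b * L + L \<le> card \<Lambda>" using bl by (simp add: algebra_simps)
      have "k \<in> {k\<in>{..<card \<Lambda>}. k div L = b} \<longleftrightarrow> k \<in> {b * L..<b * L + L}" for k
        unfolding mem_Collect_eq dv lessThan_iff atLeastLessThan_iff using bl' by linarith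
      then show ?thesis unfolding img by blast
    qed
    finally have "card (r ` {x\<in>\<Lambda>. blk x = b}) = L" by simp
    moreover have "inj_on r {x\<in>\<Lambda>. blk x = b}" by (rule inj_on_subset[OF inj]) auto
    ultimately show ?thesis by (simp add: card_image)
  qed
qed

section \<open>Sums of points on two lines through the origin\<close>

text \<open>The coefficients are differences of slopes, so for l different from i, j, k they are
  nonzero and \<open>sum_dilation_correlation_le\<close> applies with \<alpha> = i - l, \<beta> = j
  - l, \<gamma> = k - l.\<close>

definition triple_count :: "(real \<Rightarrow> real set) \<Rightarrow> real \<Rightarrow> real \<Rightarrow> real \<Rightarrow> real \<Rightarrow> nat" where
  "triple_count U i j k l = card {(u, v, z). u \<in> U i \<and> v \<in> U j \<and> z \<in> U k \<and> (i - l) * u + (j - l) * v = (k - l) * z}"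

text \<open>The vector sums of points (u, i u) and (v, j v) on the lines of slopes i and j.\<close>

definition grid :: "(real \<Rightarrow> real set) \<Rightarrow> real \<times> real \<Rightarrow> (real \<times> real) set" where
  "grid U = (\<lambda>(i, j). (\<lambda>(u, v). (u + v, i * u + j * v)) ` (U i \<times> U j))"

lemma mem_grid_iff: "y \<in> grid U (i, j) \<longleftrightarrow> (\<exists>u\<in>U i. \<exists>v\<in>U j. y = (u + v, i * u + j * v))"
  unfolding grid_def by auto

lemma card_grid:
  assumes "i \<noteq> j"
  shows "card (grid U (i, j)) = card (U i) * card (U j)"
proof -
  have "inj_on (\<lambda>(u, v). (u + v, i * u + j * v)) (U i \<times> U j)"
  proof (rule inj_onI, clarify)
    fix u v u' v' assume e: "u + v = u' + v'" "i * u + j * v = i * u' + j * v'"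
    have "(i - j) * u = (i * u + j * v) - j * (u + v)" by (simp add: algebra_simps)
    also have "\<dots> = (i - j) * u'" unfolding e by (simp add: algebra_simps)
    finally have "u = u'" using assms by simp
    then show "u = u' \<and> v = v'" using e by simp
  qed
  then show ?thesis unfolding grid_def by (simp add: card_image card_cartesian_product)
qed

text \<open>Eliminating the coordinate on the line of slope \<open>l\<close> turns a common point of two grids into a solution of a linear equation in three variables.\<close>
lemma card_grid_Int_le:
  assumes fin: "finite (U i)" "finite (U j)" "finite (U k)" and ne: "i \<noteq> j" "l \<noteq> i" "l \<noteq> j" "l \<noteq> k"
  shows "card (grid U (i, j) \<inter> grid U (k, l)) \<le> triple_count U i j k l"
    and "card (grid U (i, j) \<inter> grid U (l, k)) \<le> triple_count U i j k l"
proof -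
  let ?T = "{(u, v, z). u \<in> U i \<and> v \<in> U j \<and> z \<in> U k \<and> (i - l) * u + (j - l) * v = (k - l) * z}"
  have fT: "finite ?T" by (rule finite_subset[of _ "U i \<times> U j \<times> U k"]) (use fin in auto)
  have key: "card Y \<le> card ?T"
    if Y: "\<And>y. y \<in> Y \<Longrightarrow> \<exists>u\<in>U i. \<exists>v\<in>U j. \<exists>z\<in>U k. \<exists>x. y = (u + v, i * u + j * v) \<and> y = (z + x, k * z + l * x)" for Y
  proof -
    have "Y \<subseteq> (\<lambda>(u, v, z). (u + v, i * u + j * v)) ` ?T"
    proof
      fix y assume "y \<in> Y"
      then obtain u v z x where *: "u \<in> U i" "v \<in> U j" "z \<in> U k" "y = (u + v, i * u + j * v)" "y = (z + x, k * z + l * x)"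
        using Y by blast
      then have e: "u + v = z + x" "i * u + j * v = k * z + l * x" by auto
      have "(i - l) * u + (j - l) * v = (i * u + j * v) - l * (u + v)" by (simp add: algebra_simps)
      also have "\<dots> = (k - l) * z" unfolding e by (simp add: algebra_simps)
      finally show "y \<in> (\<lambda>(u, v, z). (u + v, i * u + j * v)) ` ?T"
        using * by (intro image_eqI[of _ _ "(u, v, z)"]) auto
    qed
    then have "card Y \<le> card ((\<lambda>(u, v, z). (u + v, i * u + j * v)) ` ?T)"
      by (rule card_mono[rotated]) (use fT in simp)
    also have "\<dots> \<le> card ?T" by (rule card_image_le[OF fT])
    finally show ?thesis .
  qed
  show "card (grid U (i, j) \<inter> grid U (k, l)) \<le> triple_count U i j k l"
    unfolding triple_count_def by (rule key) (unfold Int_iff mem_grid_iff, blast)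
  show "card (grid U (i, j) \<inter> grid U (l, k)) \<le> triple_count U i j k l"
    unfolding triple_count_def
  proof (rule key)
    fix y assume "y \<in> grid U (i, j) \<inter> grid U (l, k)"
    then obtain u v x z where *: "u \<in> U i" "v \<in> U j" "z \<in> U k" "y = (u + v, i * u + j * v)" "y = (x + z, l * x + k * z)"
      unfolding Int_iff mem_grid_iff by blast
    have "y = (z + x, k * z + l * x)" using *(5) by (simp add: add.commute)
    then show "\<exists>u\<in>U i. \<exists>v\<in>U j. \<exists>z\<in>U k. \<exists>x. y = (u + v, i * u + j * v) \<and> y = (z + x, k * z + l * x)"
      using *(1-4) by blast
  qed
qed

text \<open>
  Solymosi's argument with the sums taken over all pairs of lines from blocks of \<open>L\<close> consecutive
  slopes, as in the work of Konyagin and Shkredov.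
\<close>
lemma sumset_lower_bound_by_blocks:
  fixes A \<Lambda> :: "real set" and U :: "real \<Rightarrow> real set"
  assumes A: "finite A" "\<And>a. a \<in> A \<Longrightarrow> 0 < a" and \<Lambda>: "finite \<Lambda>"
    and U: "\<And>i. i \<in> \<Lambda> \<Longrightarrow> U i \<subseteq> {u\<in>A. i * u \<in> A} \<and> card (U i) = t"
    and L: "2 \<le> L"
    and trip: "\<And>i j k l. i \<in> \<Lambda> \<Longrightarrow> j \<in> \<Lambda> \<Longrightarrow> k \<in> \<Lambda> \<Longrightarrow> l \<in> \<Lambda> \<Longrightarrow> i \<noteq> j \<Longrightarrow> l \<noteq> i \<Longrightarrow> l \<noteq> j \<Longrightarrow> l \<noteq> k
      \<Longrightarrow> triple_count U i j k l * (L * (L - 1)) \<le> 2 * t\<^sup>2"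
  shows "card \<Lambda> div L * (L * (L - 1) * t\<^sup>2) \<le> 4 * (card (A + A))\<^sup>2"
proof -
  define blk where "blk x = card {y\<in>\<Lambda>. y < x} div L" for x
  define B where "B b = {x\<in>\<Lambda>. blk x = b}" for b
  define I where "I b = {(i, j). i \<in> B b \<and> j \<in> B b \<and> i < j}" for b
  define \<Sigma> where "\<Sigma> b = (\<Union>p\<in>I b. grid U p)" for b
  have L0: "0 < L" using L by simp
  have fB: "finite (B b)" for b unfolding B_def using \<Lambda> by simp
  have fI: "finite (I b)" for b by (rule finite_subset[of _ "B b \<times> B b"]) (use fB in \<open>auto simp: I_def\<close>)
  have fU: "finite (U i)" if "i \<in> \<Lambda>" for i using U[OF that] A by (auto intro: finite_subset)
  have fg: "finite (grid U p)" if "p \<in> I b" for p b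
    using that fU unfolding I_def B_def grid_def by auto
  \<comment> \<open>A full block has L (L - 1) / 2 pairs of slopes, so the hypothesis on triple
    counts says exactly that intersections are small in the sense of the union lemma.\<close>
  have big: "L * (L - 1) * t\<^sup>2 \<le> 4 * card (\<Sigma> b)" if b: "b < card \<Lambda> div L" for b
  proof -
    have cB: "card (B b) = L" unfolding B_def blk_def by (rule rank_blocks(1)[OF \<Lambda> L0 b])
    have cI: "2 * card (I b) = L * (L - 1)" unfolding I_def using card_increasing_pairs[OF fB, of b] cB by simp
    have "card (I b) * t\<^sup>2 \<le> 2 * card (\<Union>p\<in>I b. grid U p)"
    proof (rule card_Union_ge_of_small_intersections[OF fI])
      fix p assume p: "p \<in> I b"
      obtain i j where [simp]: "p = (i, j)" by (cases p)
      have "i \<in> \<Lambda>" "j \<in> \<Lambda>" "i \<noteq> j" using p unfolding I_def B_def by auto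
      then show "finite (grid U p) \<and> card (grid U p) = t\<^sup>2"
        using fg[OF p] U by (simp add: card_grid power2_eq_square)
    next
      fix p q assume pq: "p \<in> I b" "q \<in> I b" "p \<noteq> q"
      obtain i j k l where [simp]: "p = (i, j)" "q = (k, l)" by (cases p, cases q)
      have m: "i \<in> \<Lambda>" "j \<in> \<Lambda>" "k \<in> \<Lambda>" "l \<in> \<Lambda>" "i < j" "k < l" using pq unfolding I_def B_def by auto
      have "card (grid U p \<inter> grid U q) * (L * (L - 1)) \<le> 2 * t\<^sup>2"
      \<comment> \<open>The eliminated slope must avoid i and j. If l is one of them then k is not,
        because p and q are distinct increasing pairs.\<close>
      proof (cases "l = i \<or> l = j")
        case False
        then have "card (grid U p \<inter> grid U q) \<le> triple_count U i j k l"
          using card_grid_Int_le(1)[of U i j k l] m fU by simp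
        moreover have "triple_count U i j k l * (L * (L - 1)) \<le> 2 * t\<^sup>2"
          by (rule trip) (use m False in auto)
        ultimately show ?thesis using mult_le_mono1 order_trans by blast
      next
        case True
        then have k: "k \<noteq> i" "k \<noteq> j" "k \<noteq> l" using pq m by auto
        then have "card (grid U p \<inter> grid U q) \<le> triple_count U i j l k"
          using card_grid_Int_le(2)[of U i j l k] m fU by simp
        moreover have "triple_count U i j l k * (L * (L - 1)) \<le> 2 * t\<^sup>2"
          by (rule trip) (use m k in auto)
        ultimately show ?thesis using mult_le_mono1 order_trans by blast
      qed
      then show "card (grid U p \<inter> grid U q) * card (I b) \<le> t\<^sup>2" unfolding cI[symmetric] by simp
    qed
    then show ?thesis unfolding \<Sigma>_def cI[symmetric] by simp
  qed
  have \<Sigma>_iff: "w \<in> \<Sigma> b \<longleftrightarrow> (\<exists>i j. i \<in> B b \<and> j \<in> B b \<and> i < j \<and> w \<in> grid U (i, j))" for w b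
    unfolding \<Sigma>_def I_def by auto
  \<comment> \<open>A sum of positive vectors lies strictly between their rays. Different blocks
    therefore occupy disjoint sectors, and their point counts add up.\<close>
  have cone: "0 < fst w \<and> (\<exists>i j. i \<in> \<Lambda> \<and> j \<in> \<Lambda> \<and> blk i = b \<and> blk j = b \<and> i * fst w < snd w \<and> snd w < j * fst w)"
    if w: "w \<in> \<Sigma> b" for w b
  proof -
    obtain i j u v where *: "i \<in> B b" "j \<in> B b" "i < j" "u \<in> U i" "v \<in> U j" "w = (u + v, i * u + j * v)"
      using w unfolding \<Sigma>_iff mem_grid_iff by blast
    have ij: "i \<in> \<Lambda>" "j \<in> \<Lambda>" "blk i = b" "blk j = b" using * unfolding B_def by auto
    have uv: "0 < u" "0 < v" using U[OF ij(1)] U[OF ij(2)] * A(2) by auto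
    have "i * v < j * v" "i * u < j * u" using * uv by simp_all
    then have "i * fst w < snd w" "snd w < j * fst w" "0 < fst w" using * uv by (simp_all add: algebra_simps)
    then show ?thesis using ij by blast
  qed
  have noover: "w \<notin> \<Sigma> c" if w: "w \<in> \<Sigma> b" and bc: "b < c" for w b c
  proof
    assume "w \<in> \<Sigma> c"
    then obtain k where k: "k \<in> \<Lambda>" "blk k = c" "k * fst w < snd w" using cone by blast
    obtain j where j: "0 < fst w" "j \<in> \<Lambda>" "blk j = b" "snd w < j * fst w" using cone[OF w] by blast
    have "j < k" using rank_blocks(2)[OF \<Lambda> L0, of j k] j k bc unfolding blk_def by simp
    then have "j * fst w < k * fst w" using j by simp
    then show False using j k by linarith
  qed
  have f\<Sigma>: "finite (\<Sigma> b)" for b unfolding \<Sigma>_def using fI fg by blast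
  have sub: "\<Sigma> b \<subseteq> (A + A) \<times> (A + A)" for b
  proof
    fix w assume "w \<in> \<Sigma> b"
    then obtain i j u v where *: "i \<in> B b" "j \<in> B b" "u \<in> U i" "v \<in> U j" "w = (u + v, i * u + j * v)"
      unfolding \<Sigma>_iff mem_grid_iff by blast
    have "i \<in> \<Lambda>" "j \<in> \<Lambda>" using * unfolding B_def by auto
    then have "u \<in> A" "v \<in> A" "i * u \<in> A" "j * v \<in> A" using U * by auto
    then show "w \<in> (A + A) \<times> (A + A)" using * by (auto intro: set_plus_intro)
  qed
  have fAA: "finite ((A + A) \<times> (A + A))" using A by (intro finite_cartesian_product finite_set_plus)
  have "card \<Lambda> div L * (L * (L - 1) * t\<^sup>2) = (\<Sum>b<card \<Lambda> div L. L * (L - 1) * t\<^sup>2)" by simp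
  also have "\<dots> \<le> (\<Sum>b<card \<Lambda> div L. 4 * card (\<Sigma> b))" by (rule sum_mono) (use big in auto)
  also have "\<dots> = 4 * card (\<Union>b<card \<Lambda> div L. \<Sigma> b)"
  proof -
    have "card (\<Union>b<card \<Lambda> div L. \<Sigma> b) = (\<Sum>b<card \<Lambda> div L. card (\<Sigma> b))"
    proof (rule card_UN_disjoint)
      show "\<forall>b\<in>{..<card \<Lambda> div L}. \<forall>c\<in>{..<card \<Lambda> div L}. b \<noteq> c \<longrightarrow> \<Sigma> b \<inter> \<Sigma> c = {}"
      proof (intro ballI impI)
        fix b c :: nat assume "b \<noteq> c"
        then consider "b < c" | "c < b" by linarith
        then show "\<Sigma> b \<inter> \<Sigma> c = {}" using noover by cases blast+
      qed
    qed (use f\<Sigma> in auto)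
    then show ?thesis by (simp add: sum_distrib_left)
  qed
  also have "\<dots> \<le> 4 * card ((A + A) \<times> (A + A))"
    by (intro mult_le_mono2 card_mono fAA) (use sub in blast)
  finally show ?thesis by (simp add: card_cartesian_product power2_eq_square)
qed

section \<open>Products of structured fibres\<close>

definition rq :: "real set \<Rightarrow> real \<Rightarrow> nat" where
  "rq A \<mu> = card {a\<in>A. \<mu> * a \<in> A}"

text \<open>The whole superlevel set instead of a dyadic layer, which makes it monotone in
  A.\<close>

definition Lam :: "real set \<Rightarrow> nat \<Rightarrow> real set" where
  "Lam A i = {\<mu>. 2 ^ i \<le> rq A \<mu>}"

lemma rq_le: "finite A \<Longrightarrow> rq A \<mu> \<le> card A"
  unfolding rq_def by (rule card_mono) auto

lemma rq_mono: "finite A \<Longrightarrow> B \<subseteq> A \<Longrightarrow> rq B \<mu> \<le> rq A \<mu>"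
  unfolding rq_def by (rule card_mono) auto

lemma Lam_mono: "finite A \<Longrightarrow> B \<subseteq> A \<Longrightarrow> Lam B i \<subseteq> Lam A i"
  unfolding Lam_def using rq_mono[of A B] by (auto intro: order_trans)

lemma rq_pos_imp:
  assumes "\<And>a. a \<in> A \<Longrightarrow> 0 < a" "0 < rq A \<mu>"
  shows "0 < \<mu>" and "\<exists>a\<in>A. \<mu> * a \<in> A"
proof -
  have "{a\<in>A. \<mu> * a \<in> A} \<noteq> {}" using assms(2) unfolding rq_def by (metis card.empty less_numeral_extra(3))
  then obtain a where a: "a \<in> A" "\<mu> * a \<in> A" by blast
  then show "\<exists>a\<in>A. \<mu> * a \<in> A" by blast
  show "0 < \<mu>" using assms(1)[OF a(1)] assms(1)[OF a(2)] by (simp add: zero_less_mult_iff)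
qed

lemma Lam_pos: "(\<And>a. a \<in> A \<Longrightarrow> 0 < a) \<Longrightarrow> \<mu> \<in> Lam A i \<Longrightarrow> 0 < \<mu>"
  unfolding Lam_def by (rule rq_pos_imp(1)[of A]) (auto intro: less_le_trans[of _ "2 ^ i"])

lemma finite_Lam:
  assumes "finite A" "\<And>a. a \<in> A \<Longrightarrow> 0 < a"
  shows "finite (Lam A i)"
proof (rule finite_subset)
  show "Lam A i \<subseteq> (\<lambda>(a, b). b / a) ` (A \<times> A)"
  proof
    fix \<mu> assume "\<mu> \<in> Lam A i"
    then have "0 < rq A \<mu>" unfolding Lam_def by (auto intro: less_le_trans[of _ "2 ^ i"])
    then obtain a where "a \<in> A" "\<mu> * a \<in> A" using rq_pos_imp(2)[OF assms(2)] by blast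
    then show "\<mu> \<in> (\<lambda>(a, b). b / a) ` (A \<times> A)"
      using assms(2)[of a] by (intro image_eqI[of _ _ "(a, \<mu> * a)"]) auto
  qed
qed (use assms in simp)

lemma sum_rq_le:
  assumes "finite A" "\<And>a. a \<in> A \<Longrightarrow> 0 < a" "finite X"
  shows "(\<Sum>\<mu>\<in>X. rq A \<mu>) \<le> (card A)\<^sup>2"
proof -
  have "(\<Sum>\<mu>\<in>X. rq A \<mu>) = card (SIGMA \<mu>:X. {a\<in>A. \<mu> * a \<in> A})"
    unfolding rq_def using assms by simp
  also have "\<dots> \<le> card (A \<times> A)"
  proof (rule card_inj_on_le[of "\<lambda>(\<mu>, a). (a, \<mu> * a)"])
    show "inj_on (\<lambda>(\<mu>, a). (a, \<mu> * a)) (SIGMA \<mu>:X. {a \<in> A. \<mu> * a \<in> A})"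
      using assms(2) by (fastforce simp: inj_on_def)
  qed (use assms in auto)
  finally show ?thesis by (simp add: card_cartesian_product power2_eq_square)
qed

lemma card_Lam_le:
  assumes "finite A" "\<And>a. a \<in> A \<Longrightarrow> 0 < a"
  shows "card (Lam A i) * 2 ^ i \<le> (card A)\<^sup>2"
proof -
  have "card (Lam A i) * 2 ^ i = (\<Sum>\<mu>\<in>Lam A i. 2 ^ i)" by simp
  also have "\<dots> \<le> (\<Sum>\<mu>\<in>Lam A i. rq A \<mu>)" by (rule sum_mono) (simp add: Lam_def)
  also have "\<dots> \<le> (card A)\<^sup>2" by (rule sum_rq_le[OF assms finite_Lam[OF assms]])
  finally show ?thesis .
qed

lemma sum_image_triple_count:
  assumes "finite (U i)" "finite (U j)" "finite (U k)"
  shows "(\<Sum>u\<in>U i. card {(v, z). v \<in> U j \<and> z \<in> U k \<and> (i - l) * u + (j - l) * v = (k - l) * z}) = triple_count U i j k l"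
proof -
  let ?W = "\<lambda>u. {(v, z). v \<in> U j \<and> z \<in> U k \<and> (i - l) * u + (j - l) * v = (k - l) * z}"
  have "finite (?W u)" for u by (rule finite_subset[of _ "U j \<times> U k"]) (use assms in auto)
  then have "(\<Sum>u\<in>U i. card (?W u)) = card (SIGMA u:U i. ?W u)" using assms by simp
  also have "(SIGMA u:U i. ?W u) = {(u, v, z). u \<in> U i \<and> v \<in> U j \<and> z \<in> U k \<and> (i - l) * u + (j - l) * v = (k - l) * z}"
    by auto
  finally show ?thesis unfolding triple_count_def .
qed

text \<open>
  If \<open>U i\<close> is additively structured, its products with \<open>A\<close> along a dense graph \<open>G\<close> are nearly
  distinct: the ratios \<open>\<mu>\<close> with \<open>rq A \<mu>\<close> small are handled trivially, the popular ones by the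
  Elekes--Ruzsa bound.
\<close>
lemma card_products_of_structured_set:
  fixes U :: "real \<Rightarrow> real set"
  assumes A: "finite A" "\<And>a. a \<in> A \<Longrightarrow> 0 < a"
    and U: "U i \<subseteq> {u\<in>A. i * u \<in> A}" "finite (U j)" "finite (U k)" "card (U i) = t" "card (U j) = t" "card (U k) = t"
    and ne: "l \<noteq> i" "l \<noteq> j" "l \<noteq> k" and i0: "0 < i"
    and deg: "\<And>u. u \<in> U i \<Longrightarrow> N \<le> 2 * real (card {b\<in>A. (i * u, b) \<in> G})" and N: "0 \<le> N"
    and e: "card A < 2 ^ e" "0 < e"
    and \<theta>: "0 \<le> \<theta>" and M: "\<And>j. j < e \<Longrightarrow> \<theta> < 2 ^ (j + 1) \<Longrightarrow> 2 ^ (j + 1) * sqrt (real (card (Lam A j))) \<le> M" "0 \<le> M"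
  shows "N\<^sup>2 * (real (triple_count U i j k l))\<^sup>2
    \<le> 4 * real (card {i * u * b | u b. u \<in> U i \<and> b \<in> A \<and> (i * u, b) \<in> G})
      * (\<theta> * (real (triple_count U i j k l))\<^sup>2 + 64 * (real e)\<^sup>2 * M * real t ^ 3)"
proof -
  define w where "w u = card {(v, z). v \<in> U j \<and> z \<in> U k \<and> (i - l) * u + (j - l) * v = (k - l) * z}" for u
  define T where "T = real (triple_count U i j k l)"
  define Y where "Y = {i * u * b | u b. u \<in> U i \<and> b \<in> A \<and> (i * u, b) \<in> G}"
  have UA: "U i \<subseteq> A" using U(1) by auto
  have fU: "finite (U i)" using finite_subset[OF UA A(1)] .
  have pU: "0 < u" if "u \<in> U i" for u using UA A(2) that by blast
  have tA: "t < 2 ^ e" using card_mono[OF A(1) UA] U(4) e by simp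
  have wT: "(\<Sum>u\<in>U i. real (w u)) = T"
    unfolding T_def w_def sum_image_triple_count[OF fU U(2,3), symmetric] by simp
  define W where "W = (SIGMA u:U i. {b\<in>A. (i * u, b) \<in> G})"
  have fW: "finite W" unfolding W_def using fU A by simp
  define h where "h = (\<lambda>(u, b). i * u * b)"
  have hY: "h ` W = Y" unfolding h_def W_def Y_def by force
  have "N * T = (\<Sum>u\<in>U i. N * real (w u))" unfolding wT[symmetric] sum_distrib_left ..
  also have "\<dots> \<le> (\<Sum>u\<in>U i. 2 * real (card {b\<in>A. (i * u, b) \<in> G}) * real (w u))"
    by (intro sum_mono mult_right_mono deg) auto
  also have "\<dots> = 2 * (\<Sum>u\<in>U i. \<Sum>b\<in>{b\<in>A. (i * u, b) \<in> G}. real (w u))"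
    by (simp add: sum_distrib_left mult_ac)
  also have "(\<Sum>u\<in>U i. \<Sum>b\<in>{b\<in>A. (i * u, b) \<in> G}. real (w u)) = (\<Sum>p\<in>W. real (w (fst p)))"
    unfolding W_def by (subst sum.Sigma) (use fU A in \<open>auto simp: split_def\<close>)
  finally have "(N * T)\<^sup>2 \<le> (2 * (\<Sum>p\<in>W. real (w (fst p))))\<^sup>2"
    by (rule power_mono) (use N in \<open>simp add: T_def\<close>)
  then have 1: "N\<^sup>2 * T\<^sup>2 \<le> 4 * (\<Sum>p\<in>W. real (w (fst p)))\<^sup>2" by (simp add: power_mult_distrib)
  define Q where "Q = {(p, p'). p \<in> W \<and> p' \<in> W \<and> h p = h p'}"
  have fQ: "finite Q" by (rule finite_subset[of _ "W \<times> W"]) (use fW in \<open>auto simp: Q_def\<close>)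
  have 2: "(\<Sum>p\<in>W. real (w (fst p)))\<^sup>2 \<le> real (card Y) * (\<Sum>(p, p')\<in>Q. real (w (fst p)) * real (w (fst p')))"
    using weighted_image_Cauchy_Schwarz[OF fW, of "\<lambda>p. real (w (fst p))" h] unfolding hY Q_def .
  define R where "R = (\<lambda>(u, u'). u' / u) ` (U i \<times> U i)"
  define c where "c \<mu> = (\<Sum>u\<in>{u\<in>U i. \<mu> * u \<in> U i}. real (w u) * real (w (\<mu> * u)))" for \<mu>
  have fR: "finite R" unfolding R_def using fU by simp
  have cR: "card R \<le> t\<^sup>2"
    unfolding R_def using card_image_le[of "U i \<times> U i" "\<lambda>(u, u'). u' / u"] fU U(4)
    by (simp add: card_cartesian_product power2_eq_square)
  have R0: "0 < \<mu>" if "\<mu> \<in> R" for \<mu> using that pU unfolding R_def by auto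
  have c0: "0 \<le> c \<mu>" for \<mu> unfolding c_def by (intro sum_nonneg) auto
  define S where "S = (SIGMA \<mu>:R. {u\<in>U i. \<mu> * u \<in> U i} \<times> {b\<in>A. \<mu> * b \<in> A})"
  \<comment> \<open>A collision u b = u' b' has a single ratio \<mu> = u' / u = b / b'. For given
    \<mu>, u the pair is fixed by b', for which there are at most \<open>rq A \<mu>\<close> choices,
    while the weights depend on u and \<mu> u only.\<close>
  have 3: "(\<Sum>(p, p')\<in>Q. real (w (fst p)) * real (w (fst p'))) \<le> (\<Sum>(\<mu>, u, b)\<in>S. real (w u) * real (w (\<mu> * u)))"
  proof (rule sum_le_included[where i = "\<lambda>(\<mu>, u, b). ((u, \<mu> * b), (\<mu> * u, b))"])
    show "\<forall>x\<in>Q. \<exists>y\<in>S. (\<lambda>(\<mu>, u, b). ((u, \<mu> * b), (\<mu> * u, b))) y = x \<and>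
        (case x of (p, p') \<Rightarrow> real (w (fst p)) * real (w (fst p'))) \<le> (case y of (\<mu>, u, b) \<Rightarrow> real (w u) * real (w (\<mu> * u)))"
    proof
      fix x assume x: "x \<in> Q"
      obtain u b u' b' where xx: "x = ((u, b), (u', b'))" by (metis prod.collapse)
      have *: "u \<in> U i" "b \<in> A" "u' \<in> U i" "b' \<in> A" "i * u * b = i * u' * b'"
        using x unfolding xx Q_def W_def h_def by auto
      have up: "0 < u" using pU * by blast
      have "u * b = u' * b'" using *(5) i0 by simp
      then have b: "(u' / u) * b' = b" using up by (simp add: field_simps)
      have uu: "(u' / u) * u = u'" using up by simp
      have "(u' / u, u, b') \<in> S"
        unfolding S_def mem_Sigma_iff mem_Collect_eq b uu R_def using * by auto
      then show "\<exists>y\<in>S. (\<lambda>(\<mu>, u, b). ((u, \<mu> * b), (\<mu> * u, b))) y = x \<and>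
          (case x of (p, p') \<Rightarrow> real (w (fst p)) * real (w (fst p'))) \<le> (case y of (\<mu>, u, b) \<Rightarrow> real (w u) * real (w (\<mu> * u)))"
        by (rule bexI[rotated]) (simp only: xx split_conv fst_conv b uu, simp)
    qed
  qed (use fQ fR fU A in \<open>auto simp: S_def\<close>)
  have 4: "(\<Sum>(\<mu>, u, b)\<in>S. real (w u) * real (w (\<mu> * u))) = (\<Sum>\<mu>\<in>R. real (rq A \<mu>) * c \<mu>)"
  proof -
    have "(\<Sum>(\<mu>, u, b)\<in>S. real (w u) * real (w (\<mu> * u)))
        = (\<Sum>\<mu>\<in>R. \<Sum>(u, b)\<in>{u\<in>U i. \<mu> * u \<in> U i} \<times> {b\<in>A. \<mu> * b \<in> A}. real (w u) * real (w (\<mu> * u)))"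
      unfolding S_def using fR fU A by (subst sum.Sigma) (auto simp: split_def)
    also have "\<dots> = (\<Sum>\<mu>\<in>R. real (rq A \<mu>) * c \<mu>)"
      unfolding sum.cartesian_product[symmetric] c_def rq_def by (simp add: sum_distrib_left)
    finally show ?thesis .
  qed
  have ctot: "(\<Sum>\<mu>\<in>R. c \<mu>) \<le> T\<^sup>2"
  proof -
    have "(\<Sum>\<mu>\<in>R. c \<mu>) = (\<Sum>(\<mu>, u)\<in>(SIGMA \<mu>:R. {u\<in>U i. \<mu> * u \<in> U i}). real (w u) * real (w (\<mu> * u)))"
      unfolding c_def using fR fU by (simp add: sum.Sigma)
    also have "\<dots> \<le> (\<Sum>(u, u')\<in>U i \<times> U i. real (w u) * real (w u'))"
    proof (rule sum_le_included[where i = "\<lambda>(u, u'). (u' / u, u)"])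
      show "\<forall>x\<in>SIGMA \<mu>:R. {u \<in> U i. \<mu> * u \<in> U i}. \<exists>y\<in>U i \<times> U i. (\<lambda>(u, u'). (u' / u, u)) y = x \<and>
        (case x of (\<mu>, u) \<Rightarrow> real (w u) * real (w (\<mu> * u))) \<le> (case y of (u, u') \<Rightarrow> real (w u) * real (w u'))"
      proof
        fix x assume x: "x \<in> (SIGMA \<mu>:R. {u \<in> U i. \<mu> * u \<in> U i})"
        obtain \<mu> u where xx: "x = (\<mu>, u)" by (cases x)
        have *: "u \<in> U i" "\<mu> * u \<in> U i" using x unfolding xx by auto
        have "u \<noteq> 0" using pU[OF *(1)] by simp
        then show "\<exists>y\<in>U i \<times> U i. (\<lambda>(u, u'). (u' / u, u)) y = x \<and>
          (case x of (\<mu>, u) \<Rightarrow> real (w u) * real (w (\<mu> * u))) \<le> (case y of (u, u') \<Rightarrow> real (w u) * real (w u'))"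
          unfolding xx using * by (intro bexI[of _ "(u, \<mu> * u)"]) auto
      qed
    qed (use fR fU in auto)
    also have "\<dots> = T\<^sup>2" unfolding wT[symmetric] power2_eq_square sum_product sum.cartesian_product ..
    finally show ?thesis .
  qed
  have lvl: "(\<Sum>\<mu>\<in>{\<mu>\<in>R. 2 ^ m \<le> rq A \<mu> \<and> rq A \<mu> < 2 ^ (m + 1) \<and> \<theta> \<le> real (rq A \<mu>)}. real (rq A \<mu>) * c \<mu>) \<le> 64 * real e * M * real t ^ 3"
    if m: "m < e" for m
  proof -
    define D where "D = {\<mu>\<in>R. 2 ^ m \<le> rq A \<mu> \<and> rq A \<mu> < 2 ^ (m + 1) \<and> \<theta> \<le> real (rq A \<mu>)}"
    have DR: "D \<subseteq> R" unfolding D_def by blast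
    have fD: "finite D" by (rule finite_subset[OF DR fR])
    have up: "real (rq A \<mu>) < 2 ^ (m + 1)" if "\<mu> \<in> D" for \<mu>
    proof -
      have "real (rq A \<mu>) < real (2 ^ (m + 1))" using that unfolding D_def by (simp only: of_nat_less_iff) simp
      then show ?thesis by simp
    qed
    \<comment> \<open>A nonempty layer satisfies \<theta> < 2^(m + 1), which is the range in which M
      bounds the level; an empty one contributes nothing.\<close>
    show ?thesis
    proof (cases "D = {}")
      case True
      then show ?thesis unfolding D_def[symmetric] using M by simp
    next
      case False
      then obtain \<mu>0 where "\<mu>0 \<in> D" by blast
      then have "\<theta> < 2 ^ (m + 1)" using up[of \<mu>0] unfolding D_def by auto
      then have Mm: "2 ^ (m + 1) * sqrt (real (card (Lam A m))) \<le> M" by (rule M(1)[OF m])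
      have "(\<Sum>\<mu>\<in>D. real (rq A \<mu>) * c \<mu>) \<le> (\<Sum>\<mu>\<in>D. 2 ^ (m + 1) * c \<mu>)"
        by (intro sum_mono mult_right_mono c0) (use up in \<open>auto intro: less_imp_le\<close>)
      also have "\<dots> = 2 ^ (m + 1) * (\<Sum>\<mu>\<in>D. c \<mu>)" by (simp add: sum_distrib_left)
      also have "\<dots> \<le> 2 ^ (m + 1) * (64 * real e * sqrt (real (card D)) * real t ^ 3)"
      proof (rule mult_left_mono)
        show "(\<Sum>\<mu>\<in>D. c \<mu>) \<le> 64 * real e * sqrt (real (card D)) * real t ^ 3"
          unfolding c_def w_def
          by (rule sum_dilation_correlation_le)
            (use fU U fD R0 DR ne tA e order_trans[OF card_mono[OF fR DR] cR] in auto)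
      qed simp
      also have "\<dots> \<le> 2 ^ (m + 1) * (64 * real e * sqrt (real (card (Lam A m))) * real t ^ 3)"
        by (intro mult_left_mono mult_right_mono real_sqrt_le_mono of_nat_mono card_mono finite_Lam A)
          (auto simp: D_def Lam_def)
      also have "\<dots> = (2 ^ (m + 1) * sqrt (real (card (Lam A m)))) * (64 * real e * real t ^ 3)" by simp
      also have "\<dots> \<le> M * (64 * real e * real t ^ 3)" by (rule mult_right_mono[OF Mm]) simp
      finally show ?thesis unfolding D_def[symmetric] by (simp add: mult_ac)
    qed
  qed
  define R1 where "R1 = {\<mu>\<in>R. \<theta> \<le> real (rq A \<mu>) \<and> 1 \<le> rq A \<mu>}"
  have fR1: "finite R1" unfolding R1_def using fR by simp
  have "(\<Sum>\<mu>\<in>R. real (rq A \<mu>) * c \<mu>) \<le> (\<Sum>\<mu>\<in>R. \<theta> * c \<mu> + (if \<mu> \<in> R1 then real (rq A \<mu>) * c \<mu> else 0))"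
  proof (rule sum_mono)
    fix \<mu> assume "\<mu> \<in> R"
    show "real (rq A \<mu>) * c \<mu> \<le> \<theta> * c \<mu> + (if \<mu> \<in> R1 then real (rq A \<mu>) * c \<mu> else 0)"
    proof (cases "\<mu> \<in> R1")
      case True
      then show ?thesis using c0[of \<mu>] \<theta> by simp
    next
      case False
      then have "real (rq A \<mu>) \<le> \<theta>" using \<open>\<mu> \<in> R\<close> \<theta> unfolding R1_def by (cases "rq A \<mu> = 0") auto
      then have "real (rq A \<mu>) * c \<mu> \<le> \<theta> * c \<mu>" by (rule mult_right_mono[OF _ c0])
      then show ?thesis using False by simp
    qed
  qed
  also have "\<dots> = \<theta> * (\<Sum>\<mu>\<in>R. c \<mu>) + (\<Sum>\<mu>\<in>R1. real (rq A \<mu>) * c \<mu>)"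
  proof -
    have "R \<inter> R1 = R1" unfolding R1_def by auto
    then show ?thesis using fR by (simp add: sum.distrib sum_distrib_left sum.If_cases Int_def[symmetric] flip: sum.inter_restrict)
  qed
  also have "\<dots> \<le> \<theta> * T\<^sup>2 + real e * (64 * real e * M * real t ^ 3)"
  proof (rule add_mono)
    show "\<theta> * (\<Sum>\<mu>\<in>R. c \<mu>) \<le> \<theta> * T\<^sup>2" by (rule mult_left_mono[OF ctot \<theta>])
    have "rq A \<mu> < 2 ^ e" for \<mu> using rq_le[OF A(1), of \<mu>] e by simp
    then obtain m where m: "m < e" "(\<Sum>\<mu>\<in>R1. real (rq A \<mu>) * c \<mu>)
        \<le> real e * (\<Sum>\<mu>\<in>{\<mu>\<in>R1. 2 ^ m \<le> rq A \<mu> \<and> rq A \<mu> < 2 ^ (m + 1)}. real (rq A \<mu>) * c \<mu>)"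
      using dyadic_pigeonhole[OF fR1, of "rq A" e "\<lambda>\<mu>. real (rq A \<mu>) * c \<mu>"] c0 e unfolding R1_def by auto
    have "{\<mu>\<in>R1. 2 ^ m \<le> rq A \<mu> \<and> rq A \<mu> < 2 ^ (m + 1)}
        \<subseteq> {\<mu>\<in>R. 2 ^ m \<le> rq A \<mu> \<and> rq A \<mu> < 2 ^ (m + 1) \<and> \<theta> \<le> real (rq A \<mu>)}" unfolding R1_def by blast
    then have "(\<Sum>\<mu>\<in>{\<mu>\<in>R1. 2 ^ m \<le> rq A \<mu> \<and> rq A \<mu> < 2 ^ (m + 1)}. real (rq A \<mu>) * c \<mu>) \<le> 64 * real e * M * real t ^ 3"
      by (rule order_trans[OF sum_mono2 lvl[OF m(1)], rotated]) (use fR c0 in auto)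
    then show "(\<Sum>\<mu>\<in>R1. real (rq A \<mu>) * c \<mu>) \<le> real e * (64 * real e * M * real t ^ 3)"
      by (rule order_trans[OF m(2) mult_left_mono]) simp
  qed
  finally have 5: "(\<Sum>\<mu>\<in>R. real (rq A \<mu>) * c \<mu>) \<le> \<theta> * T\<^sup>2 + 64 * (real e)\<^sup>2 * M * real t ^ 3"
    by (simp add: power2_eq_square mult_ac)
  have "(\<Sum>p\<in>W. real (w (fst p)))\<^sup>2 \<le> real (card Y) * (\<theta> * T\<^sup>2 + 64 * (real e)\<^sup>2 * M * real t ^ 3)"
    by (rule order_trans[OF 2 mult_left_mono]) (use 3 4 5 in auto)
  then show ?thesis using 1 unfolding T_def Y_def by simp
qed

text \<open>If all triple counts were small, the block argument would make the sumset larger than K.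
  So some count T exceeds 2 t^2 / L^2, and \<open>M\<theta>\<close> is the condition under which the
  popular ratios, 64 e^2 M t^3, are absorbed by \<theta> T^2. The fibre of that slope then has at
  least N^2 / (8 \<theta>) products.\<close>

lemma exists_slope_with_many_products:
  fixes A A1 \<Lambda> :: "real set"
  assumes A: "finite A" "\<And>a. a \<in> A \<Longrightarrow> 0 < a" and A1: "A1 \<subseteq> A"
    and \<Lambda>: "\<Lambda> \<subseteq> Lam A1 i"
    and deg: "\<And>a. a \<in> A1 \<Longrightarrow> real (card A) \<le> 2 * real (card {b\<in>A. (a, b) \<in> G})"
    and e: "card A < 2 ^ e" "0 < e" and K: "real (card (A + A)) \<le> K"
    and L: "2 \<le> L" and blocks: "4 * K\<^sup>2 < real (card \<Lambda> div L) * (real (L * (L - 1)) * (2 ^ i)\<^sup>2)"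
    and \<theta>: "0 \<le> \<theta>" and M: "\<And>j. j < e \<Longrightarrow> \<theta> < 2 ^ (j + 1) \<Longrightarrow> 2 ^ (j + 1) * sqrt (real (card (Lam A j))) \<le> M" "0 \<le> M"
    and M\<theta>: "16 * (real e)\<^sup>2 * M * real L ^ 4 \<le> \<theta> * 2 ^ i"
  shows "\<exists>\<nu>\<in>\<Lambda>. (real (card A))\<^sup>2 \<le> 8 * \<theta> * real (card {y\<in>A * A. y / \<nu> \<in> A * A \<and> (\<exists>(a, b)\<in>G. y = a * b)})"
proof -
  define t :: nat where "t = 2 ^ i"
  have fA1: "finite A1" using A1 A(1) finite_subset by blast
  have pA1: "\<And>a. a \<in> A1 \<Longrightarrow> 0 < a" using A1 A(2) by blast
  have f\<Lambda>: "finite \<Lambda>" using \<Lambda> finite_Lam[OF fA1 pA1] finite_subset by blast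
  have p\<Lambda>: "0 < \<nu>" if "\<nu> \<in> \<Lambda>" for \<nu> using Lam_pos[OF pA1] \<Lambda> that by blast
  \<comment> \<open>Fibres are cut down to exactly t elements, so that all grids in a block have the
    same size.\<close>
  have "\<forall>\<nu>\<in>\<Lambda>. \<exists>X. X \<subseteq> {u\<in>A1. \<nu> * u \<in> A1} \<and> card X = t"
  proof
    fix \<nu> assume "\<nu> \<in> \<Lambda>"
    then have "t \<le> card {u\<in>A1. \<nu> * u \<in> A1}" using \<Lambda> unfolding Lam_def rq_def t_def by blast
    then show "\<exists>X. X \<subseteq> {u\<in>A1. \<nu> * u \<in> A1} \<and> card X = t" using obtain_subset_with_card_n by metis
  qed
  from bchoice[OF this] obtain U
    where "\<forall>\<nu>\<in>\<Lambda>. U \<nu> \<subseteq> {u\<in>A1. \<nu> * u \<in> A1} \<and> card (U \<nu>) = t" by blast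
  then have U: "U \<nu> \<subseteq> {u\<in>A1. \<nu> * u \<in> A1} \<and> card (U \<nu>) = t" if "\<nu> \<in> \<Lambda>" for \<nu> using that by blast
  have UA: "U \<nu> \<subseteq> {u\<in>A. \<nu> * u \<in> A} \<and> card (U \<nu>) = t" if "\<nu> \<in> \<Lambda>" for \<nu> using U[OF that] A1 by blast
  have fU: "finite (U \<nu>)" if "\<nu> \<in> \<Lambda>" for \<nu>
    by (rule finite_subset[OF _ fA1]) (use U[OF that] in blast)
  have "\<exists>i\<in>\<Lambda>. \<exists>j\<in>\<Lambda>. \<exists>k\<in>\<Lambda>. \<exists>l\<in>\<Lambda>. i \<noteq> j \<and> l \<noteq> i \<and> l \<noteq> j \<and> l \<noteq> k \<and> 2 * t\<^sup>2 < triple_count U i j k l * (L * (L - 1))"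
  proof (rule ccontr)
    assume no: "\<not> ?thesis"
    have "card \<Lambda> div L * (L * (L - 1) * t\<^sup>2) \<le> 4 * (card (A + A))\<^sup>2"
      by (rule sumset_lower_bound_by_blocks[OF A f\<Lambda> UA L]) (use no not_le in blast)+
    then have "real (card \<Lambda> div L * (L * (L - 1) * t\<^sup>2)) \<le> real (4 * (card (A + A))\<^sup>2)" by (rule of_nat_mono)
    also have "\<dots> \<le> 4 * K\<^sup>2" using K by (simp add: power_mono)
    finally show False using blocks unfolding t_def of_nat_mult of_nat_power of_nat_numeral by linarith
  qed
  then obtain \<nu> j k l where *: "\<nu> \<in> \<Lambda>" "j \<in> \<Lambda>" "k \<in> \<Lambda>" "l \<in> \<Lambda>" "l \<noteq> \<nu>" "l \<noteq> j" "l \<noteq> k"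
    and big: "2 * t\<^sup>2 < triple_count U \<nu> j k l * (L * (L - 1))" by blast
  define T where "T = real (triple_count U \<nu> j k l)"
  define Y where "Y = {\<nu> * u * b | u b. u \<in> U \<nu> \<and> b \<in> A \<and> (\<nu> * u, b) \<in> G}"
  define Z where "Z = {y\<in>A * A. y / \<nu> \<in> A * A \<and> (\<exists>(a, b)\<in>G. y = a * b)}"
  have N0: "0 \<le> real (card A)" by simp
  have main: "(real (card A))\<^sup>2 * T\<^sup>2 \<le> 4 * real (card Y) * (\<theta> * T\<^sup>2 + 64 * (real e)\<^sup>2 * M * real t ^ 3)"
    unfolding T_def Y_def
  proof (rule card_products_of_structured_set[OF A _ _ _ _ _ _ *(5-7) _ _ N0 e \<theta> M])
    show "U \<nu> \<subseteq> {u\<in>A. \<nu> * u \<in> A}" "card (U \<nu>) = t" "card (U j) = t" "card (U k) = t" "finite (U j)" "finite (U k)" "0 < \<nu>"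
      using UA fU p\<Lambda> * by auto
    fix u assume "u \<in> U \<nu>"
    then have "\<nu> * u \<in> A1" using U[OF *(1)] by blast
    then show "real (card A) \<le> 2 * real (card {b\<in>A. (\<nu> * u, b) \<in> G})" by (rule deg)
  qed
  have t0: "0 < real t" "real t = 2 ^ i" unfolding t_def by simp_all
  have TL: "2 * (real t)\<^sup>2 \<le> T * (real L)\<^sup>2"
  proof -
    have "real (2 * t\<^sup>2) \<le> real (triple_count U \<nu> j k l * (L * (L - 1)))"
      using big by (simp only: of_nat_le_iff less_imp_le)
    also have "\<dots> \<le> T * (real L)\<^sup>2"
      unfolding T_def of_nat_mult power2_eq_square by (intro mult_left_mono of_nat_mono) auto
    finally show ?thesis by simp
  qed
  have T0: "0 < T"
  proof (rule ccontr)
    assume "\<not> 0 < T"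
    then have "T = 0" unfolding T_def by simp
    then show False using TL t0 by simp
  qed
  have "64 * (real e)\<^sup>2 * M * real t ^ 3 \<le> \<theta> * T\<^sup>2"
  proof -
    have "(2 * (real t)\<^sup>2)\<^sup>2 \<le> (T * (real L)\<^sup>2)\<^sup>2" by (rule power_mono[OF TL]) simp
    then have a: "4 * real t ^ 4 \<le> T\<^sup>2 * real L ^ 4" by (simp add: eval_nat_numeral mult_ac)
    have "(16 * (real e)\<^sup>2 * M * real L ^ 4) * (4 * real t ^ 4) \<le> (\<theta> * real t) * (T\<^sup>2 * real L ^ 4)"
      by (rule mult_mono[OF M\<theta>[folded t0(2)] a]) (use \<theta> in auto)
    then have "(real t * real L ^ 4) * (64 * (real e)\<^sup>2 * M * real t ^ 3) \<le> (real t * real L ^ 4) * (\<theta> * T\<^sup>2)"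
      by (simp add: eval_nat_numeral mult_ac)
    then show ?thesis by (rule mult_left_le_imp_le) (use t0 L in simp)
  qed
  then have "4 * real (card Y) * (\<theta> * T\<^sup>2 + 64 * (real e)\<^sup>2 * M * real t ^ 3) \<le> 4 * real (card Y) * (\<theta> * T\<^sup>2 + \<theta> * T\<^sup>2)"
    by (intro mult_left_mono add_left_mono) auto
  then have "T\<^sup>2 * (real (card A))\<^sup>2 \<le> T\<^sup>2 * (8 * \<theta> * real (card Y))" using main by (simp add: mult_ac)
  then have YN: "(real (card A))\<^sup>2 \<le> 8 * \<theta> * real (card Y)" by (rule mult_left_le_imp_le) (use T0 in simp)
  \<comment> \<open>The Katz--Koester inclusion: both u and \<nu> u lie in A, so u b and \<nu> u b
    are both products.\<close>
  have YZ: "Y \<subseteq> Z"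
  proof
    fix y assume "y \<in> Y"
    then obtain u b where ub: "u \<in> U \<nu>" "b \<in> A" "(\<nu> * u, b) \<in> G" "y = \<nu> * u * b" unfolding Y_def by blast
    have uA: "u \<in> A" "\<nu> * u \<in> A" using UA[OF *(1)] ub by auto
    have "y / \<nu> = u * b" using p\<Lambda>[OF *(1)] ub(4) by simp
    then have "y / \<nu> \<in> A * A" using uA ub by (auto intro: set_times_intro)
    moreover have "y \<in> A * A" using uA ub by (auto intro: set_times_intro)
    ultimately show "y \<in> Z" unfolding Z_def using ub by blast
  qed
  have "finite Z" unfolding Z_def using A by (simp add: finite_set_times)
  then have "real (card Y) \<le> real (card Z)" by (intro of_nat_mono card_mono YZ)
  then have "8 * \<theta> * real (card Y) \<le> 8 * \<theta> * real (card Z)" by (rule mult_left_mono) (use \<theta> in simp)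
  then have "(real (card A))\<^sup>2 \<le> 8 * \<theta> * real (card Z)" using YN by linarith
  then show ?thesis using *(1) unfolding Z_def by blast
qed

section \<open>Pairs whose product has many factorizations\<close>

text \<open>Counts factorizations of y into a slope and a product. For y = a b, division by b makes
  them factorizations of a, as needed to prove a set controlled.\<close>

definition popularity :: "real set \<Rightarrow> nat \<Rightarrow> real \<Rightarrow> nat" where
  "popularity A i y = card {\<nu>\<in>Lam A i. y / \<nu> \<in> A * A}"

text \<open>
  With the exponent \<open>2 * q\<close>, the final control constant is a multiple of a power of \<open>2 ^ i\<close> whose exponent has
  the sign of \<open>2 * q\<^sup>2 + 24 * q - 27\<close>. The value \<open>q = 51 / 50\<close> keeps this negative, which makes the smallest
  admissible level the worst case, while \<open>q > 1\<close> is what improves on the plain multiplicative energy.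
\<close>
definition weight :: "real set \<Rightarrow> nat \<Rightarrow> real" where
  "weight A i = real (card (Lam A i)) * (2 ^ i) powr (51 / 25)"

text \<open>
  The role of \<open>\<T>\<close> is to collect, ahead of the choice of \<open>A1\<close>, every level that can dominate for a large
  subset \<open>A1\<close>. If the pairs with unpopular product formed a dense graph, then \<open>A1\<close> could be taken to be the
  vertices of large degree, and the previous lemma would provide too many unpopular products.
\<close>

lemma many_pairs_with_popular_product:
  fixes A :: "real set"
  assumes A: "finite A" "A \<noteq> {}" "\<And>a. a \<in> A \<Longrightarrow> 0 < a"
    and e: "card A < 2 ^ e" "0 < e" and K: "real (card (A + A)) \<le> K" "real (card (A * A)) \<le> K" and H: "1 \<le> H"
    and reg: "\<And>A1. A1 \<subseteq> A \<Longrightarrow> card A \<le> 2 * card A1 \<Longrightarrow> \<exists>i\<in>\<T>. real (card (Lam A i)) \<le> H * real (card (Lam A1 i))"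
    and lev: "\<And>i. i \<in> \<T> \<Longrightarrow> 0 < card (Lam A i)"
    and L: "\<And>i. i \<in> \<T> \<Longrightarrow> 2 \<le> L i"
    and blocks: "\<And>i x. i \<in> \<T> \<Longrightarrow> real (card (Lam A i)) \<le> 2 * H * real x
        \<Longrightarrow> 4 * K\<^sup>2 < real (x div L i) * (real (L i * (L i - 1)) * (2 ^ i)\<^sup>2)"
    and \<theta>: "\<And>i. i \<in> \<T> \<Longrightarrow> 0 < \<theta> i"
    and M: "\<And>i j. i \<in> \<T> \<Longrightarrow> j < e \<Longrightarrow> \<theta> i < 2 ^ (j + 1) \<Longrightarrow> 2 ^ (j + 1) * sqrt (real (card (Lam A j))) \<le> M i" "\<And>i. i \<in> \<T> \<Longrightarrow> 0 \<le> M i"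
    and M\<theta>: "\<And>i. i \<in> \<T> \<Longrightarrow> 16 * (real e)\<^sup>2 * M i * real (L i) ^ 4 \<le> \<theta> i * 2 ^ i"
  defines "s \<equiv> \<lambda>i. real (card (Lam A i)) * (real (card A))\<^sup>2 / (16 * H * K * \<theta> i)"
  shows "(card A)\<^sup>2 \<le> 4 * card {p\<in>A \<times> A. \<exists>i\<in>\<T>. s i \<le> real (popularity A i (fst p * snd p))}"
proof (rule ccontr)
  assume "\<not> ?thesis"
  then have few: "4 * card {p\<in>A \<times> A. \<exists>i\<in>\<T>. s i \<le> real (popularity A i (fst p * snd p))} < (card A)\<^sup>2" by simp
  define G where "G = {p\<in>A \<times> A. \<forall>i\<in>\<T>. real (popularity A i (fst p * snd p)) < s i}"
  define N where "N = card A"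
  have fG: "finite G" by (rule finite_subset[of _ "A \<times> A"]) (use A in \<open>auto simp: G_def\<close>)
  have N0: "0 < N" unfolding N_def using A by (simp add: card_gt_0_iff)
  have "A \<times> A - G = {p\<in>A \<times> A. \<exists>i\<in>\<T>. s i \<le> real (popularity A i (fst p * snd p))}"
    unfolding G_def by (auto simp: not_less)
  then have "4 * card (A \<times> A - G) < N\<^sup>2" using few unfolding N_def by simp
  moreover have "card (A \<times> A - G) = card (A \<times> A) - card G"
    by (rule card_Diff_subset[OF fG]) (auto simp: G_def)
  moreover have "card (A \<times> A) = N\<^sup>2" unfolding N_def by (simp add: card_cartesian_product power2_eq_square)
  ultimately have G: "3 * N\<^sup>2 < 4 * card G" by linarith
  define d where "d a = card {b\<in>A. (a, b) \<in> G}" for a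
  have dN: "d a \<le> N" for a unfolding d_def N_def using A by (intro card_mono) auto
  have "G = (SIGMA a:A. {b\<in>A. (a, b) \<in> G})" unfolding G_def by auto
  then have "card G = card (SIGMA a:A. {b\<in>A. (a, b) \<in> G})" by simp
  also have "\<dots> = (\<Sum>a\<in>A. d a)" unfolding d_def using A by simp
  finally have dG: "card G = (\<Sum>a\<in>A. d a)" .
  define A1 where "A1 = {a\<in>A. N \<le> 2 * d a}"
  have A1A: "A1 \<subseteq> A" unfolding A1_def by blast
  have fA1: "finite A1" using A1A A finite_subset by blast
  have pA1: "\<And>a. a \<in> A1 \<Longrightarrow> 0 < a" using A1A A by blast
  \<comment> \<open>A vertex outside \<open>A1\<close> has degree below N / 2 and no degree exceeds
    N; more than 3 N^2 / 4 edges therefore put at least half of A into \<open>A1\<close>.\<close>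
  have "2 * (\<Sum>a\<in>A. d a) \<le> (\<Sum>a\<in>A. N + (if a \<in> A1 then N else 0))"
    unfolding sum_distrib_left
  proof (rule sum_mono)
    fix a assume "a \<in> A"
    then show "2 * d a \<le> N + (if a \<in> A1 then N else 0)"
      using dN[of a] unfolding A1_def by auto
  qed
  also have "\<dots> = N * N + card A1 * N"
    using A A1A by (simp add: sum.distrib N_def sum.If_cases Int_absorb1)
  finally have "2 * (2 * (\<Sum>a\<in>A. d a)) \<le> 2 * (N * N + card A1 * N)" by (rule mult_le_mono2)
  moreover have "3 * N\<^sup>2 < 2 * (2 * (\<Sum>a\<in>A. d a))" using G unfolding dG by simp
  ultimately have "3 * N\<^sup>2 < 2 * (N * N + card A1 * N)" by (rule less_le_trans[rotated])
  then have "N * N \<le> (2 * card A1) * N" by (simp add: power2_eq_square)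
  then have half: "card A \<le> 2 * card A1" unfolding N_def[symmetric] using N0 by simp
  obtain i where i: "i \<in> \<T>" "real (card (Lam A i)) \<le> H * real (card (Lam A1 i))" using reg[OF A1A half] by blast
  define n where "n = real (card (Lam A i))"
  have n0: "0 < n" unfolding n_def using lev[OF i(1)] by simp
  have fL: "finite (Lam A1 i)" by (rule finite_Lam[OF fA1 pA1])
  have K0: "0 < K"
  proof -
    obtain a where "a \<in> A" using A by blast
    then have "a + a \<in> A + A" by (intro set_plus_intro)
    moreover have "finite (A + A)" using A by (simp add: finite_set_plus)
    ultimately have "0 < card (A + A)" by (auto simp: card_gt_0_iff)
    then show ?thesis using K(1) by linarith
  qed
  define Z where "Z \<nu> = {y\<in>A * A. y / \<nu> \<in> A * A \<and> (\<exists>(a, b)\<in>G. y = a * b)}" for \<nu>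
  define Good where "Good = {\<nu>\<in>Lam A1 i. (real N)\<^sup>2 \<le> 8 * \<theta> i * real (card (Z \<nu>))}"
  have fGood: "finite Good" unfolding Good_def using fL by simp
  have GoodL: "Good \<subseteq> Lam A i" unfolding Good_def using Lam_mono[OF A(1) A1A] by blast
  \<comment> \<open>Otherwise the slopes that are not good still number at least n / (2 H), which
    suffices for the block argument, and that argument produces a good slope among them.\<close>
  have good_half: "n \<le> 2 * H * real (card Good)"
  proof (rule ccontr)
    assume a: "\<not> ?thesis"
    define B where "B = Lam A1 i - Good"
    have "card B = card (Lam A1 i) - card Good"
      unfolding B_def by (rule card_Diff_subset[OF fGood]) (auto simp: Good_def)
    moreover have "card Good \<le> card (Lam A1 i)" by (rule card_mono[OF fL]) (auto simp: Good_def)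
    ultimately have "real (card (Lam A1 i)) = real (card B) + real (card Good)" by simp
    then have "n \<le> H * real (card B) + H * real (card Good)" using i(2) unfolding n_def by (simp add: distrib_left)
    then have "n \<le> 2 * H * real (card B)" using a by linarith
    then have bl: "4 * K\<^sup>2 < real (card B div L i) * (real (L i * (L i - 1)) * (2 ^ i)\<^sup>2)"
      unfolding n_def by (rule blocks[OF i(1)])
    have "\<exists>\<nu>\<in>B. (real (card A))\<^sup>2 \<le> 8 * \<theta> i * real (card {y\<in>A * A. y / \<nu> \<in> A * A \<and> (\<exists>(a, b)\<in>G. y = a * b)})"
    proof (rule exists_slope_with_many_products[OF A(1,3) A1A _ _ e K(1) L[OF i(1)] bl _ M(1)[OF i(1)] M(2)[OF i(1)] M\<theta>[OF i(1)]])
      show "B \<subseteq> Lam A1 i" unfolding B_def by blast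
      show "0 \<le> \<theta> i" using \<theta>[OF i(1)] by simp
      fix a assume "a \<in> A1"
      then have "N \<le> 2 * d a" unfolding A1_def by blast
      then have "real N \<le> real (2 * d a)" by (rule of_nat_mono)
      then show "real (card A) \<le> 2 * real (card {b\<in>A. (a, b) \<in> G})" unfolding N_def d_def by simp
    qed
    then show False unfolding B_def Good_def Z_def N_def by blast
  qed
  define Bad where "Bad = {y\<in>A * A. \<exists>(a, b)\<in>G. y = a * b}"
  have fAA: "finite (A * A)" using A by (simp add: finite_set_times)
  have fBad: "finite Bad" unfolding Bad_def using fAA by simp
  have Bad: "real (popularity A i y) < s i" if "y \<in> Bad" for y
    using that i(1) unfolding Bad_def G_def by auto
  \<comment> \<open>Double counting of good slopes against bad products. The threshold
    \<open>s i\<close> is the value at which n / (2 H) slopes with N^2 / (8 \<theta>) products each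
    equal K products with \<open>s i\<close> slopes each; strict unpopularity then contradicts
    it.\<close>
  have "n / (2 * H) * ((real N)\<^sup>2 / (8 * \<theta> i)) \<le> real (card Good) * ((real N)\<^sup>2 / (8 * \<theta> i))"
    by (rule mult_right_mono) (use good_half H \<theta>[OF i(1)] in \<open>auto simp: field_simps\<close>)
  also have "\<dots> = (\<Sum>\<nu>\<in>Good. (real N)\<^sup>2 / (8 * \<theta> i))" by simp
  also have "\<dots> \<le> (\<Sum>\<nu>\<in>Good. real (card (Z \<nu>)))"
    by (rule sum_mono) (use \<theta>[OF i(1)] in \<open>auto simp: Good_def field_simps\<close>)
  also have "\<dots> = real (card (SIGMA \<nu>:Good. Z \<nu>))"
    using fGood fAA by (simp add: Z_def)
  also have "\<dots> \<le> real (card (SIGMA y:Bad. {\<nu>\<in>Lam A i. y / \<nu> \<in> A * A}))"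
    by (rule of_nat_mono, rule card_inj_on_le[of "\<lambda>(\<nu>, y). (y, \<nu>)"])
      (use GoodL fBad finite_Lam[OF A(1,3)] in \<open>auto simp: inj_on_def Z_def Bad_def\<close>)
  also have "\<dots> = (\<Sum>y\<in>Bad. real (popularity A i y))"
    unfolding popularity_def using fBad finite_Lam[OF A(1,3)] by simp
  finally have low: "n / (2 * H) * ((real N)\<^sup>2 / (8 * \<theta> i)) \<le> (\<Sum>y\<in>Bad. real (popularity A i y))" .
  have pos: "0 < n / (2 * H) * ((real N)\<^sup>2 / (8 * \<theta> i))" using n0 H N0 \<theta>[OF i(1)] by simp
  then have "Bad \<noteq> {}" using low by auto
  then have "(\<Sum>y\<in>Bad. real (popularity A i y)) < (\<Sum>y\<in>Bad. s i)"
    by (intro sum_strict_mono fBad) (use Bad in auto)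
  also have "\<dots> = real (card Bad) * s i" by simp
  also have "\<dots> \<le> K * s i"
  proof (rule mult_right_mono)
    have "real (card Bad) \<le> real (card (A * A))" by (intro of_nat_mono card_mono fAA) (auto simp: Bad_def)
    then show "real (card Bad) \<le> K" using K(2) by linarith
    show "0 \<le> s i" unfolding s_def using H K0 \<theta>[OF i(1)] by simp
  qed
  also have "\<dots> = n / (2 * H) * ((real N)\<^sup>2 / (8 * \<theta> i))"
    unfolding s_def n_def N_def using K0 by simp
  finally show False using low by linarith
qed

section \<open>Large controlled subsets\<close>

lemma weight_nonneg: "0 \<le> weight A i"
  unfolding weight_def by simp

text \<open>The multiplicative energy is at least N^4 / K, and ratios with fewer than N^2 / (2 K)
  representations contribute at most half of it. The dominant level thus has t >= N^2 / (4 K), which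
  bounds the surplus factor t^(1/25) of the weight from below.\<close>

lemma exists_large_weight:
  fixes A :: "real set"
  assumes A: "finite A" "A \<noteq> {}" "\<And>a. a \<in> A \<Longrightarrow> 0 < a"
    and e: "card A < 2 ^ e" "0 < e" and K: "real (card (A * A)) \<le> K"
  shows "\<exists>i<e. real (card A) ^ 4 / (8 * K * real e) * ((real (card A))\<^sup>2 / (4 * K)) powr (1 / 25) \<le> weight A i"
proof -
  define N where "N = real (card A)"
  have N0: "0 < N" unfolding N_def using A by (simp add: card_gt_0_iff)
  have fAA: "finite (A * A)" using A by (simp add: finite_set_times)
  have AA: "A * A = (\<lambda>p. fst p * snd p) ` (A \<times> A)" by (simp add: set_times_image split_def)
  have K0: "0 < K"
  proof -
    have "0 < card (A * A)" unfolding AA using A by (simp add: card_gt_0_iff)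
    then show ?thesis using K by linarith
  qed
  define T0 where "T0 = N\<^sup>2 / (2 * K)"
  have T0: "0 < T0" unfolding T0_def using N0 K0 by simp
  define \<Omega> where "\<Omega> = Lam A 0"
  have f\<Omega>: "finite \<Omega>" unfolding \<Omega>_def by (rule finite_Lam[OF A(1,3)])
  define E where "E = card {(p, q). p \<in> A \<times> A \<and> q \<in> A \<times> A \<and> fst p * snd p = fst q * snd q}"
  have E1: "N ^ 4 \<le> K * real E"
  proof -
    have "(card (A \<times> A))\<^sup>2 \<le> card (A * A) * E"
      unfolding AA E_def by (rule image_Cauchy_Schwarz) (use A in simp)
    then have "real ((card (A \<times> A))\<^sup>2) \<le> real (card (A * A) * E)" by (rule of_nat_mono)
    also have "\<dots> \<le> K * real E" using mult_right_mono[OF K, of "real E"] by simp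
    finally show ?thesis unfolding N_def by (simp add: card_cartesian_product eval_nat_numeral mult_ac)
  qed
  have E2: "real E \<le> (\<Sum>\<mu>\<in>\<Omega>. (real (rq A \<mu>))\<^sup>2)"
  proof -
    let ?S = "SIGMA \<mu>:\<Omega>. {a\<in>A. \<mu> * a \<in> A} \<times> {a\<in>A. \<mu> * a \<in> A}"
    have "E \<le> card ?S"
      unfolding E_def
    proof (rule card_inj_on_le[of "\<lambda>((a, b), (c, d)). (a / c, (c, b))"])
      show "inj_on (\<lambda>((a, b), (c, d)). (a / c, (c, b)))
          {(p, q). p \<in> A \<times> A \<and> q \<in> A \<times> A \<and> fst p * snd p = fst q * snd q}"
      proof (rule inj_onI)
        fix P Q assume P: "P \<in> {(p, q). p \<in> A \<times> A \<and> q \<in> A \<times> A \<and> fst p * snd p = fst q * snd q}"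
          and Q: "Q \<in> {(p, q). p \<in> A \<times> A \<and> q \<in> A \<times> A \<and> fst p * snd p = fst q * snd q}"
          and eq: "(\<lambda>((a, b), (c, d)). (a / c, (c, b))) P = (\<lambda>((a, b), (c, d)). (a / c, (c, b))) Q"
        obtain a b c d where p: "P = ((a, b), (c, d))" by (metis prod.collapse)
        obtain a' b' c' d' where q: "Q = ((a', b'), (c', d'))" by (metis prod.collapse)
        have 1: "a / c = a' / c" "c' = c" "b' = b" using eq unfolding p q by auto
        have 2: "0 < c" "a * b = c * d" "a' * b = c * d'" using P Q A(3) 1 unfolding p q by auto
        have "a = a'" using 1(1) 2(1) by simp
        moreover have "d = d'" using 2 \<open>a = a'\<close> by simp
        ultimately show "P = Q" using 1 unfolding p q by simp
      qed
      show "(\<lambda>((a, b), (c, d)). (a / c, (c, b))) ` {(p, q). p \<in> A \<times> A \<and> q \<in> A \<times> A \<and> fst p * snd p = fst q * snd q} \<subseteq> ?S"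
      proof (intro subsetI, elim imageE)
        fix y P assume P: "P \<in> {(p, q). p \<in> A \<times> A \<and> q \<in> A \<times> A \<and> fst p * snd p = fst q * snd q}"
          and y: "y = (\<lambda>((a, b), (c, d)). (a / c, (c, b))) P"
        obtain a b c d where p: "P = ((a, b), (c, d))" by (metis prod.collapse)
        have *: "a \<in> A" "b \<in> A" "c \<in> A" "d \<in> A" "a * b = c * d" using P unfolding p by auto
        have c: "0 < c" using A(3) * by blast
        have e: "a / c * c = a" "a / c * b = d" using c *(5) by (simp_all add: field_simps)
        have m: "c \<in> {x\<in>A. a / c * x \<in> A}" "b \<in> {x\<in>A. a / c * x \<in> A}" unfolding mem_Collect_eq e using * by auto
        have "card {x\<in>A. a / c * x \<in> A} \<noteq> 0" using m A(1) by auto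
        then have "a / c \<in> \<Omega>" unfolding \<Omega>_def Lam_def rq_def by simp
        then show "y \<in> ?S" unfolding y p using m by simp
      qed
    qed (use f\<Omega> A in auto)
    also have "\<dots> = (\<Sum>\<mu>\<in>\<Omega>. rq A \<mu> * rq A \<mu>)" unfolding rq_def using f\<Omega> A by (simp add: card_cartesian_product)
    finally have "real E \<le> real (\<Sum>\<mu>\<in>\<Omega>. rq A \<mu> * rq A \<mu>)" by (rule of_nat_mono)
    then show ?thesis by (simp add: power2_eq_square)
  qed
  define \<Omega>1 where "\<Omega>1 = {\<mu>\<in>\<Omega>. T0 \<le> real (rq A \<mu>)}"
  have f\<Omega>1: "finite \<Omega>1" unfolding \<Omega>1_def using f\<Omega> by simp
  have "(\<Sum>\<mu>\<in>\<Omega>. (real (rq A \<mu>))\<^sup>2) \<le> (\<Sum>\<mu>\<in>\<Omega>. T0 * real (rq A \<mu>) + (if \<mu> \<in> \<Omega>1 then (real (rq A \<mu>))\<^sup>2 else 0))"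
  proof (rule sum_mono)
    fix \<mu> assume m: "\<mu> \<in> \<Omega>"
    show "(real (rq A \<mu>))\<^sup>2 \<le> T0 * real (rq A \<mu>) + (if \<mu> \<in> \<Omega>1 then (real (rq A \<mu>))\<^sup>2 else 0)"
    proof (cases "\<mu> \<in> \<Omega>1")
      case False
      then have "real (rq A \<mu>) * real (rq A \<mu>) \<le> T0 * real (rq A \<mu>)"
        using m unfolding \<Omega>1_def by (intro mult_right_mono) auto
      then show ?thesis using False by (simp add: power2_eq_square)
    qed (use T0 in simp)
  qed
  also have "\<dots> = T0 * (\<Sum>\<mu>\<in>\<Omega>. real (rq A \<mu>)) + (\<Sum>\<mu>\<in>\<Omega>1. (real (rq A \<mu>))\<^sup>2)"
  proof -
    have "\<Omega> \<inter> \<Omega>1 = \<Omega>1" unfolding \<Omega>1_def by auto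
    then show ?thesis using f\<Omega> by (simp add: sum.distrib sum_distrib_left flip: sum.inter_restrict)
  qed
  also have "T0 * (\<Sum>\<mu>\<in>\<Omega>. real (rq A \<mu>)) \<le> T0 * N\<^sup>2"
  proof (rule mult_left_mono)
    have "real (\<Sum>\<mu>\<in>\<Omega>. rq A \<mu>) \<le> real ((card A)\<^sup>2)" by (rule of_nat_mono[OF sum_rq_le[OF A(1,3) f\<Omega>]])
    then show "(\<Sum>\<mu>\<in>\<Omega>. real (rq A \<mu>)) \<le> N\<^sup>2" unfolding N_def by simp
  qed (use T0 in simp)
  finally have "real E \<le> T0 * N\<^sup>2 + (\<Sum>\<mu>\<in>\<Omega>1. (real (rq A \<mu>))\<^sup>2)" using E2 by linarith
  then have "K * real E \<le> K * (T0 * N\<^sup>2 + (\<Sum>\<mu>\<in>\<Omega>1. (real (rq A \<mu>))\<^sup>2))" by (rule mult_left_mono) (use K0 in simp)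
  moreover have "K * (T0 * N\<^sup>2) = N ^ 4 / 2" unfolding T0_def using K0 by (simp add: field_simps eval_nat_numeral)
  ultimately have 1: "N ^ 4 \<le> 2 * K * (\<Sum>\<mu>\<in>\<Omega>1. (real (rq A \<mu>))\<^sup>2)" using E1 by (simp add: distrib_left)
  have rqe: "rq A \<mu> < 2 ^ e" for \<mu> using rq_le[OF A(1), of \<mu>] e by linarith
  obtain i where i: "i < e" "(\<Sum>\<mu>\<in>\<Omega>1. (real (rq A \<mu>))\<^sup>2)
      \<le> real e * (\<Sum>\<mu>\<in>{\<mu>\<in>\<Omega>1. 2 ^ i \<le> rq A \<mu> \<and> rq A \<mu> < 2 ^ (i + 1)}. (real (rq A \<mu>))\<^sup>2)"
    using dyadic_pigeonhole[OF f\<Omega>1, of "rq A" e "\<lambda>\<mu>. (real (rq A \<mu>))\<^sup>2"] rqe e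
    unfolding \<Omega>1_def \<Omega>_def Lam_def by auto
  define V where "V = {\<mu>\<in>\<Omega>1. 2 ^ i \<le> rq A \<mu> \<and> rq A \<mu> < 2 ^ (i + 1)}"
  define t where "t = (2::real) ^ i"
  have t0: "0 < t" unfolding t_def by simp
  have Vt: "real (rq A \<mu>) < 2 * t" if "\<mu> \<in> V" for \<mu>
  proof -
    have "real (rq A \<mu>) < real (2 ^ (i + 1))" using that unfolding V_def by (simp only: of_nat_less_iff) simp
    then show ?thesis unfolding t_def by simp
  qed
  define n where "n = real (card (Lam A i))"
  have "(\<Sum>\<mu>\<in>V. (real (rq A \<mu>))\<^sup>2) \<le> (\<Sum>\<mu>\<in>V. (2 * t)\<^sup>2)"
    by (intro sum_mono power_mono less_imp_le[OF Vt]) auto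
  also have "\<dots> = real (card V) * (4 * t\<^sup>2)" by (simp add: power_mult_distrib)
  also have "\<dots> \<le> n * (4 * t\<^sup>2)" unfolding n_def
    by (intro mult_right_mono of_nat_mono card_mono finite_Lam A) (auto simp: V_def Lam_def)
  finally have "real e * (\<Sum>\<mu>\<in>V. (real (rq A \<mu>))\<^sup>2) \<le> real e * (n * (4 * t\<^sup>2))" by (rule mult_left_mono) simp
  then have "(\<Sum>\<mu>\<in>\<Omega>1. (real (rq A \<mu>))\<^sup>2) \<le> real e * (n * (4 * t\<^sup>2))" using i(2) unfolding V_def by linarith
  then have "2 * K * (\<Sum>\<mu>\<in>\<Omega>1. (real (rq A \<mu>))\<^sup>2) \<le> 2 * K * (real e * (n * (4 * t\<^sup>2)))"
    by (rule mult_left_mono) (use K0 in simp)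
  then have 2: "N ^ 4 \<le> (8 * K * real e) * (n * t\<^sup>2)" using 1 by (simp add: mult_ac)
  have "V \<noteq> {}"
  proof
    assume "V = {}"
    then have "(\<Sum>\<mu>\<in>\<Omega>1. (real (rq A \<mu>))\<^sup>2) \<le> 0" using i(2)[folded V_def] by simp
    then have "2 * K * (\<Sum>\<mu>\<in>\<Omega>1. (real (rq A \<mu>))\<^sup>2) \<le> 0" using K0 by (simp add: mult_nonneg_nonpos)
    then have "N ^ 4 \<le> 0" using 1 by linarith
    then show False using N0 by (simp add: not_le)
  qed
  then obtain \<mu> where "\<mu> \<in> V" by blast
  then have "T0 < 2 * t" using Vt[of \<mu>] unfolding V_def \<Omega>1_def by auto
  then have "T0 / 2 \<le> t" by simp
  moreover have "T0 / 2 = N\<^sup>2 / (4 * K)" unfolding T0_def by simp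
  ultimately have 3: "(N\<^sup>2 / (4 * K)) powr (1 / 25) \<le> t powr (1 / 25)"
    using T0 by (intro powr_mono2) auto
  have 4: "N ^ 4 / (8 * K * real e) \<le> n * t\<^sup>2" using 2 K0 e by (simp add: field_simps)
  have "N ^ 4 / (8 * K * real e) * (N\<^sup>2 / (4 * K)) powr (1 / 25) \<le> (n * t\<^sup>2) * t powr (1 / 25)"
    by (rule mult_mono[OF 4 3]) (use n_def in auto)
  also have "\<dots> = n * (t powr 2 * t powr (1 / 25))" using t0 by (simp add: powr_numeral)
  also have "\<dots> = weight A i" unfolding weight_def n_def t_def[symmetric] powr_add[symmetric] by simp
  finally show ?thesis unfolding N_def using i(1) by blast
qed

lemma one_mem_Lam:
  assumes "finite A" "A \<noteq> {}"
  shows "1 \<in> Lam A 0"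
  using assms unfolding Lam_def rq_def by (simp add: Suc_le_eq card_gt_0_iff ex_in_conv)

lemma weight_zero_ge_1:
  assumes "finite A" "A \<noteq> {}" "\<And>a. a \<in> A \<Longrightarrow> 0 < a"
  shows "1 \<le> weight A 0"
proof -
  have "0 < card (Lam A 0)" using one_mem_Lam[OF assms(1,2)] finite_Lam[OF assms(1,3)] by (auto simp: card_gt_0_iff)
  then show ?thesis unfolding weight_def by simp
qed

lemma level_le_card:
  assumes "finite A" "0 < card (Lam A i)"
  shows "2 ^ i \<le> card A"
proof -
  obtain \<mu> where "\<mu> \<in> Lam A i" using assms(2) by (metis card.empty ex_in_conv less_numeral_extra(3))
  then show ?thesis using rq_le[OF assms(1), of \<mu>] unfolding Lam_def by simp
qed

text \<open>A crude bound suffices, so 51/25 is raised to 3: the exponent 4 is later divided by the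
  large number h.\<close>

lemma weight_le:
  assumes "finite A" "\<And>a. a \<in> A \<Longrightarrow> 0 < a"
  shows "weight A i \<le> real (card A) ^ 4"
proof (cases "card (Lam A i) = 0")
  case False
  define t where "t = (2::real) ^ i"
  have t: "1 \<le> t" unfolding t_def by simp
  have tN: "t \<le> real (card A)"
    using of_nat_mono[OF level_le_card[OF assms(1), of i], where 'a=real] False unfolding t_def by simp
  have nt: "real (card (Lam A i)) * t \<le> (real (card A))\<^sup>2"
    using of_nat_mono[OF card_Lam_le[OF assms, of i], where 'a=real] unfolding t_def by simp
  have "weight A i = real (card (Lam A i)) * t powr (51 / 25)" unfolding weight_def t_def ..
  also have "\<dots> \<le> real (card (Lam A i)) * t powr 3" using t by (intro mult_left_mono powr_mono) auto
  also have "\<dots> = (real (card (Lam A i)) * t) * t\<^sup>2" using t by (simp add: powr_numeral eval_nat_numeral)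
  also have "\<dots> \<le> (real (card A))\<^sup>2 * (real (card A))\<^sup>2"
    by (intro mult_mono power_mono nt tN) (use t in auto)
  finally show ?thesis by (simp add: eval_nat_numeral)
qed (simp add: weight_def)

text \<open>Minimising \<open>Max (weight B) / card B ^ h\<close> over the subsets \<open>B\<close> of \<open>A\<close> makes the maximal weight stable under passing to large subsets.\<close>
lemma exists_weight_regular_subset:
  fixes A :: "real set"
  assumes A: "finite A" "A \<noteq> {}" "\<And>a. a \<in> A \<Longrightarrow> 0 < a" and e: "0 < e"
  shows "\<exists>A0\<subseteq>A. A0 \<noteq> {} \<and> real (card A) ^ h \<le> real (card A) ^ 4 * real (card A0) ^ h \<and>
    (\<forall>A1\<subseteq>A0. card A0 \<le> 2 * card A1 \<longrightarrow> (\<exists>i<e. \<forall>j<e. weight A0 j \<le> 2 ^ h * weight A1 i))"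
proof -
  define \<Phi> where "\<Phi> B = Max (weight B ` {..<e})" for B
  have \<Phi>_ge: "weight B j \<le> \<Phi> B" if "j < e" for B j unfolding \<Phi>_def using that by (intro Max_ge) auto
  have \<Phi>_in: "\<exists>i<e. \<Phi> B = weight B i" for B
  proof -
    have "Max (weight B ` {..<e}) \<in> weight B ` {..<e}" by (rule Max_in) (use e in auto)
    then show ?thesis unfolding \<Phi>_def by blast
  qed
  define F where "F B = \<Phi> B / real (card B) ^ h" for B :: "real set"
  define \<B> where "\<B> = {B. B \<subseteq> A \<and> B \<noteq> {}}"
  have "finite \<B>" unfolding \<B>_def using A by simp
  moreover have "\<B> \<noteq> {}" unfolding \<B>_def using A by blast
  ultimately obtain A0 where "is_arg_min F (\<lambda>B. B \<in> \<B>) A0" using ex_is_arg_min_if_finite by blast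
  then have A0: "A0 \<in> \<B>" and min: "\<And>B. B \<in> \<B> \<Longrightarrow> F A0 \<le> F B" unfolding is_arg_min_linorder by auto
  have A0A: "A0 \<subseteq> A" "A0 \<noteq> {}" using A0 unfolding \<B>_def by auto
  have pos: "0 < real (card B)" if "B \<subseteq> A" "B \<noteq> {}" for B
    using that A finite_subset by (auto simp: card_gt_0_iff)
  have \<Phi>1: "1 \<le> \<Phi> A0"
    by (rule order_trans[OF weight_zero_ge_1 \<Phi>_ge[OF e]]) (use A0A A finite_subset in auto)
  have \<Phi>4: "\<Phi> A \<le> real (card A) ^ 4" using \<Phi>_in[of A] weight_le[OF A(1,3)] by auto
  have "\<Phi> A0 / real (card A0) ^ h \<le> \<Phi> A / real (card A) ^ h"
    using min[of A] A unfolding F_def \<B>_def by simp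
  then have "\<Phi> A0 * real (card A) ^ h \<le> \<Phi> A * real (card A0) ^ h"
    using pos[OF A0A] pos[OF order_refl A(2)] by (simp add: divide_simps mult_ac)
  moreover have "1 * real (card A) ^ h \<le> \<Phi> A0 * real (card A) ^ h" by (rule mult_right_mono[OF \<Phi>1]) simp
  moreover have "\<Phi> A * real (card A0) ^ h \<le> real (card A) ^ 4 * real (card A0) ^ h" by (rule mult_right_mono[OF \<Phi>4]) simp
  \<comment> \<open>Maximal weights lie between 1 and N^4, so the minimiser is smaller than A by a
    factor of at most N^(4/h).\<close>
  ultimately have size: "real (card A) ^ h \<le> real (card A) ^ 4 * real (card A0) ^ h" by linarith
  have "\<exists>i<e. \<forall>j<e. weight A0 j \<le> 2 ^ h * weight A1 i" if A1: "A1 \<subseteq> A0" and half: "card A0 \<le> 2 * card A1" for A1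
  proof -
    obtain i where i: "i < e" "\<Phi> A1 = weight A1 i" using \<Phi>_in by blast
    have "A1 \<noteq> {}" using half pos[OF A0A] by auto
    then have "A1 \<in> \<B>" unfolding \<B>_def using A1 A0A by blast
    then have "\<Phi> A0 / real (card A0) ^ h \<le> \<Phi> A1 / real (card A1) ^ h" using min unfolding F_def by blast
    then have 1: "\<Phi> A0 * real (card A1) ^ h \<le> \<Phi> A1 * real (card A0) ^ h"
      using pos[OF A0A] pos[of A1] A1 A0A \<open>A1 \<noteq> {}\<close> by (simp add: divide_simps mult_ac)
    have "real (card A0) \<le> real (2 * card A1)" by (rule of_nat_mono[OF half])
    then have "real (card A0) ^ h \<le> (2 * real (card A1)) ^ h" by (intro power_mono) auto
    then have "\<Phi> A1 * real (card A0) ^ h \<le> \<Phi> A1 * (2 * real (card A1)) ^ h"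
      by (rule mult_left_mono) (simp add: i weight_nonneg)
    then have "real (card A1) ^ h * \<Phi> A0 \<le> real (card A1) ^ h * (2 ^ h * \<Phi> A1)"
      using 1 by (simp add: power_mult_distrib mult_ac)
    then have "\<Phi> A0 \<le> 2 ^ h * \<Phi> A1"
      by (rule mult_left_le_imp_le) (use pos[of A1] A1 A0A \<open>A1 \<noteq> {}\<close> in simp)
    then show ?thesis using i \<Phi>_ge order_trans by metis
  qed
  then show ?thesis using A0A size by blast
qed

lemma card_le_card_sumset:
  fixes A :: "real set"
  assumes "finite A" "A \<noteq> {}"
  shows "card A \<le> card (A + A)"
proof -
  obtain a where a: "a \<in> A" using assms by blast
  show ?thesis
    by (rule card_inj_on_le[of "\<lambda>x. a + x"]) (use assms a in \<open>auto intro: set_plus_intro finite_set_plus\<close>)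
qed

text \<open>Solymosi's bound, from blocks of two slopes: u and v determine z because l and k differ,
  so the triple count is at most t^2. A single slope forms no block, and there t <=
  \<open>card A\<close> <= \<open>card (A + A)\<close> is enough.\<close>

lemma card_Lam_le_sumset:
  fixes A :: "real set"
  assumes A: "finite A" "A \<noteq> {}" "\<And>a. a \<in> A \<Longrightarrow> 0 < a" and K: "real (card (A + A)) \<le> K"
  shows "real (card (Lam A i)) * (2 ^ i)\<^sup>2 \<le> 6 * K\<^sup>2"
proof -
  define n where "n = card (Lam A i)"
  define t :: nat where "t = 2 ^ i"
  have K2: "(real (card (A + A)))\<^sup>2 \<le> K\<^sup>2" by (rule power_mono[OF K]) simp
  consider "n = 0" | "n = 1" | "2 \<le> n" by linarith
  then show ?thesis
  proof cases
    case 1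
    then show ?thesis unfolding n_def by simp
  next
    case 2
    then have "t \<le> card A" unfolding t_def n_def by (intro level_le_card[OF A(1)]) simp
    then have "t \<le> card (A + A)" using card_le_card_sumset[OF A(1,2)] by linarith
    then have "(real t)\<^sup>2 \<le> (real (card (A + A)))\<^sup>2" by (intro power_mono of_nat_mono) auto
    then have "(real t)\<^sup>2 \<le> K\<^sup>2" using K2 by (rule order_trans)
    moreover have "real (card (Lam A i)) * (2 ^ i)\<^sup>2 = (real t)\<^sup>2" using 2 unfolding n_def t_def by simp
    ultimately show ?thesis using zero_le_power2[of K] by linarith
  next
    case 3
    have "\<exists>X. X \<subseteq> {u\<in>A. \<nu> * u \<in> A} \<and> card X = t" if "\<nu> \<in> Lam A i" for \<nu>
    proof -
      have "t \<le> card {u\<in>A. \<nu> * u \<in> A}" using that unfolding Lam_def rq_def t_def by blast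
      then show ?thesis using obtain_subset_with_card_n by metis
    qed
    then obtain U where U: "\<forall>\<nu>\<in>Lam A i. U \<nu> \<subseteq> {u\<in>A. \<nu> * u \<in> A} \<and> card (U \<nu>) = t"
      using bchoice[of "Lam A i" "\<lambda>\<nu> X. X \<subseteq> {u\<in>A. \<nu> * u \<in> A} \<and> card X = t"] by blast
    have fU: "finite (U \<nu>)" if "\<nu> \<in> Lam A i" for \<nu>
      by (rule finite_subset[OF _ A(1)]) (use U that in blast)
    have "card (Lam A i) div 2 * (2 * (2 - 1) * t\<^sup>2) \<le> 4 * (card (A + A))\<^sup>2"
    proof (rule sumset_lower_bound_by_blocks[OF A(1,3) finite_Lam[OF A(1,3)]])
      fix p j k l assume m: "p \<in> Lam A i" "j \<in> Lam A i" "k \<in> Lam A i" "l \<in> Lam A i" "l \<noteq> k"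
      have "triple_count U p j k l \<le> card (U p \<times> U j)"
        unfolding triple_count_def
      proof (rule card_inj_on_le[of "\<lambda>(u, v, z). (u, v)"])
        show "inj_on (\<lambda>(u, v, z). (u, v)) {(u, v, z). u \<in> U p \<and> v \<in> U j \<and> z \<in> U k \<and> (p - l) * u + (j - l) * v = (k - l) * z}"
          using m(5) by (auto simp: inj_on_def)
      qed (use fU m in auto)
      also have "\<dots> = t\<^sup>2" using U m by (simp add: card_cartesian_product power2_eq_square)
      finally show "triple_count U p j k l * (2 * (2 - 1)) \<le> 2 * t\<^sup>2" by simp
    qed (use U in auto)
    then have "n * t\<^sup>2 \<le> 6 * (card (A + A))\<^sup>2"
    proof -
      assume a: "card (Lam A i) div 2 * (2 * (2 - 1) * t\<^sup>2) \<le> 4 * (card (A + A))\<^sup>2"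
      have "n \<le> 3 * (n div 2)" using 3 by linarith
      then have "n * t\<^sup>2 \<le> 3 * (n div 2) * t\<^sup>2" by (rule mult_le_mono1)
      also have "\<dots> = 3 * (n div 2 * t\<^sup>2)" by (simp only: mult.assoc)
      also have "n div 2 * t\<^sup>2 \<le> 2 * (card (A + A))\<^sup>2"
        using a unfolding n_def[symmetric] by (simp add: mult_ac)
      finally show ?thesis by simp
    qed
    then have "real (n * t\<^sup>2) \<le> real (6 * (card (A + A))\<^sup>2)" by (rule of_nat_mono)
    then show ?thesis using K2 unfolding n_def t_def by simp
  qed
qed

section \<open>Choice of the parameters\<close>

lemma powr_51_25: "(x powr (51 / 50))\<^sup>2 = x powr (51 / 25)" for x :: real
  by (simp add: power2_eq_square flip: powr_add)

text \<open>Applied with X = 2^j and c the number of slopes on level j. The square root of the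
  weight comparison controls X^(51/50) sqrt c; the surplus X^(1/50) is divided out using X >
  \<theta> / 2. This is where a weight exponent above 2 gains a negative power of \<theta>.\<close>

lemma level_weight_bound:
  fixes X c n t \<theta> H :: real
  assumes "0 < X" "0 \<le> c" "0 \<le> H * n" "0 < t" "0 < \<theta>" "\<theta> < 2 * X"
    and le: "c * X powr (51 / 25) \<le> H * (n * t powr (51 / 25))"
  shows "2 * X * sqrt c \<le> 4 * sqrt (H * n) * t powr (51 / 50) * \<theta> powr (- 1 / 50)"
proof -
  have s: "sqrt (a * y powr (51 / 25)) = sqrt a * y powr (51 / 50)" if "0 \<le> a" for a y :: real
    unfolding real_sqrt_mult powr_51_25[symmetric] by simp
  have "sqrt (c * X powr (51 / 25)) \<le> sqrt ((H * n) * t powr (51 / 25))"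
    using le by (intro real_sqrt_le_mono) (simp add: mult_ac)
  then have a: "sqrt c * X powr (51 / 50) \<le> sqrt (H * n) * t powr (51 / 50)"
    using s[OF assms(2), of X] s[OF assms(3), of t] by simp
  have "X powr (- 1 / 50) \<le> (\<theta> / 2) powr (- 1 / 50)"
    by (rule powr_mono2') (use assms in auto)
  also have "\<dots> = \<theta> powr (- 1 / 50) * 2 powr (1 / 50)"
    using assms by (simp add: powr_divide powr_minus_divide)
  also have "\<dots> \<le> \<theta> powr (- 1 / 50) * 2 powr 1"
    by (intro mult_left_mono powr_mono) auto
  finally have b: "X powr (- 1 / 50) \<le> 2 * \<theta> powr (- 1 / 50)" by simp
  have "2 * X * sqrt c = 2 * (sqrt c * X powr (51 / 50)) * X powr (- 1 / 50)"
    using assms(1) by (simp add: powr_add[symmetric] mult.assoc)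
  also have "\<dots> \<le> 2 * (sqrt (H * n) * t powr (51 / 50)) * (2 * \<theta> powr (- 1 / 50))"
    by (intro mult_mono mult_left_mono a b) (use assms in auto)
  finally show ?thesis by (simp add: mult_ac)
qed

text \<open>The bound M itself contains \<theta>^(-1/50), so the requirement 16 c M L^4 <= \<theta>
  t is implicit in \<theta>. With equality it reads b \<theta>^(-1/50) = \<theta>, whose solution is
  b^(50/51).\<close>

lemma threshold_identity:
  fixes c n t H L :: real
  assumes "0 < c" "0 < H * n" "0 < t" "0 < L"
  defines "\<theta> \<equiv> (64 * c * sqrt (H * n) * t powr (1 / 50) * L ^ 4) powr (50 / 51)"
  shows "16 * c * (4 * sqrt (H * n) * t powr (51 / 50) * \<theta> powr (- 1 / 50)) * L ^ 4 = \<theta> * t"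
proof -
  define b where "b = 64 * c * sqrt (H * n) * t powr (1 / 50) * L ^ 4"
  have b: "0 < b" unfolding b_def using assms by simp
  have "\<theta> powr (51 / 50) = b" unfolding \<theta>_def b_def[symmetric] using b by (simp add: powr_powr)
  moreover have "\<theta> powr (51 / 50) * \<theta> powr (- 1 / 50) = \<theta>"
    unfolding powr_add[symmetric] using b by (simp add: \<theta>_def b_def)
  ultimately have e: "b * \<theta> powr (- 1 / 50) = \<theta>" by simp
  have t: "t powr (51 / 50) = t * t powr (1 / 50)"
    using powr_add[of t 1 "1 / 50"] assms(3) by simp
  have "16 * c * (4 * sqrt (H * n) * t powr (51 / 50) * \<theta> powr (- 1 / 50)) * L ^ 4 = (b * \<theta> powr (- 1 / 50)) * t"
    unfolding t b_def by (simp add: mult_ac)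
  then show ?thesis unfolding e .
qed

text \<open>Here \<open>n\<close> is the number of slopes on a level and \<open>t\<close> the size of their fibres. In logarithms all constraints are linear.\<close>
locale level_parameters =
  fixes N K n t H e :: real
  assumes N: "1 \<le> N" and K: "0 < K" and n: "0 < n" and t: "1 \<le> t" "t \<le> N" and H: "1 \<le> H" and e: "1 \<le> e"
    and nt: "n * t \<le> N\<^sup>2" and nt2: "n * t\<^sup>2 \<le> 6 * K\<^sup>2"
    and wt: "N ^ 4 / (8 * K * e) * (N\<^sup>2 / (4 * K)) powr (1 / 25) \<le> H * (n * t powr (51 / 25))"
    and KN: "ln K \<le> 134 / 100 * ln N" and big: "3 * ln H + 2 * ln e + 20 \<le> 3 / 10 * ln N"
begin

lemma ln_nt: "ln n + ln t \<le> 2 * ln N"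
proof -
  have "ln (n * t) \<le> ln (N\<^sup>2)" using nt n t N by simp
  then show ?thesis using n t N by (simp add: ln_mult_pos ln_realpow)
qed

lemma ln_wt: "102 / 25 * ln N - 77 / 25 * ln 2 - 26 / 25 * ln K - ln e \<le> ln H + ln n + 51 / 25 * ln t"
proof -
  have p: "0 < (N\<^sup>2 / (4 * K)) powr (1 / 25)" "0 < N ^ 4 / (8 * K * e)" using N K e by simp_all
  have "ln (N ^ 4 / (8 * K * e) * (N\<^sup>2 / (4 * K)) powr (1 / 25)) \<le> ln (H * (n * t powr (51 / 25)))"
    by (rule ln_mono[OF wt mult_pos_pos[OF p(2,1)]])
  moreover have "ln (N ^ 4 / (8 * K * e) * (N\<^sup>2 / (4 * K)) powr (1 / 25))
      = ln (N ^ 4 / (8 * K * e)) + ln ((N\<^sup>2 / (4 * K)) powr (1 / 25))" using p by (rule ln_mult_pos[rotated])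
  moreover have "ln (N ^ 4 / (8 * K * e)) = 4 * ln N - (3 * ln 2 + ln K + ln e)"
    using N K e ln_realpow[of 2 3] by (simp add: ln_div ln_mult_pos ln_realpow)
  moreover have "ln ((N\<^sup>2 / (4 * K)) powr (1 / 25)) = 1 / 25 * ln (N\<^sup>2 / (4 * K))"
    using N K by (simp add: ln_powr)
  moreover have "ln (N\<^sup>2 / (4 * K)) = 2 * ln N - (2 * ln 2 + ln K)"
    using N K ln_realpow[of 2 2] by (simp add: ln_div ln_mult_pos ln_realpow)
  moreover have "ln (H * (n * t powr (51 / 25))) = ln H + (ln n + 51 / 25 * ln t)"
    using H n t by (simp add: ln_mult_pos ln_powr)
  ultimately show ?thesis by argo
qed

lemma ln_pos: "0 \<le> ln N" "0 \<le> ln t" "ln t \<le> ln N" "0 \<le> ln H" "0 \<le> ln e"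
  using N t H e by simp_all

text \<open>Solymosi's bound lets the rounding term 2 of the block length be absorbed into the main
  term: 16 + 12 = 28.\<close>

lemma two_le: "2 \<le> 12 * H * K\<^sup>2 / (n * t\<^sup>2)"
proof -
  have "2 * (n * t\<^sup>2) \<le> 12 * K\<^sup>2" using nt2 by linarith
  also have "\<dots> \<le> 12 * H * K\<^sup>2" using mult_right_mono[OF H, of "K\<^sup>2"] by simp
  finally show ?thesis using n t by (simp add: field_simps)
qed

text \<open>A block must fit into the n / (2 H) slopes available, which amounts to 56 H^2 K^2 <= (n
  t)^2. As t <= N, the weight bound makes n t at least about N^(3.04) K^(-1.04), and this exceeds K
  by a power of N because K <= N^(1.34).\<close>

lemma block_size: "16 * H * K\<^sup>2 / (n * t\<^sup>2) + 2 \<le> n / (2 * H)"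
proof -
  have "ln (56 * H\<^sup>2 * K\<^sup>2) \<le> ln (n\<^sup>2 * t\<^sup>2)"
  proof -
    have "ln (56 * H\<^sup>2 * K\<^sup>2) = ln 56 + 2 * ln H + 2 * ln K"
      using H K by (simp add: ln_mult_pos ln_realpow)
    moreover have "ln (n\<^sup>2 * t\<^sup>2) = 2 * ln n + 2 * ln t" using n t by (simp add: ln_mult_pos ln_realpow)
    moreover have "ln 56 \<le> 6 * ln (2::real)" using ln_realpow[of "2::real" 6] ln_le_cancel_iff[of 56 "64::real"] by simp
    moreover have "ln (2::real) \<le> 1" using ln_le_minus_one[of 2] by simp
    ultimately show ?thesis using ln_wt ln_pos KN big by linarith
  qed
  then have a: "56 * H\<^sup>2 * K\<^sup>2 \<le> n\<^sup>2 * t\<^sup>2" using H K n t by (subst (asm) ln_le_cancel_iff) auto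
  have "16 * H * K\<^sup>2 / (n * t\<^sup>2) + 2 \<le> 16 * H * K\<^sup>2 / (n * t\<^sup>2) + 12 * H * K\<^sup>2 / (n * t\<^sup>2)"
    by (rule add_left_mono[OF two_le])
  also have "\<dots> = 28 * H * K\<^sup>2 / (n * t\<^sup>2)" by (simp add: add_divide_distrib[symmetric])
  also have "\<dots> \<le> n / (2 * H)"
    using a n t H by (simp add: divide_simps power2_eq_square mult_ac)
  finally show ?thesis .
qed

text \<open>Since L <= x, the full blocks contain more than half of the x slopes, hence more than n
  / (4 H). The length is chosen with L - 1 > g, where n / (4 H) * g t^2 = 4 K^2.\<close>

lemma block_count:
  fixes x L :: nat
  assumes "n \<le> 2 * H * real x" and L: "L = nat \<lfloor>16 * H * K\<^sup>2 / (n * t\<^sup>2)\<rfloor> + 2"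
  shows "4 * K\<^sup>2 < real (x div L) * (real (L * (L - 1)) * t\<^sup>2)"
proof -
  define g where "g = 16 * H * K\<^sup>2 / (n * t\<^sup>2)"
  have g0: "0 < g" unfolding g_def using H K n t by simp
  have Lg: "real L \<le> g + 2" "g + 1 < real L" unfolding L g_def[symmetric] using g0 by linarith+
  have nx: "n / (2 * H) \<le> real x" using assms(1) H by (simp add: field_simps)
  have Lx: "L \<le> x" using nx Lg(1) block_size unfolding g_def[symmetric] by linarith
  have L0: "0 < L" unfolding L by simp
  have "x < (x div L) * L + L" using mod_less_divisor[OF L0, of x] div_mult_mod_eq[of x L] by linarith
  moreover have "L \<le> (x div L) * L" using Lx L0 by (simp add: div_greater_zero_iff Suc_le_eq)
  ultimately have "x < 2 * ((x div L) * L)" by linarith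
  then have "real x < real (2 * ((x div L) * L))" by (simp only: of_nat_less_iff)
  then have "real x < 2 * real ((x div L) * L)" by (simp only: of_nat_mult of_nat_numeral)
  moreover have "n / (4 * H) = n / (2 * H) / 2" by simp
  ultimately have xL: "n / (4 * H) < real ((x div L) * L)" using nx by linarith
  have "4 * K\<^sup>2 = n / (4 * H) * (g * t\<^sup>2)" unfolding g_def using n t H by (simp add: field_simps)
  also have "\<dots> < real ((x div L) * L) * (g * t\<^sup>2)" using xL g0 t by (intro mult_strict_right_mono) auto
  also have "\<dots> \<le> real ((x div L) * L) * ((real L - 1) * t\<^sup>2)"
    using Lg by (intro mult_left_mono mult_right_mono) auto
  also have "\<dots> = real (x div L) * (real (L * (L - 1)) * t\<^sup>2)"
    using L0 by (simp add: of_nat_diff mult_ac)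
  finally show ?thesis .
qed

text \<open>After L and \<theta> are substituted, the weight bound removes n. The remaining exponent
  of t is negative, so t is replaced by its lower bound N^2 / K, which follows from the weight bound
  and n t <= N^2. The numbers 140, 29 and 22 are rounded up.\<close>

lemma control_exponent:
  fixes L :: real
  assumes L: "0 < L" "L \<le> 28 * H * K\<^sup>2 / (n * t\<^sup>2)"
  defines "\<theta> \<equiv> (64 * e\<^sup>2 * sqrt (H * n) * t powr (1 / 50) * L ^ 4) powr (50 / 51)"
  defines "s \<equiv> n * N\<^sup>2 / (16 * H * K * \<theta>)"
  shows "51 / 50 * ln (2048 * e ^ 3 * n\<^sup>2 * K\<^sup>2 / s ^ 3)
    \<le> 140 + 29 * ln H + 22 * ln e + 4152 / 100 * ln K - 54 * ln N"
proof -
  have pos: "0 < 64 * e\<^sup>2 * sqrt (H * n) * t powr (1 / 50) * L ^ 4" using e H n t L by simp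
  have \<theta>0: "0 < \<theta>" unfolding \<theta>_def powr_gt_zero using pos by (rule less_imp_neq[symmetric])
  have s0: "0 < s" unfolding s_def using n N H K \<theta>0 by simp
  have l2: "ln (2::real) \<le> 1" "0 \<le> ln (2::real)" using ln_le_minus_one[of 2] by simp_all
  have lL: "ln L \<le> 5 * ln 2 + ln H + 2 * ln K - ln n - 2 * ln t"
  proof -
    have "ln L \<le> ln (32 * H * K\<^sup>2 / (n * t\<^sup>2))"
    proof (subst ln_le_cancel_iff)
      have "28 * H * K\<^sup>2 / (n * t\<^sup>2) \<le> 32 * H * K\<^sup>2 / (n * t\<^sup>2)"
        using H n t by (intro divide_right_mono mult_right_mono) auto
      then show "L \<le> 32 * H * K\<^sup>2 / (n * t\<^sup>2)" using L by linarith
    qed (use L H K n t in auto)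
    also have "\<dots> = 5 * ln 2 + ln H + 2 * ln K - (ln n + 2 * ln t)"
      using H K n t ln_realpow[of "2::real" 5] by (simp add: ln_div ln_mult_pos ln_realpow)
    finally show ?thesis by simp
  qed
  have l\<theta>: "51 * ln \<theta> = 300 * ln 2 + 100 * ln e + 25 * ln H + 25 * ln n + ln t + 200 * ln L"
  proof -
    have "ln \<theta> = 50 / 51 * ln (64 * e\<^sup>2 * sqrt (H * n) * t powr (1 / 50) * L ^ 4)"
      unfolding \<theta>_def by (simp only: ln_powr)
    moreover have "ln (64 * e\<^sup>2 * sqrt (H * n) * t powr (1 / 50) * L ^ 4)
        = 6 * ln 2 + 2 * ln e + (ln H + ln n) / 2 + 1 / 50 * ln t + 4 * ln L"
      using e H n t L ln_realpow[of "2::real" 6] by (simp add: ln_mult_pos ln_realpow ln_sqrt ln_powr)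
    ultimately show ?thesis by argo
  qed
  have ls: "ln s = ln n + 2 * ln N - (4 * ln 2 + ln H + ln K + ln \<theta>)"
    unfolding s_def using n N H K \<theta>0 ln_realpow[of "2::real" 4] by (simp add: ln_div ln_mult_pos ln_realpow)
  have "ln (2048 * e ^ 3 * n\<^sup>2 * K\<^sup>2 / s ^ 3) = 11 * ln 2 + 3 * ln e + 2 * ln n + 2 * ln K - 3 * ln s"
    using e n K s0 ln_realpow[of "2::real" 11] by (simp add: ln_div ln_mult_pos ln_realpow)
  then show ?thesis using lL l\<theta> ls ln_wt ln_nt ln_pos l2 by linarith
qed

end

section \<open>Controlled subsets from popular products\<close>

lemma controlled_mono: "controlled \<kappa> A \<Longrightarrow> \<kappa> \<le> \<kappa>' \<Longrightarrow> controlled \<kappa>' A"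
  unfolding controlled_def by (meson mult_right_mono order_trans zero_le_power2)

text \<open>For fixed b, a factorization a b = \<nu> y with y a product reads a = \<nu> (y / b). The
  factors are slopes and elements of the product set dilated by 1 / b, which has the same
  size.\<close>

lemma controlled_if_popular_products:
  fixes A A' :: "real set"
  assumes A: "finite A" "\<And>a. a \<in> A \<Longrightarrow> 0 < a" and A': "A' \<subseteq> A" and b: "b \<in> A"
    and s: "0 < s" "\<And>a. a \<in> A' \<Longrightarrow> s \<le> real (popularity A i (a * b))"
    and e: "card (A * A) < 2 ^ e" "0 < e" and K: "real (card (A * A)) \<le> K"
  shows "controlled (2048 * real e ^ 3 * (real (card (Lam A i)))\<^sup>2 * K\<^sup>2 / s ^ 3) A'"
proof -
  have b0: "0 < b" using A(2) b .
  have fA': "finite A'" using A' A(1) finite_subset by blast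
  define R where "R = (\<lambda>x. x / b) ` (A * A)"
  have fAA: "finite (A * A)" using A by (simp add: finite_set_times)
  have cR: "card R = card (A * A)" unfolding R_def using b0 by (intro card_image) (auto simp: inj_on_def)
  define t where "t = nat \<lceil>s\<rceil>"
  have t: "0 < t" "s \<le> real t" unfolding t_def using s(1) by linarith+
  have "controlled (2048 * real e ^ 3 * (real (card (Lam A i)))\<^sup>2 * (real (card R))\<^sup>2 / real t ^ 3) A'"
  proof (rule controlled_if_many_factorizations[OF fA' finite_Lam[OF A] _ _ _ t(1)])
    show "0 < q" if "q \<in> Lam A i" for q by (rule Lam_pos[OF A(2) that])
    show "finite R" unfolding R_def using fAA by simp
    show "0 < r" if "r \<in> R" for r using that A(2) b0 unfolding R_def by (auto elim!: set_times_elim)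
    show "t \<le> card {q \<in> Lam A i. a / q \<in> R}" if a: "a \<in> A'" for a
    proof -
      have "s \<le> real_of_int (int (popularity A i (a * b)))" using s(2)[OF a] by simp
      then have "\<lceil>s\<rceil> \<le> int (popularity A i (a * b))" by (simp only: ceiling_le_iff)
      then have "t \<le> popularity A i (a * b)" unfolding t_def by (simp only: nat_le_iff)
      also have "\<dots> \<le> card {q \<in> Lam A i. a / q \<in> R}" unfolding popularity_def
      proof (rule card_mono)
        show "finite {q \<in> Lam A i. a / q \<in> R}" using finite_Lam[OF A] by simp
        show "{\<nu> \<in> Lam A i. a * b / \<nu> \<in> A * A} \<subseteq> {q \<in> Lam A i. a / q \<in> R}"
          unfolding R_def using b0 by (auto intro!: image_eqI[of _ _ "a * b / _"])
      qed
      finally show ?thesis .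
    qed
    show "card R < 2 ^ e" "0 < e" using e cR by simp_all
  qed
  then show ?thesis
  proof (rule controlled_mono)
    have "(real (card R))\<^sup>2 \<le> K\<^sup>2" unfolding cR by (rule power_mono[OF K]) simp
    moreover have "s ^ 3 \<le> real t ^ 3" by (rule power_mono[OF t(2)]) (use s in simp)
    ultimately show "2048 * real e ^ 3 * (real (card (Lam A i)))\<^sup>2 * (real (card R))\<^sup>2 / real t ^ 3
        \<le> 2048 * real e ^ 3 * (real (card (Lam A i)))\<^sup>2 * K\<^sup>2 / s ^ 3"
      using s(1) by (intro frac_le mult_left_mono) auto
  qed
qed

text \<open>A quarter of all pairs (a, b) has a product popular at some admissible level.
  Pigeonholing over at most e levels and N values of b fixes both, and the elements a that remain
  form the controlled set.\<close>

lemma exists_controlled_subset: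
  fixes A :: "real set"
  assumes A: "finite A" "A \<noteq> {}" "\<And>a. a \<in> A \<Longrightarrow> 0 < a"
    and e: "(card A)\<^sup>2 < 2 ^ e" "0 < e" and K: "real (card (A + A)) \<le> K" "real (card (A * A)) \<le> K" and H: "1 \<le> H"
    and reg: "\<And>A1. A1 \<subseteq> A \<Longrightarrow> card A \<le> 2 * card A1 \<Longrightarrow> \<exists>i<e. \<forall>j<e. weight A j \<le> H * weight A1 i"
    and KN: "ln K \<le> 134 / 100 * ln (real (card A))"
    and big: "3 * ln H + 2 * ln (real e) + 20 \<le> 3 / 10 * ln (real (card A))"
  shows "\<exists>A' \<kappa>. A' \<subseteq> A \<and> A' \<noteq> {} \<and> card A \<le> 4 * e * card A' \<and> controlled \<kappa> A' \<and> 0 < \<kappa> \<and>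
    51 / 50 * ln \<kappa> \<le> 140 + 29 * ln H + 22 * ln (real e) + 4152 / 100 * ln K - 54 * ln (real (card A))"
proof -
  define N where "N = card A"
  have N1: "1 \<le> N" unfolding N_def using A by (simp add: Suc_le_eq card_gt_0_iff)
  have "N \<le> N\<^sup>2" using N1 by (simp add: power2_eq_square)
  then have Ne: "card A < 2 ^ e" using e(1) unfolding N_def by (rule le_less_trans)
  have "real N \<le> real (card (A + A))" unfolding N_def by (rule of_nat_mono[OF card_le_card_sumset[OF A(1,2)]])
  then have NK: "real N \<le> K" using K(1) by linarith
  have K0: "0 < K" using NK N1 by linarith
  \<comment> \<open>Levels of maximal weight up to the factor H. A level dominating a large subset
    belongs here, since passing to a subset cannot increase its weight.\<close>
  define \<T> where "\<T> = {i. i < e \<and> (\<forall>j<e. weight A j \<le> H * weight A i)}"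
  have f\<T>: "finite \<T>" "card \<T> \<le> e"
    using card_mono[of "{..<e}" \<T>] finite_subset[of \<T> "{..<e}"] unfolding \<T>_def by auto
  define t where "t i = (2::real) ^ i" for i :: nat
  define n where "n i = real (card (Lam A i))" for i
  have w: "weight A i = n i * t i powr (51 / 25)" for i unfolding weight_def n_def t_def ..
  have n0: "0 < n i" if "i \<in> \<T>" for i
  proof (rule ccontr)
    assume "\<not> 0 < n i"
    then have "weight A i = 0" unfolding w n_def by simp
    then show False using that weight_zero_ge_1[OF A] e(2) unfolding \<T>_def by force
  qed
  have lp: "level_parameters (real N) K (n i) (t i) H (real e)" if i: "i \<in> \<T>" for i
  proof
    show "1 \<le> real N" "0 < K" "0 < n i" "1 \<le> t i" "1 \<le> H" "1 \<le> real e"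
      using N1 K0 n0[OF i] H e(2) unfolding t_def by auto
    show "t i \<le> real N" using of_nat_mono[OF level_le_card[OF A(1), of i], where 'a=real] n0[OF i] unfolding t_def N_def n_def by simp
    show "n i * t i \<le> (real N)\<^sup>2" using of_nat_mono[OF card_Lam_le[OF A(1,3), of i], where 'a=real] unfolding t_def N_def n_def by simp
    show "n i * (t i)\<^sup>2 \<le> 6 * K\<^sup>2" unfolding n_def t_def by (rule card_Lam_le_sumset[OF A K(1)])
    show "ln K \<le> 134 / 100 * ln (real N)" "3 * ln H + 2 * ln (real e) + 20 \<le> 3 / 10 * ln (real N)"
      using KN big unfolding N_def by auto
    obtain j where "j < e" "real N ^ 4 / (8 * K * real e) * ((real N)\<^sup>2 / (4 * K)) powr (1 / 25) \<le> weight A j"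
      using exists_large_weight[OF A Ne e(2) K(2)] unfolding N_def by blast
    then show "real N ^ 4 / (8 * K * real e) * ((real N)\<^sup>2 / (4 * K)) powr (1 / 25) \<le> H * (n i * t i powr (51 / 25))"
      using i unfolding \<T>_def w by force
  qed
  \<comment> \<open>Adding 2 to the floor gives both L >= 2 and L - 1 above the unrounded
    value.\<close>
  define L where "L i = nat \<lfloor>16 * H * K\<^sup>2 / (n i * (t i)\<^sup>2)\<rfloor> + 2" for i
  have Lpos: "0 < L i" for i unfolding L_def by simp
  have t0: "0 < t i" for i unfolding t_def by simp
  define \<theta> where "\<theta> i = (64 * (real e)\<^sup>2 * sqrt (H * n i) * t i powr (1 / 50) * real (L i) ^ 4) powr (50 / 51)" for i
  define M where "M i = 4 * sqrt (H * n i) * t i powr (51 / 50) * \<theta> i powr (- 1 / 50)" for i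
  have \<theta>0: "0 < \<theta> i" if "i \<in> \<T>" for i
    unfolding \<theta>_def powr_gt_zero using n0[OF that] t0[of i] Lpos[of i] H e(2) by simp
  define s where "s i = real (card (Lam A i)) * (real (card A))\<^sup>2 / (16 * H * K * \<theta> i)" for i
  have pop: "N\<^sup>2 \<le> 4 * card {p\<in>A \<times> A. \<exists>i\<in>\<T>. s i \<le> real (popularity A i (fst p * snd p))}"
    unfolding N_def s_def
  proof (rule many_pairs_with_popular_product[OF A Ne e(2) K H, where L = L and M = M])
    fix A1 assume A1: "A1 \<subseteq> A" "card A \<le> 2 * card A1"
    obtain i where i: "i < e" "\<forall>j<e. weight A j \<le> H * weight A1 i" using reg[OF A1] by blast
    have fL: "finite (Lam A i)" by (rule finite_Lam[OF A(1,3)])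
    have "weight A1 i \<le> weight A i" unfolding weight_def
      by (intro mult_right_mono of_nat_mono card_mono fL Lam_mono A A1) simp
    then have "H * weight A1 i \<le> H * weight A i" by (rule mult_left_mono) (use H in simp)
    then have "i \<in> \<T>" unfolding \<T>_def using i by (auto intro: order_trans)
    moreover have "real (card (Lam A i)) \<le> H * real (card (Lam A1 i))"
    proof -
      have "(2 ^ i) powr (51 / 25) * real (card (Lam A i)) \<le> (2 ^ i) powr (51 / 25) * (H * real (card (Lam A1 i)))"
        using i unfolding weight_def by (simp add: mult_ac)
      then show ?thesis by (rule mult_left_le_imp_le) simp
    qed
    ultimately show "\<exists>i\<in>\<T>. real (card (Lam A i)) \<le> H * real (card (Lam A1 i))" by blast
  next
    fix i assume i: "i \<in> \<T>"
    show "0 < card (Lam A i)" using n0[OF i] unfolding n_def by simp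
    show "2 \<le> L i" unfolding L_def by simp
    show "0 < \<theta> i" by (rule \<theta>0[OF i])
    show "0 \<le> M i" unfolding M_def using n0[OF i] H by simp
    show "16 * (real e)\<^sup>2 * M i * real (L i) ^ 4 \<le> \<theta> i * 2 ^ i"
      unfolding M_def \<theta>_def t_def[symmetric]
      by (rule eq_refl, rule threshold_identity) (use n0[OF i] H e(2) t0[of i] Lpos[of i] in simp_all)
    fix x assume "real (card (Lam A i)) \<le> 2 * H * real x"
    then show "4 * K\<^sup>2 < real (x div L i) * (real (L i * (L i - 1)) * (2 ^ i)\<^sup>2)"
      using level_parameters.block_count[OF lp[OF i] _ L_def[of i], of x] unfolding n_def t_def by blast
  next
    fix i j assume i: "i \<in> \<T>" and j: "j < e" and less: "\<theta> i < 2 ^ (j + 1)"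
    have "t j * 2 = 2 ^ (j + 1)" unfolding t_def by simp
    moreover have "2 * t j * sqrt (n j) \<le> M i"
      unfolding M_def
    proof (rule level_weight_bound)
      show "n j * t j powr (51 / 25) \<le> H * (n i * t i powr (51 / 25))"
        using i j unfolding \<T>_def w by blast
      show "\<theta> i < 2 * t j" using less unfolding t_def by simp
    qed (use n0[OF i] \<theta>0[OF i] H in \<open>auto simp: t_def n_def\<close>)
    ultimately show "2 ^ (j + 1) * sqrt (real (card (Lam A j))) \<le> M i"
      unfolding n_def by (simp add: mult_ac)
  qed
  define X where "X i b = {a\<in>A. s i \<le> real (popularity A i (a * b))}" for i b
  have fX: "finite (X i b)" for i b unfolding X_def using A by simp
  have "\<exists>i\<in>\<T>. \<exists>b\<in>A. N \<le> 4 * e * card (X i b)"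
  proof (rule ccontr)
    assume "\<not> ?thesis"
    then have less: "4 * e * card (X i b) < N" if "i \<in> \<T>" "b \<in> A" for i b using that by (auto simp: not_le)
    have "{p\<in>A \<times> A. \<exists>i\<in>\<T>. s i \<le> real (popularity A i (fst p * snd p))} \<subseteq> (\<lambda>((i, b), a). (a, b)) ` (SIGMA q:\<T> \<times> A. X (fst q) (snd q))"
      unfolding X_def by force
    then have "card {p\<in>A \<times> A. \<exists>i\<in>\<T>. s i \<le> real (popularity A i (fst p * snd p))} \<le> card (SIGMA q:\<T> \<times> A. X (fst q) (snd q))"
      by (rule surj_card_le[rotated]) (use f\<T> A fX in auto)
    also have "\<dots> = (\<Sum>q\<in>\<T> \<times> A. card (X (fst q) (snd q)))"
      by (rule card_SigmaI) (use f\<T> A fX in auto)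
    finally have 1: "N\<^sup>2 \<le> 4 * (\<Sum>q\<in>\<T> \<times> A. card (X (fst q) (snd q)))" using pop by linarith
    have ne: "\<T> \<times> A \<noteq> {}"
    proof
      assume em: "\<T> \<times> A = {}"
      have "N\<^sup>2 \<le> 0" using 1 unfolding em by simp
      then show False using N1 by simp
    qed
    have "e * N\<^sup>2 \<le> (\<Sum>q\<in>\<T> \<times> A. 4 * e * card (X (fst q) (snd q)))"
      using mult_le_mono2[OF 1, of e] by (simp add: sum_distrib_left mult_ac)
    also have "\<dots> < (\<Sum>q\<in>\<T> \<times> A. N)"
      by (rule sum_strict_mono) (use ne f\<T> A less in auto)
    also have "\<dots> = card \<T> * N * N" unfolding N_def by (simp add: card_cartesian_product)
    also have "\<dots> \<le> e * N * N" using f\<T> by (intro mult_le_mono1)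
    finally show False by (simp add: power2_eq_square mult_ac)
  qed
  then obtain i b where i: "i \<in> \<T>" and b: "b \<in> A" and c: "N \<le> 4 * e * card (X i b)" by blast
  have s0: "0 < s i" unfolding s_def using n0[OF i] \<theta>0[OF i] N1 K0 H unfolding n_def N_def by simp
  define \<kappa> where "\<kappa> = 2048 * real e ^ 3 * (n i)\<^sup>2 * K\<^sup>2 / (s i) ^ 3"
  have AAe: "card (A * A) < 2 ^ e"
  proof -
    have "card (A * A) \<le> card (A \<times> A)" unfolding set_times_image by (rule card_image_le) (use A in simp)
    then show ?thesis using e(1) by (simp add: card_cartesian_product power2_eq_square)
  qed
  have "controlled \<kappa> (X i b)"
    unfolding \<kappa>_def n_def
    by (rule controlled_if_popular_products[OF A(1,3) _ b s0 _ AAe e(2) K(2)]) (auto simp: X_def)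
  moreover have "0 < \<kappa>" unfolding \<kappa>_def using e(2) n0[OF i] K0 s0 by simp
  moreover have "X i b \<noteq> {}" using c N1 by auto
  moreover have "51 / 50 * ln \<kappa> \<le> 140 + 29 * ln H + 22 * ln (real e) + 4152 / 100 * ln K - 54 * ln (real (card A))"
  proof -
    have g: "0 < 16 * H * K\<^sup>2 / (n i * (t i)\<^sup>2)" using H K0 n0[OF i] unfolding t_def by simp
    have "real (L i) \<le> 16 * H * K\<^sup>2 / (n i * (t i)\<^sup>2) + 2" unfolding L_def using g by linarith
    also have "\<dots> \<le> 16 * H * K\<^sup>2 / (n i * (t i)\<^sup>2) + 12 * H * K\<^sup>2 / (n i * (t i)\<^sup>2)"
      by (rule add_left_mono[OF level_parameters.two_le[OF lp[OF i]]])
    also have "\<dots> = 28 * H * K\<^sup>2 / (n i * (t i)\<^sup>2)" by (simp add: add_divide_distrib[symmetric])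
    finally have L28: "real (L i) \<le> 28 * H * K\<^sup>2 / (n i * (t i)\<^sup>2)" .
    have L0: "0 < real (L i)" using Lpos[of i] by simp
    show ?thesis
      using level_parameters.control_exponent[OF lp[OF i] L0 L28]
      unfolding \<kappa>_def s_def \<theta>_def n_def[symmetric] N_def .
  qed
  ultimately show ?thesis using c unfolding N_def by (intro exI[of _ "X i b"] exI[of _ \<kappa>]) (auto simp: X_def)
qed

section \<open>The sum-product estimates\<close>

lemma difference_set_mono: "A \<subseteq> B \<Longrightarrow> difference_set A A \<subseteq> difference_set B B"
  unfolding difference_set_def by blast

lemma finite_difference_set: "finite A \<Longrightarrow> finite (difference_set A A)" for A :: "real set"
  unfolding difference_set_conv_image by simp

lemma ln_2_bounds: "1 / 2 \<le> ln (2::real)" "ln (2::real) \<le> 1"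
  using ln_le_minus_one[of "1 / 2::real"] ln_le_minus_one[of 2] by (simp_all add: ln_div)

text \<open>The bound 1336/1000 lies above both target exponents and below the 134/100 assumed of
  the parameters; the gap allows for \<open>A0\<close> being smaller than A.\<close>

lemma sum_product_log_inequalities:
  fixes A :: "real set"
  assumes A: "finite A" "A \<noteq> {}" "\<And>a. a \<in> A \<Longrightarrow> 0 < a"
    and e: "(card A)\<^sup>2 < 2 ^ e" "0 < e" and K: "real (card (A + A)) \<le> K" "real (card (A * A)) \<le> K"
    and h: "real h = 1000000" and X: "X = ln (real (card A))"
    and big: "2000 * (real h + ln (real e) + 1) \<le> 4 / 1000 * X"
    and KX: "ln K \<le> 1336 / 1000 * X"
  shows "1270 / 951 * X \<le> ln K"
    and "real (card (difference_set A A)) \<le> K \<Longrightarrow> 144511 / 108174 * X \<le> ln K"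
proof -
  obtain A0 where A0: "A0 \<subseteq> A" "A0 \<noteq> {}" and size: "real (card A) ^ h \<le> real (card A) ^ 4 * real (card A0) ^ h"
    and reg: "\<And>A1. A1 \<subseteq> A0 \<Longrightarrow> card A0 \<le> 2 * card A1 \<Longrightarrow> \<exists>i<e. \<forall>j<e. weight A0 j \<le> 2 ^ h * weight A1 i"
    using exists_weight_regular_subset[OF A e(2), of h] by blast
  have fA0: "finite A0" using A0 A finite_subset by blast
  have pA0: "\<And>a. a \<in> A0 \<Longrightarrow> 0 < a" using A0 A by blast
  have c0: "0 < real (card A0)" "0 < real (card A)" using A0 A fA0 by (simp_all add: card_gt_0_iff)
  have cle: "card A0 \<le> card A" by (rule card_mono[OF A(1) A0(1)])
  define x where "x = ln (real (card A0))"
  define y where "y = ln (real e)"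
  define H where "H = (2::real) ^ h"
  have y0: "0 \<le> y" unfolding y_def using e by simp
  have H1: "1 \<le> H" unfolding H_def by simp
  have lnH: "ln H \<le> 1000000" "0 \<le> ln H"
    unfolding H_def ln_realpow h using ln_2_bounds by simp_all
  \<comment> \<open>Passing to \<open>A0\<close> costs 4/h = 4 * 10^(-6) in the exponent, well
    inside the margin. The price is the factor \<open>H = 2 ^ h\<close>, enormous but
    constant.\<close>
  have hx: "1000000 * X \<le> 4 * X + 1000000 * x"
  proof -
    have "ln (real (card A) ^ h) \<le> ln (real (card A) ^ 4 * real (card A0) ^ h)"
      by (rule ln_mono[OF size]) (use c0 in simp)
    also have "\<dots> = ln (real (card A) ^ 4) + ln (real (card A0) ^ h)"
      using c0 by (intro ln_mult_pos) simp_all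
    finally show ?thesis unfolding ln_realpow X[symmetric] x_def[symmetric] h by simp
  qed
  have big': "2000002000 + 2000 * y \<le> 4 / 1000 * X" using big unfolding h y_def[symmetric] by argo
  have sum_mono': "real (card (B + B)) \<le> K" if "B \<subseteq> A" for B
  proof -
    have "real (card (B + B)) \<le> real (card (A + A))"
      by (intro of_nat_mono card_mono finite_set_plus A set_plus_mono2 that)
    then show ?thesis using K by linarith
  qed
  have prod_mono': "real (card (B * B)) \<le> K" if "B \<subseteq> A" for B
  proof -
    have "real (card (B * B)) \<le> real (card (A * A))"
      by (intro of_nat_mono card_mono finite_set_times A set_times_mono2 that)
    then show ?thesis using K by linarith
  qed
  have e0: "(card A0)\<^sup>2 < 2 ^ e" using power_mono[OF cle, of 2] e(1) by linarith
  have KN: "ln K \<le> 134 / 100 * ln (real (card A0))" using KX hx big' y0 unfolding x_def[symmetric] by linarith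
  have bg: "3 * ln H + 2 * ln (real e) + 20 \<le> 3 / 10 * ln (real (card A0))"
    using lnH hx big' y0 unfolding x_def[symmetric] y_def[symmetric] by linarith
  obtain A' \<kappa> where A': "A' \<subseteq> A0" "A' \<noteq> {}" "card A0 \<le> 4 * e * card A'" "controlled \<kappa> A'" "0 < \<kappa>"
    and \<kappa>: "51 / 50 * ln \<kappa> \<le> 140 + 29 * ln H + 22 * ln (real e) + 4152 / 100 * ln K - 54 * ln (real (card A0))"
    using exists_controlled_subset[OF fA0 A0(2) pA0 e0 e(2) sum_mono'[OF A0(1)] prod_mono'[OF A0(1)] H1 reg[folded H_def] KN bg]
    by blast
  have A'A: "A' \<subseteq> A" using A' A0 by blast
  have fA': "finite A'" using A'A A finite_subset by blast
  define z where "z = ln (real (card A'))"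
  have c': "0 < real (card A')" using A' fA' by (simp add: card_gt_0_iff)
  have zx: "x \<le> 2 + y + z"
  proof -
    have "real (card A0) \<le> real (4 * e * card A')" by (rule of_nat_mono[OF A'(3)])
    then have "x \<le> ln (4 * real e * real (card A'))" unfolding x_def using c0 by (intro ln_mono) simp_all
    also have "\<dots> = ln 4 + y + z" unfolding y_def z_def using e(2) c' by (simp add: ln_mult_pos)
    also have "ln (4::real) \<le> 2" using ln_realpow[of "2::real" 2] ln_2_bounds by simp
    finally show ?thesis by simp
  qed
  have cl: "card A' < 2 ^ e"
  proof -
    have "card A' \<le> card A" by (rule card_mono[OF A(1) A'A])
    also have "card A \<le> (card A)\<^sup>2" by (simp add: power2_eq_square)
    finally show ?thesis using e(1) by linarith
  qed
  have K0: "0 < K"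
  proof -
    have "card A \<le> card (A + A)" by (rule card_le_card_sumset[OF A(1,2)])
    then have "real (card A) \<le> real (card (A + A))" by (rule of_nat_mono)
    then show ?thesis using K(1) c0 by linarith
  qed
  have \<kappa>': "51 * ln \<kappa> \<le> 7000 + 1450 * ln H + 1100 * y + 2076 * ln K - 2700 * x"
    using \<kappa> unfolding y_def[symmetric] x_def[symmetric] by argo
  show "1270 / 951 * X \<le> ln K"
  proof -
    have "real (card A') ^ 41 \<le> 2 ^ 102 * real e ^ 27 * \<kappa> ^ 11 * K ^ 19"
      by (rule controlled_sumset[OF A'(4) fA' A'(2) cl sum_mono'[OF A'A]])
    then have "ln (real (card A') ^ 41) \<le> ln (2 ^ 102 * real e ^ 27 * \<kappa> ^ 11 * K ^ 19)"
      by (rule ln_mono) (use c' in simp)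
    also have "\<dots> = ln (2 ^ 102) + ln (real e ^ 27) + ln (\<kappa> ^ 11) + ln (K ^ 19)"
      using e(2) A'(5) K0 by (simp add: ln_mult_pos)
    finally have "41 * z \<le> 102 * ln 2 + 27 * y + 11 * ln \<kappa> + 19 * ln K"
      unfolding ln_realpow z_def[symmetric] y_def[symmetric] by simp
    then show ?thesis using \<kappa>' zx hx big' lnH y0 ln_2_bounds KX by linarith
  qed
  show "144511 / 108174 * X \<le> ln K" if D: "real (card (difference_set A A)) \<le> K"
  proof -
    have "real (card (difference_set A' A')) \<le> real (card (difference_set A A))"
      by (intro of_nat_mono card_mono finite_difference_set A difference_set_mono A'A)
    then have "real (card (difference_set A' A')) \<le> K" using D by linarith
    then have "real (card A') ^ 11 \<le> 65536 * real e ^ 4 * \<kappa> ^ 3 * K ^ 5"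
      by (rule controlled_difference_set[OF A'(4) fA' A'(2) cl])
    then have "ln (real (card A') ^ 11) \<le> ln (2 ^ 16 * real e ^ 4 * \<kappa> ^ 3 * K ^ 5)"
      by (intro ln_mono) (use c' in simp_all)
    also have "\<dots> = ln (2 ^ 16) + ln (real e ^ 4) + ln (\<kappa> ^ 3) + ln (K ^ 5)"
      using e(2) A'(5) K0 by (simp add: ln_mult_pos)
    finally have "11 * z \<le> 16 * ln 2 + 4 * y + 3 * ln \<kappa> + 5 * ln K"
      unfolding ln_realpow z_def[symmetric] y_def[symmetric] by simp
    then show ?thesis using \<kappa>' zx hx big' lnH y0 ln_2_bounds KX by linarith
  qed
qed

lemma sum_product_positive:
  "\<exists>X0. \<forall>(A::real set) K. finite A \<longrightarrow> A \<noteq> {} \<longrightarrow> (\<forall>a\<in>A. 0 < a) \<longrightarrow> X0 \<le> ln (real (card A)) \<longrightarrow>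
    real (card (A + A)) \<le> K \<longrightarrow> real (card (A * A)) \<le> K \<longrightarrow>
    real (card A) powr (1270 / 951) \<le> K \<and>
    (real (card (difference_set A A)) \<le> K \<longrightarrow> real (card A) powr (144511 / 108174) \<le> K)"
proof -
  have "eventually (\<lambda>x::real. ln x / x < 1 / 1000000) at_top"
    by (rule order_tendstoD(2)[OF ln_x_over_x_tendsto_0]) simp
  then obtain X1 :: real where X1: "\<And>x. X1 \<le> x \<Longrightarrow> ln x / x < 1 / 1000000" unfolding eventually_at_top_linorder by blast
  \<comment> \<open>The size is dictated by h = 10^6: its multiple 2000 h must stay below the share
    of 4/1000 x left after x/500 is spent on logarithms.\<close>
  define X0 where "X0 = max X1 2000000000000"
  obtain h :: nat where h: "real h = 1000000" by (rule that[of 1000000]) simp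
  show ?thesis
  proof (rule exI[of _ X0], intro allI impI)
    fix A :: "real set" and K :: real
    assume A: "finite A" "A \<noteq> {}" "\<forall>a\<in>A. 0 < a" and X: "X0 \<le> ln (real (card A))"
      and K: "real (card (A + A)) \<le> K" "real (card (A * A)) \<le> K"
    define x where "x = ln (real (card A))"
    have x: "2000000000000 \<le> x" "X1 \<le> x" using X unfolding X0_def x_def by auto
    have c: "0 < real (card A)" using A by (simp add: card_gt_0_iff)
    \<comment> \<open>As ln 2 >= 1/2, this gives e ln 2 >= 5 x / 2 > 2 x, so 2^e exceeds the square
      of \<open>card A\<close>, while e is still only a multiple of x.\<close>
    define e where "e = nat \<lceil>5 * x\<rceil> + 1"
    have e: "5 * x \<le> real e" "real e \<le> 7 * x" "0 < e" unfolding e_def using x by linarith+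
    have "(card A)\<^sup>2 < 2 ^ e"
    proof -
      have "2 * x < real e * ln 2" using mult_mono[OF e(1) ln_2_bounds(1)] x e by linarith
      then have "ln ((real (card A))\<^sup>2) < ln (2 ^ e)" unfolding ln_realpow x_def[symmetric] by simp
      then have "(real (card A))\<^sup>2 < 2 ^ e" using c by (subst (asm) ln_less_cancel_iff) auto
      then have "real ((card A)\<^sup>2) < real (2 ^ e)" by simp
      then show ?thesis by (simp only: of_nat_less_iff)
    qed
    moreover have "2000 * (real h + ln (real e) + 1) \<le> 4 / 1000 * x"
    proof -
      have "ln (real e) \<le> ln (7 * x)" by (rule ln_mono[OF e(2)]) (use e in simp)
      also have "\<dots> = ln 7 + ln x" using x by (simp add: ln_mult_pos)
      also have "ln (7::real) \<le> 6" using ln_le_minus_one[of 7] by simp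
      also have "ln x \<le> x / 1000000" using X1[OF x(2)] x by (simp add: field_simps)
      finally have "ln (real e) \<le> 6 + x / 1000000" by simp
      then have "2000 * ln (real e) \<le> 12000 + x / 500" by argo
      then show ?thesis unfolding h using x by argo
    qed
    ultimately have main: "1270 / 951 * x \<le> ln K" "real (card (difference_set A A)) \<le> K \<Longrightarrow> 144511 / 108174 * x \<le> ln K"
      if "ln K \<le> 1336 / 1000 * x"
      using sum_product_log_inequalities[OF A(1,2) _ _ e(3) K h x_def _ that] A(3) by blast+
    have "real (card A) \<le> real (card (A + A))" by (rule of_nat_mono[OF card_le_card_sumset[OF A(1,2)]])
    then have K0: "0 < K" using c K by linarith
    have conv: "real (card A) powr d \<le> K" if "d * x \<le> ln K" for d
    proof -
      have "ln (real (card A) powr d) \<le> ln K" using that unfolding x_def by simp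
      then show ?thesis using K0 c by (subst (asm) ln_le_cancel_iff) auto
    qed
    show "real (card A) powr (1270 / 951) \<le> K \<and>
      (real (card (difference_set A A)) \<le> K \<longrightarrow> real (card A) powr (144511 / 108174) \<le> K)"
    \<comment> \<open>Both target exponents are below 1.336, so larger K satisfies the claims at
      once.\<close>
    proof (cases "ln K \<le> 1336 / 1000 * x")
      case True
      then show ?thesis using main conv by blast
    next
      case False
      have "1270 / 951 * x \<le> ln K" "144511 / 108174 * x \<le> ln K" using False x by linarith+
      then show ?thesis using conv by blast
    qed
  qed
qed

section \<open>Reduction to positive sets and conclusion\<close>

text \<open>Either the positive part or the reflected negative part serves. Reflection negates sums,
  keeps products and reverses differences, so no set grows; the 1 accounts for the element
  0.\<close>

lemma exists_positive_half:
  fixes A :: "real set"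
  assumes "finite A"
  shows "\<exists>B::real set. finite B \<and> (\<forall>b\<in>B. 0 < b) \<and> card A \<le> 2 * card B + 1 \<and>
    card (B + B) \<le> card (A + A) \<and> card (B * B) \<le> card (A * A) \<and>
    card (difference_set B B) \<le> card (difference_set A A)"
proof -
  define P where "P = {a\<in>A. 0 < a}"
  define M where "M = {a\<in>A. a < 0}"
  define Q where "Q = uminus ` M"
  have fin: "finite P" "finite M" "finite Q" unfolding P_def M_def Q_def using assms by simp_all
  have "A \<subseteq> insert 0 (P \<union> M)" unfolding P_def M_def by auto
  then have "card A \<le> card (insert 0 (P \<union> M))" by (rule card_mono[rotated]) (use fin in simp)
  also have "\<dots> \<le> card (P \<union> M) + 1" using card_insert_le_m1[of "card (P \<union> M) + 1" "P \<union> M" 0] by simp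
  also have "\<dots> \<le> card P + card M + 1" using card_Un_le[of P M] by simp
  also have "card M = card Q" unfolding Q_def by (simp add: card_image)
  finally have c: "card A \<le> card P + card Q + 1" .
  have fA: "finite (A + A)" "finite (A * A)" "finite (difference_set A A)"
    using assms by (simp_all add: finite_set_plus finite_set_times finite_difference_set)
  have PA: "P \<subseteq> A" unfolding P_def by blast
  have P: "card (P + P) \<le> card (A + A)" "card (P * P) \<le> card (A * A)" "card (difference_set P P) \<le> card (difference_set A A)"
    by (intro card_mono fA set_plus_mono2 set_times_mono2 difference_set_mono PA)+
  have QA: "- q \<in> A" "0 < q" if "q \<in> Q" for q using that unfolding Q_def M_def by auto
  have "Q + Q \<subseteq> uminus ` (A + A)"
  proof
    fix w assume "w \<in> Q + Q"
    then obtain p q where "w = p + q" "p \<in> Q" "q \<in> Q" by (rule set_plus_elim)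
    then have "w = - (- p + - q)" "- p + - q \<in> A + A" using QA by (simp, intro set_plus_intro)
    then show "w \<in> uminus ` (A + A)" by blast
  qed
  then have "card (Q + Q) \<le> card (uminus ` (A + A))" by (rule card_mono[rotated]) (use fA in simp)
  then have Q1: "card (Q + Q) \<le> card (A + A)" by (simp add: card_image)
  have "Q * Q \<subseteq> A * A"
  proof
    fix w assume "w \<in> Q * Q"
    then obtain p q where "w = p * q" "p \<in> Q" "q \<in> Q" by (rule set_times_elim)
    then have "w = - p * - q" "- p * - q \<in> A * A" using QA by (simp, intro set_times_intro)
    then show "w \<in> A * A" by simp
  qed
  then have Q2: "card (Q * Q) \<le> card (A * A)" by (rule card_mono[OF fA(2)])
  have "difference_set Q Q \<subseteq> difference_set A A"
  proof
    fix w assume "w \<in> difference_set Q Q"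
    then obtain p q where "w = p - q" "p \<in> Q" "q \<in> Q" unfolding difference_set_def by blast
    then have "w = - q - - p" "- q \<in> A" "- p \<in> A" using QA by simp_all
    then show "w \<in> difference_set A A" unfolding difference_set_def by blast
  qed
  then have Q3: "card (difference_set Q Q) \<le> card (difference_set A A)" by (rule card_mono[OF fA(3)])
  show ?thesis
  proof (cases "card Q \<le> card P")
    case True
    then have le: "card A \<le> 2 * card P + 1" using c by linarith
    have pos: "\<forall>b\<in>P. 0 < b" unfolding P_def by blast
    have "finite P \<and> (\<forall>b\<in>P. 0 < b) \<and> card A \<le> 2 * card P + 1 \<and>
      card (P + P) \<le> card (A + A) \<and> card (P * P) \<le> card (A * A) \<and>
      card (difference_set P P) \<le> card (difference_set A A)"
      by (intro conjI fin(1) pos le P)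
    then show ?thesis by (rule exI)
  next
    case False
    then have le: "card A \<le> 2 * card Q + 1" using c by linarith
    have pos: "\<forall>b\<in>Q. 0 < b" using QA(2) by blast
    have "finite Q \<and> (\<forall>b\<in>Q. 0 < b) \<and> card A \<le> 2 * card Q + 1 \<and>
      card (Q + Q) \<le> card (A + A) \<and> card (Q * Q) \<le> card (A * A) \<and>
      card (difference_set Q Q) \<le> card (difference_set A A)"
      by (intro conjI fin(3) pos le Q1 Q2 Q3)
    then show ?thesis by (rule exI)
  qed
qed

text \<open>For large m, n <= 3 m costs a factor 3^c <= 9. For 0 < m < exp X0, n is at most 3 exp X0
  and c <= 2 bounds n^c by its square; m = 0 forces n = 1. As n >= 1, the exponent c may be lowered
  to c - \<epsilon>.\<close>

lemma powr_le_of_positive_half: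
  fixes n m :: nat and \<epsilon> c K X0 :: real
  assumes "0 < \<epsilon>" "0 < c" "c \<le> 2" "n \<le> 2 * m + 1" "1 \<le> n" "1 \<le> K"
    and "0 < m \<Longrightarrow> X0 \<le> ln (real m) \<Longrightarrow> real m powr c \<le> K"
  shows "real n powr (c - \<epsilon>) \<le> (9 + (3 * exp X0)\<^sup>2) * K"
proof -
  have n: "1 \<le> real n" using assms(5) by simp
  have "real n powr (c - \<epsilon>) \<le> real n powr c" using n assms(1) by (intro powr_mono) auto
  also have "\<dots> \<le> (9 + (3 * exp X0)\<^sup>2) * K"
  proof (cases "0 < m \<and> X0 \<le> ln (real m)")
    case True
    have "real n \<le> 3 * real m" using assms(4) True by linarith
    then have "real n powr c \<le> (3 * real m) powr c" using assms by (intro powr_mono2) auto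
    also have "\<dots> = 3 powr c * real m powr c" by (simp add: powr_mult)
    also have "\<dots> \<le> 3 powr 2 * K"
      using assms(7) True assms(3) by (intro mult_mono powr_mono) auto
    also have "\<dots> = 9 * K" by (simp add: powr_numeral)
    also have "\<dots> \<le> (9 + (3 * exp X0)\<^sup>2) * K" using assms(6) by (intro mult_right_mono) auto
    finally show ?thesis .
  next
    case False
    have n2: "real n powr c \<le> (real n)\<^sup>2"
      using powr_mono[OF assms(3) n] n by (simp add: powr_numeral)
    have "(real n)\<^sup>2 \<le> 9 + (3 * exp X0)\<^sup>2"
    proof (cases "m = 0")
      case True
      then have "n = 1" using assms(4,5) by simp
      then show ?thesis by (simp add: add_increasing2)
    next
      case m: False
      then have "ln (real m) < X0" using False by simp
      then have "exp (ln (real m)) < exp X0" by (simp only: exp_less_cancel_iff)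
      then have "real m < exp X0" using m by simp
      then have "real n \<le> 3 * exp X0" using assms(4) m by linarith
      then have "(real n)\<^sup>2 \<le> (3 * exp X0)\<^sup>2" by (intro power_mono) auto
      then show ?thesis by simp
    qed
    then have "real n powr c \<le> (9 + (3 * exp X0)\<^sup>2) * 1" unfolding mult_1_right by (rule order_trans[OF n2])
    also have "\<dots> \<le> (9 + (3 * exp X0)\<^sup>2) * K" by (rule mult_left_mono[OF assms(6)]) simp
    finally show ?thesis .
  qed
  finally show ?thesis .
qed

theorem theorem1p4:
  fixes \<epsilon> :: real
  assumes "\<epsilon> > 0"
  shows "(\<exists>C::real. C > 0 \<and> (\<forall>A::real set. finite A \<and> A \<noteq> {} \<longrightarrow>
            real (card A) powr (1270 / 951 - \<epsilon>)
              \<le> C * real (max (card (A + A)) (card (A * A)))))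
       \<and> (\<exists>C::real. C > 0 \<and> (\<forall>A::real set. finite A \<and> A \<noteq> {} \<longrightarrow>
            real (card A) powr (144511 / 108174 - \<epsilon>)
              \<le> C * real (max (card (difference_set A A)) (max (card (A + A)) (card (A * A))))))"
proof -
  obtain X0 where X0: "\<And>(B::real set) K. finite B \<Longrightarrow> B \<noteq> {} \<Longrightarrow> (\<forall>b\<in>B. 0 < b) \<Longrightarrow> X0 \<le> ln (real (card B)) \<Longrightarrow>
    real (card (B + B)) \<le> K \<Longrightarrow> real (card (B * B)) \<le> K \<Longrightarrow>
    real (card B) powr (1270 / 951) \<le> K \<and>
    (real (card (difference_set B B)) \<le> K \<longrightarrow> real (card B) powr (144511 / 108174) \<le> K)"
    using sum_product_positive by blast
  define C where "C = 9 + (3 * exp X0)\<^sup>2"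
  have C0: "0 < C" unfolding C_def by (simp add: add_pos_nonneg)
  have "real (card A) powr (1270 / 951 - \<epsilon>) \<le> C * real (max (card (A + A)) (card (A * A))) \<and>
      real (card A) powr (144511 / 108174 - \<epsilon>)
        \<le> C * real (max (card (difference_set A A)) (max (card (A + A)) (card (A * A))))"
    if A: "finite A" "A \<noteq> {}" for A :: "real set"
  proof -
    obtain B :: "real set" where B: "finite B" "\<forall>b\<in>B. 0 < b" "card A \<le> 2 * card B + 1" "card (B + B) \<le> card (A + A)"
      "card (B * B) \<le> card (A * A)" "card (difference_set B B) \<le> card (difference_set A A)"
      using exists_positive_half[OF A(1)] by blast
    have A1: "1 \<le> card A" using A by (simp add: Suc_le_eq card_gt_0_iff)
    have S1: "1 \<le> card (A + A)" using card_le_card_sumset[OF A] A1 by linarith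
    let ?K = "max (card (A + A)) (card (A * A))"
    let ?K' = "max (card (difference_set A A)) ?K"
    have le: "card (B + B) \<le> ?K" "card (B * B) \<le> ?K" "card (B + B) \<le> ?K'" "card (B * B) \<le> ?K'"
      "card (difference_set B B) \<le> ?K'" "1 \<le> ?K" "1 \<le> ?K'" using B S1 by linarith+
    have ne: "B \<noteq> {}" if "0 < card B" using that by auto
    show ?thesis
      unfolding C_def
    proof
      show "real (card A) powr (1270 / 951 - \<epsilon>) \<le> (9 + (3 * exp X0)\<^sup>2) * real ?K"
      proof (rule powr_le_of_positive_half[OF assms _ _ B(3) A1])
        assume "0 < card B" "X0 \<le> ln (real (card B))"
        then show "real (card B) powr (1270 / 951) \<le> real ?K"
          using X0[OF B(1) ne B(2) _ of_nat_mono[OF le(1)] of_nat_mono[OF le(2)]] by blast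
      qed (use of_nat_mono[OF le(6), where 'a=real] in simp_all)
      show "real (card A) powr (144511 / 108174 - \<epsilon>) \<le> (9 + (3 * exp X0)\<^sup>2) * real ?K'"
      proof (rule powr_le_of_positive_half[OF assms _ _ B(3) A1])
        assume "0 < card B" "X0 \<le> ln (real (card B))"
        then show "real (card B) powr (144511 / 108174) \<le> real ?K'"
          using X0[OF B(1) ne B(2) _ of_nat_mono[OF le(3)] of_nat_mono[OF le(4)]] of_nat_mono[OF le(5), where 'a=real] by blast
      qed (use of_nat_mono[OF le(7), where 'a=real] in simp_all)
    qed
  qed
  then show ?thesis using C0 by blast
qed

end
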